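(* Let $T$ be a complete theory with infinite models in a language $\mathcal L\supseteq\mathcal L_{\mathrm{ring}}$, extending the theory of fields, and suppose $T$ is pregeometric. If $T$ is rosy, then $T$ is surgical, i.e. $T$ is superrosy of þ-rank $1$.
   Context: $T$ is pregeometric if in every model of $T$ the algebraic closure $\mathrm{acl}_{\mathcal L}$ satisfies exchange. The paper uses "surgical" to mean superrosy of þ-rank $1$, where the þ-rank of $T$ is the supremum of the þ-ranks of unary (real) types over $\emptyset$. *)

theory Defs
  imports Main
begin

unbundle cardinal_syntax

text \<open>
  Many-sorted first-order logic. A sort context is a list of sorts. In a formula over the context
  \<open>\<Gamma>\<close> the variable \<open>Var i\<close> (a de Bruijn index) has sort \<open>\<Gamma> ! i\<close>, and \<open>Ex s\<close> binds index \<open>0\<close>.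
  Thus a formula \<open>\<delta>(x, y)\<close> with \<open>x\<close> of sorts \<open>\<Gamma>\<close> and \<open>y\<close> of sorts \<open>\<Delta>\<close> is a formula over
  \<open>\<Gamma> @ \<Delta>\<close>, and the instance \<open>\<delta>(x, a)\<close> is given by \<open>\<delta>\<close> together with the tuple \<open>a\<close>.
  One-sorted languages are those with sort type \<^typ>\<open>unit\<close>.
\<close>

record ('s, 'f, 'r) language =
  sorts :: "'s set"
  funs :: "'f set"
  rels :: "'r set"
  fun_dom :: "'f \<Rightarrow> 's list"
  fun_cod :: "'f \<Rightarrow> 's"
  rel_dom :: "'r \<Rightarrow> 's list"

record ('s, 'f, 'r, 'a) struct =
  carrier :: "'s \<Rightarrow> 'a set"
  fun_interp :: "'f \<Rightarrow> 'a list \<Rightarrow> 'a"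
  rel_interp :: "'r \<Rightarrow> 'a list \<Rightarrow> bool"

datatype 'f tm = Var nat | Fn 'f "'f tm list"

datatype ('s, 'f, 'r) fm =
    Equal "'f tm" "'f tm"
  | Rel 'r "'f tm list"
  | Neg "('s, 'f, 'r) fm"
  | Conj "('s, 'f, 'r) fm" "('s, 'f, 'r) fm"
  | Ex 's "('s, 'f, 'r) fm"

fun has_sort :: "('s, 'f, 'r) language \<Rightarrow> 's list \<Rightarrow> 'f tm \<Rightarrow> 's \<Rightarrow> bool" where
  "has_sort L \<Gamma> (Var i) s \<longleftrightarrow> i < length \<Gamma> \<and> \<Gamma> ! i = s"
| "has_sort L \<Gamma> (Fn f ts) s \<longleftrightarrow>
     f \<in> funs L \<and> fun_cod L f = s \<and> list_all2 (has_sort L \<Gamma>) ts (fun_dom L f)"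

fun wf_fm :: "('s, 'f, 'r) language \<Rightarrow> 's list \<Rightarrow> ('s, 'f, 'r) fm \<Rightarrow> bool" where
  "wf_fm L \<Gamma> (Equal t u) \<longleftrightarrow> (\<exists>s\<in>sorts L. has_sort L \<Gamma> t s \<and> has_sort L \<Gamma> u s)"
| "wf_fm L \<Gamma> (Rel r ts) \<longleftrightarrow> r \<in> rels L \<and> list_all2 (has_sort L \<Gamma>) ts (rel_dom L r)"
| "wf_fm L \<Gamma> (Neg \<phi>) \<longleftrightarrow> wf_fm L \<Gamma> \<phi>"
| "wf_fm L \<Gamma> (Conj \<phi> \<psi>) \<longleftrightarrow> wf_fm L \<Gamma> \<phi> \<and> wf_fm L \<Gamma> \<psi>"
| "wf_fm L \<Gamma> (Ex s \<phi>) \<longleftrightarrow> s \<in> sorts L \<and> wf_fm L (s # \<Gamma>) \<phi>"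

fun eval :: "('s, 'f, 'r, 'a) struct \<Rightarrow> 'a list \<Rightarrow> 'f tm \<Rightarrow> 'a" where
  "eval M e (Var i) = e ! i"
| "eval M e (Fn f ts) = fun_interp M f (map (eval M e) ts)"

fun sat :: "('s, 'f, 'r, 'a) struct \<Rightarrow> 'a list \<Rightarrow> ('s, 'f, 'r) fm \<Rightarrow> bool" where
  "sat M e (Equal t u) \<longleftrightarrow> eval M e t = eval M e u"
| "sat M e (Rel r ts) \<longleftrightarrow> rel_interp M r (map (eval M e) ts)"
| "sat M e (Neg \<phi>) \<longleftrightarrow> \<not> sat M e \<phi>"
| "sat M e (Conj \<phi> \<psi>) \<longleftrightarrow> sat M e \<phi> \<and> sat M e \<psi>"
| "sat M e (Ex s \<phi>) \<longleftrightarrow> (\<exists>x\<in>carrier M s. sat M (x # e) \<phi>)"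

definition sentences :: "('s, 'f, 'r) language \<Rightarrow> ('s, 'f, 'r) fm set" where
  "sentences L = {\<sigma>. wf_fm L [] \<sigma>}"

definition formulas :: "('s, 'f, 'r) language \<Rightarrow> ('s, 'f, 'r) fm set" where
  "formulas L = {\<phi>. \<exists>\<Gamma>. set \<Gamma> \<subseteq> sorts L \<and> wf_fm L \<Gamma> \<phi>}"

definition tuples :: "('s, 'f, 'r, 'a) struct \<Rightarrow> 's list \<Rightarrow> 'a list set" where
  "tuples M \<Gamma> = {a. list_all2 (\<lambda>x s. x \<in> carrier M s) a \<Gamma>}"

definition elements :: "('s, 'f, 'r) language \<Rightarrow> ('s, 'f, 'r, 'a) struct \<Rightarrow> 'a set" where
  "elements L M = (\<Union>s\<in>sorts L. carrier M s)"

definition is_structure :: "('s, 'f, 'r) language \<Rightarrow> ('s, 'f, 'r, 'a) struct \<Rightarrow> bool" where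
  "is_structure L M \<longleftrightarrow>
     (\<forall>s\<in>sorts L. carrier M s \<noteq> {}) \<and>
     (\<forall>f\<in>funs L. \<forall>a\<in>tuples M (fun_dom L f). fun_interp M f a \<in> carrier M (fun_cod L f))"

definition Mod :: "('s, 'f, 'r) language \<Rightarrow> ('s, 'f, 'r) fm set \<Rightarrow> ('s, 'f, 'r, 'a) struct set" where
  "Mod L T = {M. is_structure L M \<and> (\<forall>\<sigma>\<in>T. sat M [] \<sigma>)}"

text \<open>
  HOL cannot quantify over the types in which the universes of models live, so statements about all
  models refer to the models with universe in a type \<open>'a\<close>. By the Loewenheim--Skolem theorem this is
  no restriction as soon as \<open>'a\<close> has at least as many elements as there are formulas.
\<close>

definition entails :: "'a itself \<Rightarrow> ('s, 'f, 'r) language \<Rightarrow> ('s, 'f, 'r) fm set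
    \<Rightarrow> ('s, 'f, 'r) fm \<Rightarrow> bool" where
  "entails _ L T \<sigma> \<longleftrightarrow> (\<forall>M \<in> (Mod L T :: ('s, 'f, 'r, 'a) struct set). sat M [] \<sigma>)"

definition complete_theory :: "'a itself \<Rightarrow> ('s, 'f, 'r) language \<Rightarrow> ('s, 'f, 'r) fm set \<Rightarrow> bool"
  where
  "complete_theory U L T \<longleftrightarrow>
     T \<subseteq> sentences L \<and>
     (Mod L T :: ('s, 'f, 'r, 'a) struct set) \<noteq> {} \<and>
     (\<forall>\<sigma>\<in>sentences L. entails U L T \<sigma> \<or> entails U L T (Neg \<sigma>))"

definition has_infinite_models :: "'a itself \<Rightarrow> (unit, 'f, 'r) language \<Rightarrow> (unit, 'f, 'r) fm set
    \<Rightarrow> bool" where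
  "has_infinite_models _ L T \<longleftrightarrow>
     (\<exists>M \<in> (Mod L T :: (unit, 'f, 'r, 'a) struct set). infinite (carrier M ()))"

definition sublanguage :: "('s, 'f, 'r) language \<Rightarrow> ('s, 'f, 'r) language \<Rightarrow> bool" where
  "sublanguage L L' \<longleftrightarrow>
     sorts L \<subseteq> sorts L' \<and> funs L \<subseteq> funs L' \<and> rels L \<subseteq> rels L' \<and>
     (\<forall>f\<in>funs L. fun_dom L f = fun_dom L' f \<and> fun_cod L f = fun_cod L' f) \<and>
     (\<forall>r\<in>rels L. rel_dom L r = rel_dom L' r)"


section \<open>The language of rings and the theory of fields\<close>

text \<open>Languages extending the language of rings have function symbols in \<open>ring_sym + 'f\<close>.\<close>

datatype ring_sym = Zero | One | Plus | Minus | Times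

definition ring_language :: "(unit, ring_sym + 'f, 'r) language" where
  "ring_language =
     \<lparr>sorts = {()}, funs = range Inl, rels = {},
      fun_dom = (\<lambda>f. case f of
          Inl Zero \<Rightarrow> [] | Inl One \<Rightarrow> [] | Inl Minus \<Rightarrow> [()]
        | Inl Plus \<Rightarrow> [(), ()] | Inl Times \<Rightarrow> [(), ()] | Inr _ \<Rightarrow> []),
      fun_cod = (\<lambda>_. ()), rel_dom = (\<lambda>_. [])\<rparr>"

abbreviation All1 :: "(unit, 'f, 'r) fm \<Rightarrow> (unit, 'f, 'r) fm" where
  "All1 \<phi> \<equiv> Neg (Ex () (Neg \<phi>))"

abbreviation Disj :: "('s, 'f, 'r) fm \<Rightarrow> ('s, 'f, 'r) fm \<Rightarrow> ('s, 'f, 'r) fm" where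
  "Disj \<phi> \<psi> \<equiv> Neg (Conj (Neg \<phi>) (Neg \<psi>))"

abbreviation tzero :: "(ring_sym + 'f) tm" where "tzero \<equiv> Fn (Inl Zero) []"
abbreviation tone :: "(ring_sym + 'f) tm" where "tone \<equiv> Fn (Inl One) []"
abbreviation tminus :: "(ring_sym + 'f) tm \<Rightarrow> (ring_sym + 'f) tm" where
  "tminus t \<equiv> Fn (Inl Minus) [t]"
abbreviation tplus :: "(ring_sym + 'f) tm \<Rightarrow> (ring_sym + 'f) tm \<Rightarrow> (ring_sym + 'f) tm" where
  "tplus t u \<equiv> Fn (Inl Plus) [t, u]"
abbreviation ttimes :: "(ring_sym + 'f) tm \<Rightarrow> (ring_sym + 'f) tm \<Rightarrow> (ring_sym + 'f) tm" where
  "ttimes t u \<equiv> Fn (Inl Times) [t, u]"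

definition field_axioms :: "(unit, ring_sym + 'f, 'r) fm set" where
  "field_axioms =
    (let x = Var 2; y = Var 1; z = Var 0 in
     {All1 (All1 (All1 (Equal (tplus x (tplus y z)) (tplus (tplus x y) z)))),
      All1 (All1 (Equal (tplus y z) (tplus z y))),
      All1 (Equal (tplus z tzero) z),
      All1 (Equal (tplus z (tminus z)) tzero),
      All1 (All1 (All1 (Equal (ttimes x (ttimes y z)) (ttimes (ttimes x y) z)))),
      All1 (All1 (Equal (ttimes y z) (ttimes z y))),
      All1 (Equal (ttimes z tone) z),
      All1 (All1 (All1 (Equal (ttimes x (tplus y z)) (tplus (ttimes x y) (ttimes x z))))),
      Neg (Equal tzero tone),
      All1 (Disj (Equal z tzero) (Ex () (Equal (ttimes y z) tone)))})"


section \<open>Pregeometric theories\<close>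

definition acl :: "('s, 'f, 'r) language \<Rightarrow> ('s, 'f, 'r, 'a) struct \<Rightarrow> 'a set \<Rightarrow> 'a set" where
  "acl L M A = {b. \<exists>s \<phi> \<Theta> c. s \<in> sorts L \<and> b \<in> carrier M s \<and>
      set \<Theta> \<subseteq> sorts L \<and> c \<in> tuples M \<Theta> \<and> set c \<subseteq> A \<and> wf_fm L (s # \<Theta>) \<phi> \<and>
      sat M (b # c) \<phi> \<and> finite {x \<in> carrier M s. sat M (x # c) \<phi>}}"

definition acl_exchange :: "('s, 'f, 'r) language \<Rightarrow> ('s, 'f, 'r, 'a) struct \<Rightarrow> bool" where
  "acl_exchange L M \<longleftrightarrow>
     (\<forall>A a b. A \<subseteq> elements L M \<longrightarrow> a \<in> elements L M \<longrightarrow> b \<in> elements L M \<longrightarrow>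
        a \<in> acl L M (insert b A) \<longrightarrow> a \<notin> acl L M A \<longrightarrow> b \<in> acl L M (insert a A))"

definition pregeometric :: "'a itself \<Rightarrow> (unit, 'f, 'r) language \<Rightarrow> (unit, 'f, 'r) fm set \<Rightarrow> bool"
  where
  "pregeometric _ L T \<longleftrightarrow> (\<forall>M \<in> (Mod L T :: (unit, 'f, 'r, 'a) struct set). acl_exchange L M)"


section \<open>Monster models\<close>

text \<open>A set of formulas over \<open>A\<close> in variables of sorts \<open>\<Gamma>\<close> is a set of pairs \<open>(\<phi>, c)\<close> standing
  for \<open>\<phi>(x, c)\<close>, where \<open>c\<close> is a tuple from \<open>A\<close>.\<close>

definition param_formulas :: "('s, 'f, 'r) language \<Rightarrow> ('s, 'f, 'r, 'a) struct \<Rightarrow> 's list \<Rightarrow> 'a set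
    \<Rightarrow> (('s, 'f, 'r) fm \<times> 'a list) set" where
  "param_formulas L M \<Gamma> A = {(\<phi>, c). set c \<subseteq> A \<and>
     (\<exists>\<Theta>. set \<Theta> \<subseteq> sorts L \<and> c \<in> tuples M \<Theta> \<and> wf_fm L (\<Gamma> @ \<Theta>) \<phi>)}"

definition saturated :: "('s, 'f, 'r) language \<Rightarrow> 'k rel \<Rightarrow> ('s, 'f, 'r, 'a) struct \<Rightarrow> bool" where
  "saturated L \<kappa> M \<longleftrightarrow>
     (\<forall>A \<Gamma> \<Sigma>. A \<subseteq> elements L M \<longrightarrow> |A| <o \<kappa> \<longrightarrow> set \<Gamma> \<subseteq> sorts L \<longrightarrow>
        \<Sigma> \<subseteq> param_formulas L M \<Gamma> A \<longrightarrow>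
        (\<forall>F \<subseteq> \<Sigma>. finite F \<longrightarrow> (\<exists>a\<in>tuples M \<Gamma>. \<forall>(\<phi>, c)\<in>F. sat M (a @ c) \<phi>)) \<longrightarrow>
        (\<exists>a\<in>tuples M \<Gamma>. \<forall>(\<phi>, c)\<in>\<Sigma>. sat M (a @ c) \<phi>))"

definition elementary_on :: "('s, 'f, 'r) language \<Rightarrow> ('s, 'f, 'r, 'a) struct \<Rightarrow> 'a set
    \<Rightarrow> ('a \<Rightarrow> 'a) \<Rightarrow> bool" where
  "elementary_on L M A h \<longleftrightarrow>
     (\<forall>\<Theta> c. set \<Theta> \<subseteq> sorts L \<longrightarrow> c \<in> tuples M \<Theta> \<longrightarrow> set c \<subseteq> A \<longrightarrow>
        map h c \<in> tuples M \<Theta> \<and>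
        (\<forall>\<phi>. wf_fm L \<Theta> \<phi> \<longrightarrow> sat M (map h c) \<phi> = sat M c \<phi>))"

definition automorphism :: "('s, 'f, 'r) language \<Rightarrow> ('s, 'f, 'r, 'a) struct \<Rightarrow> ('a \<Rightarrow> 'a) \<Rightarrow> bool"
  where
  "automorphism L M g \<longleftrightarrow>
     (\<forall>s\<in>sorts L. bij_betw g (carrier M s) (carrier M s)) \<and>
     (\<forall>f\<in>funs L. \<forall>a\<in>tuples M (fun_dom L f). fun_interp M f (map g a) = g (fun_interp M f a)) \<and>
     (\<forall>r\<in>rels L. \<forall>a\<in>tuples M (rel_dom L r). rel_interp M r (map g a) = rel_interp M r a)"

definition strongly_homogeneous :: "('s, 'f, 'r) language \<Rightarrow> 'k rel \<Rightarrow> ('s, 'f, 'r, 'a) struct \<Rightarrow> bool"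
  where
  "strongly_homogeneous L \<kappa> M \<longleftrightarrow>
     (\<forall>A h. A \<subseteq> elements L M \<longrightarrow> |A| <o \<kappa> \<longrightarrow> elementary_on L M A h \<longrightarrow>
        (\<exists>g. automorphism L M g \<and> (\<forall>x\<in>A. g x = h x)))"

text \<open>A set is small if its cardinality is less than \<open>\<kappa>\<close>; there are \<open>|L| + \<aleph>\<^sub>0\<close> formulas.\<close>

definition monster_model :: "('s, 'f, 'r) language \<Rightarrow> ('s, 'f, 'r) fm set \<Rightarrow> 'k rel
    \<Rightarrow> ('s, 'f, 'r, 'a) struct \<Rightarrow> bool" where
  "monster_model L T \<kappa> M \<longleftrightarrow>
     Card_order \<kappa> \<and> |formulas L| <o \<kappa> \<and>
     M \<in> Mod L T \<and> saturated L \<kappa> M \<and> strongly_homogeneous L \<kappa> M"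


section \<open>Imaginaries\<close>

text \<open>
  For a one-sorted structure \<open>M\<close>, the structure \<open>M\<^sup>e\<^sup>q\<close> has the home sort and, for every formula
  \<open>E(x\<^sub>1, \<dots>, x\<^sub>n, y\<^sub>1, \<dots>, y\<^sub>n)\<close> without parameters defining an equivalence relation on \<open>M\<^sup>n\<close>, a sort
  for the quotient \<open>M\<^sup>n / E\<close> together with the projection \<open>M\<^sup>n \<rightarrow> M\<^sup>n / E\<close>. If \<open>M\<close> is a model of a
  complete theory, the set of sorts depends only on that theory.
\<close>

datatype ('f, 'r) eq_sort = Home | Quot nat "(unit, 'f, 'r) fm"

datatype ('f, 'r) eq_fun = Base 'f | Proj nat "(unit, 'f, 'r) fm"

datatype ('f, 'r, 'a) eq_elem = Real (the_real: 'a) | Class nat "(unit, 'f, 'r) fm" "'a list set"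

abbreviation cart_power :: "(unit, 'f, 'r, 'a) struct \<Rightarrow> nat \<Rightarrow> 'a list set" where
  "cart_power M n \<equiv> tuples M (replicate n ())"

definition def_rel :: "(unit, 'f, 'r, 'a) struct \<Rightarrow> nat \<Rightarrow> (unit, 'f, 'r) fm
    \<Rightarrow> ('a list \<times> 'a list) set" where
  "def_rel M n E = {(a, b) \<in> cart_power M n \<times> cart_power M n. sat M (a @ b) E}"

definition eq_sorts :: "(unit, 'f, 'r) language \<Rightarrow> (unit, 'f, 'r, 'a) struct \<Rightarrow> ('f, 'r) eq_sort set"
  where
  "eq_sorts L M = insert Home
     {Quot n E | n E. wf_fm L (replicate (n + n) ()) E \<and> equiv (cart_power M n) (def_rel M n E)}"

definition eq_language :: "(unit, 'f, 'r) language \<Rightarrow> (unit, 'f, 'r, 'a) struct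
    \<Rightarrow> (('f, 'r) eq_sort, ('f, 'r) eq_fun, 'r) language" where
  "eq_language L M =
     \<lparr>sorts = eq_sorts L M,
      funs = Base ` funs L \<union> {Proj n E | n E. Quot n E \<in> eq_sorts L M},
      rels = rels L,
      fun_dom = (\<lambda>f. case f of Base g \<Rightarrow> map (\<lambda>_. Home) (fun_dom L g) | Proj n E \<Rightarrow> replicate n Home),
      fun_cod = (\<lambda>f. case f of Base g \<Rightarrow> Home | Proj n E \<Rightarrow> Quot n E),
      rel_dom = (\<lambda>r. map (\<lambda>_. Home) (rel_dom L r))\<rparr>"

definition eq_structure :: "(unit, 'f, 'r, 'a) struct
    \<Rightarrow> (('f, 'r) eq_sort, ('f, 'r) eq_fun, 'r, ('f, 'r, 'a) eq_elem) struct" where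
  "eq_structure M =
     \<lparr>carrier = (\<lambda>s. case s of Home \<Rightarrow> Real ` carrier M ()
                        | Quot n E \<Rightarrow> Class n E ` (cart_power M n // def_rel M n E)),
      fun_interp = (\<lambda>f a. case f of Base g \<Rightarrow> Real (fun_interp M g (map the_real a))
                        | Proj n E \<Rightarrow> Class n E (def_rel M n E `` {map the_real a})),
      rel_interp = (\<lambda>r a. rel_interp M r (map the_real a))\<rparr>"


section \<open>Thorn-forking\<close>

text \<open>In this section \<open>M\<close> stands for a (many-sorted) monster model.\<close>

definition inst :: "('s, 'f, 'r, 'a) struct \<Rightarrow> 's list \<Rightarrow> ('s, 'f, 'r) fm \<Rightarrow> 'a list \<Rightarrow> 'a list set"
  where
  "inst M \<Gamma> \<delta> a = {x \<in> tuples M \<Gamma>. sat M (x @ a) \<delta>}"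

definition tp :: "('s, 'f, 'r) language \<Rightarrow> ('s, 'f, 'r, 'a) struct \<Rightarrow> 's list \<Rightarrow> 'a set \<Rightarrow> 'a list
    \<Rightarrow> (('s, 'f, 'r) fm \<times> 'a list) set" where
  "tp L M \<Gamma> A a = {(\<phi>, c) \<in> param_formulas L M \<Gamma> A. sat M (a @ c) \<phi>}"

definition realizations :: "('s, 'f, 'r) language \<Rightarrow> ('s, 'f, 'r, 'a) struct \<Rightarrow> 's list \<Rightarrow> 'a set
    \<Rightarrow> 'a list \<Rightarrow> 'a list set" where
  "realizations L M \<Gamma> A a = {a' \<in> tuples M \<Gamma>. tp L M \<Gamma> A a' = tp L M \<Gamma> A a}"

text \<open>The family \<open>{\<delta>(x, a)}\<close>, \<open>a \<in> Y\<close>, is \<open>k\<close>-inconsistent.\<close>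

definition k_inconsistent :: "('s, 'f, 'r, 'a) struct \<Rightarrow> nat \<Rightarrow> 's list \<Rightarrow> ('s, 'f, 'r) fm
    \<Rightarrow> 'a list set \<Rightarrow> bool" where
  "k_inconsistent M k \<Gamma> \<delta> Y \<longleftrightarrow>
     (\<forall>S \<subseteq> Y. finite S \<longrightarrow> card S = k \<longrightarrow> \<not> (\<exists>x\<in>tuples M \<Gamma>. \<forall>a\<in>S. x \<in> inst M \<Gamma> \<delta> a))"

text \<open>In what follows \<open>x\<close> has sorts \<open>\<Gamma>\<close> and \<open>a\<close> has sorts \<open>\<Delta>\<close>.\<close>

definition strongly_divides :: "('s, 'f, 'r) language \<Rightarrow> ('s, 'f, 'r, 'a) struct \<Rightarrow> 's list
    \<Rightarrow> 's list \<Rightarrow> ('s, 'f, 'r) fm \<Rightarrow> 'a list \<Rightarrow> 'a set \<Rightarrow> bool" where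
  "strongly_divides L M \<Gamma> \<Delta> \<delta> a A \<longleftrightarrow>
     infinite (realizations L M \<Delta> A a) \<and>
     (\<exists>k. k_inconsistent M k \<Gamma> \<delta> (realizations L M \<Delta> A a))"

definition thorn_divides :: "('s, 'f, 'r) language \<Rightarrow> ('s, 'f, 'r, 'a) struct \<Rightarrow> 's list
    \<Rightarrow> 's list \<Rightarrow> ('s, 'f, 'r) fm \<Rightarrow> 'a list \<Rightarrow> 'a set \<Rightarrow> bool" where
  "thorn_divides L M \<Gamma> \<Delta> \<delta> a A \<longleftrightarrow>
     (\<exists>\<Theta> c. set \<Theta> \<subseteq> sorts L \<and> c \<in> tuples M \<Theta> \<and> strongly_divides L M \<Gamma> \<Delta> \<delta> a (A \<union> set c))"

definition thorn_forks :: "('s, 'f, 'r) language \<Rightarrow> ('s, 'f, 'r, 'a) struct \<Rightarrow> 's list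
    \<Rightarrow> ('s, 'f, 'r) fm \<Rightarrow> 'a list \<Rightarrow> 'a set \<Rightarrow> bool" where
  "thorn_forks L M \<Gamma> \<phi> b A \<longleftrightarrow>
     (\<exists>D. finite D \<and>
        (\<forall>(\<Delta>, \<delta>, a)\<in>D. set \<Delta> \<subseteq> sorts L \<and> a \<in> tuples M \<Delta> \<and> wf_fm L (\<Gamma> @ \<Delta>) \<delta> \<and>
           thorn_divides L M \<Gamma> \<Delta> \<delta> a A) \<and>
        inst M \<Gamma> \<phi> b \<subseteq> (\<Union>(\<Delta>, \<delta>, a)\<in>D. inst M \<Gamma> \<delta> a))"

definition type_thorn_forks :: "('s, 'f, 'r) language \<Rightarrow> ('s, 'f, 'r, 'a) struct \<Rightarrow> 's list
    \<Rightarrow> (('s, 'f, 'r) fm \<times> 'a list) set \<Rightarrow> 'a set \<Rightarrow> bool" where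
  "type_thorn_forks L M \<Gamma> p A \<longleftrightarrow> (\<exists>(\<phi>, b)\<in>p. thorn_forks L M \<Gamma> \<phi> b A)"


section \<open>Thorn-rank\<close>

text \<open>
  Every complete type over a small set is realized in the monster model, so types are represented in
  the form \<open>tp(a/A)\<close>; the extensions of \<open>tp(a/A)\<close> to \<open>B \<supseteq> A\<close> are the types \<open>tp(a'/B)\<close> with \<open>a'\<close>
  realizing \<open>tp(a/A)\<close>.
\<close>

definition thorn_forking_extension :: "('s, 'f, 'r) language \<Rightarrow> 'k rel \<Rightarrow> ('s, 'f, 'r, 'a) struct
    \<Rightarrow> 's list \<Rightarrow> 'a set \<Rightarrow> 'a list \<Rightarrow> 'a set \<Rightarrow> 'a list \<Rightarrow> bool" where
  "thorn_forking_extension L \<kappa> M \<Gamma> A a B a' \<longleftrightarrow>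
     A \<subseteq> B \<and> B \<subseteq> elements L M \<and> |B| <o \<kappa> \<and> a' \<in> realizations L M \<Gamma> A a \<and>
     type_thorn_forks L M \<Gamma> (tp L M \<Gamma> B a') A"

text \<open>
  The thorn-rank of types is the ordinal-valued foundation rank of the relation of being a
  thorn-forking extension: the rank of \<open>p\<close> is the supremum of \<open>rank q + 1\<close> over the thorn-forking
  extensions \<open>q\<close> of \<open>p\<close>, and this defines an ordinal once every such \<open>q\<close> has one; a type without
  ordinal rank has rank \<open>\<infinity>\<close>. Accordingly \<open>has_ordinal_rank\<close> says that the rank of \<open>tp(a/A)\<close> is not
  \<open>\<infinity>\<close>, and \<open>rank_ge n\<close> that it is at least \<open>n\<close>.
\<close>

inductive has_ordinal_rank :: "('s, 'f, 'r) language \<Rightarrow> 'k rel \<Rightarrow> ('s, 'f, 'r, 'a) struct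
    \<Rightarrow> 's list \<Rightarrow> 'a set \<Rightarrow> 'a list \<Rightarrow> bool"
  for L :: "('s, 'f, 'r) language" and \<kappa> :: "'k rel" and M :: "('s, 'f, 'r, 'a) struct"
    and \<Gamma> :: "'s list" where
  "(\<And>B a'. thorn_forking_extension L \<kappa> M \<Gamma> A a B a' \<Longrightarrow> has_ordinal_rank L \<kappa> M \<Gamma> B a')
   \<Longrightarrow> has_ordinal_rank L \<kappa> M \<Gamma> A a"

fun rank_ge :: "('s, 'f, 'r) language \<Rightarrow> 'k rel \<Rightarrow> ('s, 'f, 'r, 'a) struct \<Rightarrow> nat
    \<Rightarrow> 's list \<Rightarrow> 'a set \<Rightarrow> 'a list \<Rightarrow> bool" where
  "rank_ge L \<kappa> M 0 \<Gamma> A a \<longleftrightarrow> True"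
| "rank_ge L \<kappa> M (Suc n) \<Gamma> A a \<longleftrightarrow>
     (\<exists>B a'. thorn_forking_extension L \<kappa> M \<Gamma> A a B a' \<and> rank_ge L \<kappa> M n \<Gamma> B a')"


section \<open>Rosy theories\<close>

text \<open>
  The local thorn-rank of the formula defining \<open>X \<subseteq> M\<^sup>\<Gamma>\<close> with respect to \<open>k\<close>, a set \<open>D\<close> of formulas
  \<open>\<delta>(x, y)\<close> and a set \<open>P\<close> of formulas \<open>\<pi>(y, z)\<close>, where \<open>x\<close>, \<open>y\<close>, \<open>z\<close> have sorts \<open>\<Gamma>\<close>, \<open>\<Delta>\<close>, \<open>\<Theta>\<close>, is
  at least \<open>n\<close>.
\<close>

fun local_rank_ge :: "('s, 'f, 'r, 'a) struct \<Rightarrow> 's list \<Rightarrow> 's list \<Rightarrow> 's list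
    \<Rightarrow> ('s, 'f, 'r) fm set \<Rightarrow> ('s, 'f, 'r) fm set \<Rightarrow> nat \<Rightarrow> nat \<Rightarrow> 'a list set \<Rightarrow> bool" where
  "local_rank_ge M \<Gamma> \<Delta> \<Theta> D P k 0 X \<longleftrightarrow> X \<noteq> {}"
| "local_rank_ge M \<Gamma> \<Delta> \<Theta> D P k (Suc n) X \<longleftrightarrow>
     (\<exists>\<delta>\<in>D. \<exists>\<pi>\<in>P. \<exists>c\<in>tuples M \<Theta>.
        infinite {a \<in> inst M \<Delta> \<pi> c. local_rank_ge M \<Gamma> \<Delta> \<Theta> D P k n (X \<inter> inst M \<Gamma> \<delta> a)} \<and>
        k_inconsistent M k \<Gamma> \<delta> (inst M \<Delta> \<pi> c))"

text \<open>
  All local thorn-ranks are finite. (By compactness, in a saturated model such a rank is either finite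
  or \<open>\<infinity>\<close>, as \<open>D\<close> and \<open>P\<close> are finite.)
\<close>

definition finite_local_ranks :: "('s, 'f, 'r) language \<Rightarrow> ('s, 'f, 'r, 'a) struct \<Rightarrow> bool" where
  "finite_local_ranks L M \<longleftrightarrow>
     (\<forall>\<Gamma> \<Delta> \<Theta> D P k \<Xi> \<theta> e.
        set \<Gamma> \<subseteq> sorts L \<longrightarrow> set \<Delta> \<subseteq> sorts L \<longrightarrow> set \<Theta> \<subseteq> sorts L \<longrightarrow>
        finite D \<longrightarrow> (\<forall>\<delta>\<in>D. wf_fm L (\<Gamma> @ \<Delta>) \<delta>) \<longrightarrow>
        finite P \<longrightarrow> (\<forall>\<pi>\<in>P. wf_fm L (\<Delta> @ \<Theta>) \<pi>) \<longrightarrow>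
        set \<Xi> \<subseteq> sorts L \<longrightarrow> e \<in> tuples M \<Xi> \<longrightarrow> wf_fm L (\<Gamma> @ \<Xi>) \<theta> \<longrightarrow>
        (\<exists>n. \<not> local_rank_ge M \<Gamma> \<Delta> \<Theta> D P k n (inst M \<Gamma> \<theta> e)))"

text \<open>
  The remaining notions are properties of \<open>T = Th(M)\<close>, evaluated in \<open>M\<^sup>e\<^sup>q\<close> for a monster model \<open>M\<close>.
\<close>

definition rosy :: "(unit, 'f, 'r) language \<Rightarrow> (unit, 'f, 'r, 'a) struct \<Rightarrow> bool" where
  "rosy L M \<longleftrightarrow> finite_local_ranks (eq_language L M) (eq_structure M)"

definition superrosy :: "(unit, 'f, 'r) language \<Rightarrow> 'k rel \<Rightarrow> (unit, 'f, 'r, 'a) struct \<Rightarrow> bool" where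
  "superrosy L \<kappa> M \<longleftrightarrow> rosy L M \<and>
     (\<forall>\<Gamma> A a. set \<Gamma> \<subseteq> eq_sorts L M \<longrightarrow> A \<subseteq> elements (eq_language L M) (eq_structure M) \<longrightarrow>
        |A| <o \<kappa> \<longrightarrow> a \<in> tuples (eq_structure M) \<Gamma> \<longrightarrow>
        has_ordinal_rank (eq_language L M) \<kappa> (eq_structure M) \<Gamma> A a)"

text \<open>The supremum of the thorn-ranks of the unary real types over \<open>\<emptyset>\<close> is the finite number \<open>n\<close>;
  such a supremum is attained, the rank of every type being at least \<open>0\<close>.\<close>

definition theory_thorn_rank :: "(unit, 'f, 'r) language \<Rightarrow> 'k rel \<Rightarrow> (unit, 'f, 'r, 'a) struct \<Rightarrow> nat
    \<Rightarrow> bool" where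
  "theory_thorn_rank L \<kappa> M n \<longleftrightarrow>
     (\<exists>a\<in>carrier M (). rank_ge (eq_language L M) \<kappa> (eq_structure M) n [Home] {} [Real a]) \<and>
     (\<forall>a\<in>carrier M (). \<not> rank_ge (eq_language L M) \<kappa> (eq_structure M) (Suc n) [Home] {} [Real a])"

definition surgical :: "(unit, 'f, 'r) language \<Rightarrow> 'k rel \<Rightarrow> (unit, 'f, 'r, 'a) struct \<Rightarrow> bool" where
  "surgical L \<kappa> M \<longleftrightarrow> superrosy L \<kappa> M \<and> theory_thorn_rank L \<kappa> M 1"

end

theory Submission
  imports Defs
begin

text \<open>
  Let \<open>N = M\<^sup>e\<^sup>q\<close> and write \<open>dim(r/A)\<close> for the number of coordinates of a real tuple \<open>r\<close> that are not
  algebraic over \<open>A \<subseteq> N\<close> and the preceding coordinates. The theorem follows from exchange between reals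
  and imaginaries: if \<open>x\<close> is real and \<open>e \<in> acl(Cx) - acl(C)\<close>, then \<open>x \<in> acl(Ce)\<close>. It makes \<open>dim\<close> drop
  along thorn-forking extensions, which bounds the thorn-rank of a real tuple by its length; thorn-forking
  extensions of the type of an imaginary lift to a real tuple of representatives.

  If that exchange fails, there are infinitely many \<open>e\<close> with an infinite set \<open>X\<^sub>e\<close> of reals, each real
  lying in boundedly many \<open>X\<^sub>e\<close>. For infinite definable \<open>Y\<close> and any real \<open>c \<noteq> 0\<close>, exchange in \<open>M\<close> forces
  \<open>(x, w) \<mapsto> x + cw\<close> to be far from injective on \<open>Y \<times> Y\<close>: there is \<open>(x, w, y, z) \<in> Y\<^sup>4\<close> with
  \<open>x + cw = y + cz\<close>, \<open>z \<noteq> w\<close> and \<open>x, w, y\<close> independent over \<open>c\<close>, so all four are independent if \<open>c\<close> is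
  generic. (In particular infinity is definable, as a finite \<open>Y\<close> produces finitely many \<open>c\<close> only.)
  Finiteness of the local ranks allows \<open>Y\<close> to be shrunk until, for all but finitely many \<open>e\<close>, no
  independent quadruple from \<open>Y\<close> has its \<open>c\<close> in \<open>X\<^sub>e\<close>; a generic \<open>c \<in> X\<^sub>e\<close> contradicts this.
\<close>

subsection \<open>Substitution and definability with parameters\<close>

text \<open>The rank assumption is brought to bear on one real coordinate at a time, and this shapes
  the thinning: removing a coordinate \<open>u\<close> replaces \<open>G(e, u, v)\<close> by "for
  infinitely many \<open>u\<close>", which must again be a formula, with a bound on the number of
  \<open>e\<close> that is uniform in \<open>v\<close>. Neither is automatic. Both rest on
  definability of infinity, which is not a hypothesis and has to be extracted from the field; hence
  collisions are studied before the exchange with imaginaries. Quadruples have the right length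
  because \<open>z \<noteq> w\<close> makes \<open>c\<close> the only slope of
  \<open>(x, w, y, z)\<close>: a bound on the \<open>e\<close> belonging to \<open>c\<close> is a
  bound on the \<open>e\<close> belonging to the quadruple, and by exchange a generic
  \<open>c\<close> can be traded for \<open>z\<close>, so that independence no longer mentions
  \<open>c\<close>. For thorn-forking the difficulty is that each formula of the covering
  disjunction may divide over a different parameter set. A realization of the type over
  \<open>B\<close> is therefore moved, without loss of dimension, away from all these parameters at
  once; whichever formula it satisfies then gives the drop.\<close>

lemma tuples_Nil [simp]: "a \<in> tuples M [] \<longleftrightarrow> a = []"
  by (simp add: tuples_def)

lemma Nil_tuples [simp]: "[] \<in> tuples M \<Gamma> \<longleftrightarrow> \<Gamma> = []"
  by (auto simp: tuples_def)

lemma tuples_Cons: "a \<in> tuples M (s # \<Gamma>) \<longleftrightarrow> (\<exists>x b. a = x # b \<and> x \<in> carrier M s \<and> b \<in> tuples M \<Gamma>)"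
  by (auto simp: tuples_def list_all2_Cons2)

lemma Cons_tuples [simp]: "x # b \<in> tuples M (s # \<Gamma>) \<longleftrightarrow> x \<in> carrier M s \<and> b \<in> tuples M \<Gamma>"
  by (simp add: tuples_def)

lemma tuples_length: "a \<in> tuples M \<Gamma> \<Longrightarrow> length a = length \<Gamma>"
  by (auto simp: tuples_def list_all2_lengthD)

lemma tuples_nth: "a \<in> tuples M \<Gamma> \<Longrightarrow> i < length \<Gamma> \<Longrightarrow> a ! i \<in> carrier M (\<Gamma> ! i)"
  by (auto simp: tuples_def list_all2_conv_all_nth)

lemma tuples_appendI: "a \<in> tuples M \<Gamma> \<Longrightarrow> b \<in> tuples M \<Delta> \<Longrightarrow> a @ b \<in> tuples M (\<Gamma> @ \<Delta>)"
  by (auto simp: tuples_def intro: list_all2_appendI)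

lemma tuples_append:
  "a \<in> tuples M (\<Gamma> @ \<Delta>) \<longleftrightarrow> (\<exists>b c. a = b @ c \<and> b \<in> tuples M \<Gamma> \<and> c \<in> tuples M \<Delta>)"
proof
  assume "a \<in> tuples M (\<Gamma> @ \<Delta>)"
  then show "\<exists>b c. a = b @ c \<and> b \<in> tuples M \<Gamma> \<and> c \<in> tuples M \<Delta>"
    by (auto simp: tuples_def list_all2_append2)
qed (auto intro: tuples_appendI)

lemma tuples_replicate:
  "a \<in> tuples M (replicate n s) \<longleftrightarrow> length a = n \<and> set a \<subseteq> carrier M s"
proof (induction n arbitrary: a)
  case (Suc n)
  then show ?case by (cases a) (auto simp: tuples_def)
qed auto

lemma set_tuples: "a \<in> tuples M \<Gamma> \<Longrightarrow> set \<Gamma> \<subseteq> sorts L \<Longrightarrow> set a \<subseteq> elements L M"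
proof (induction \<Gamma> arbitrary: a)
  case (Cons s \<Gamma>)
  then obtain x b where "a = x # b" "x \<in> carrier M s" "b \<in> tuples M \<Gamma>" by (auto simp: tuples_Cons)
  with Cons show ?case by (auto simp: elements_def)
qed auto

section \<open>Simultaneous substitution and weakening\<close>

fun tsub :: "(nat \<Rightarrow> 'f tm) \<Rightarrow> 'f tm \<Rightarrow> 'f tm" where
  "tsub \<sigma> (Var i) = \<sigma> i"
| "tsub \<sigma> (Fn f ts) = Fn f (map (tsub \<sigma>) ts)"

definition lift :: "(nat \<Rightarrow> 'f tm) \<Rightarrow> nat \<Rightarrow> 'f tm" where
  "lift \<sigma> i = (case i of 0 \<Rightarrow> Var 0 | Suc j \<Rightarrow> tsub (\<lambda>k. Var (Suc k)) (\<sigma> j))"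

fun fsub :: "(nat \<Rightarrow> 'f tm) \<Rightarrow> ('s, 'f, 'r) fm \<Rightarrow> ('s, 'f, 'r) fm" where
  "fsub \<sigma> (Equal t u) = Equal (tsub \<sigma> t) (tsub \<sigma> u)"
| "fsub \<sigma> (Rel r ts) = Rel r (map (tsub \<sigma>) ts)"
| "fsub \<sigma> (Neg \<phi>) = Neg (fsub \<sigma> \<phi>)"
| "fsub \<sigma> (Conj \<phi> \<psi>) = Conj (fsub \<sigma> \<phi>) (fsub \<sigma> \<psi>)"
| "fsub \<sigma> (Ex s \<phi>) = Ex s (fsub (lift \<sigma>) \<phi>)"

lemma list_all2_has_sort_cong:
  assumes "list_all2 (has_sort L \<Gamma>) ts ss"
    and "\<And>t s. t \<in> set ts \<Longrightarrow> has_sort L \<Gamma> t s \<Longrightarrow> has_sort L \<Delta> (f t) s"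
  shows "list_all2 (has_sort L \<Delta>) (map f ts) ss"
  using assms by (auto simp: list_all2_conv_all_nth)

lemma list_all2_has_sortD: "list_all2 (has_sort L \<Gamma>) ts ss \<Longrightarrow> t \<in> set ts \<Longrightarrow> \<exists>s. has_sort L \<Gamma> t s"
  by (auto simp: list_all2_conv_all_nth in_set_conv_nth)

lemma has_sort_tsub:
  assumes "has_sort L \<Gamma> t s" "\<And>i. i < length \<Gamma> \<Longrightarrow> has_sort L \<Delta> (\<sigma> i) (\<Gamma> ! i)"
  shows "has_sort L \<Delta> (tsub \<sigma> t) s"
  using assms
proof (induction t arbitrary: s)
  case (Fn f ts)
  then show ?case by (auto intro: list_all2_has_sort_cong)
qed auto

lemma eval_tsub:
  assumes "has_sort L \<Gamma> t s" "\<And>i. i < length \<Gamma> \<Longrightarrow> eval M e (\<sigma> i) = e' ! i"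
  shows "eval M e (tsub \<sigma> t) = eval M e' t"
  using assms
proof (induction t arbitrary: s)
  case (Fn f ts)
  then have "map (\<lambda>t. eval M e (tsub \<sigma> t)) ts = map (eval M e') ts"
    by (auto dest: list_all2_has_sortD)
  then have "map (eval M e) (map (tsub \<sigma>) ts) = map (eval M e') ts" by simp
  then show ?case by (simp only: tsub.simps eval.simps)
qed auto

lemma has_sort_lift:
  assumes "\<And>i. i < length \<Gamma> \<Longrightarrow> has_sort L \<Delta> (\<sigma> i) (\<Gamma> ! i)" "i < length (s # \<Gamma>)"
  shows "has_sort L (s # \<Delta>) (lift \<sigma> i) ((s # \<Gamma>) ! i)"
  using assms by (cases i) (auto simp: lift_def intro!: has_sort_tsub)

lemma wf_fsub:
  assumes "wf_fm L \<Gamma> \<phi>" "\<And>i. i < length \<Gamma> \<Longrightarrow> has_sort L \<Delta> (\<sigma> i) (\<Gamma> ! i)"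
  shows "wf_fm L \<Delta> (fsub \<sigma> \<phi>)"
  using assms
proof (induction \<phi> arbitrary: \<Gamma> \<Delta> \<sigma>)
  case (Equal t u)
  then show ?case by (auto intro: has_sort_tsub)
next
  case (Rel r ts)
  then show ?case by (auto intro: list_all2_has_sort_cong has_sort_tsub)
next
  case (Ex s \<phi>)
  then show ?case using has_sort_lift[of \<Gamma> L \<Delta> \<sigma>] by (auto intro: Ex.IH[of "s # \<Gamma>"])
qed auto

lemma eval_lift:
  assumes "i < length (s # \<Gamma>)" "\<And>i. i < length \<Gamma> \<Longrightarrow> has_sort L \<Delta> (\<sigma> i) (\<Gamma> ! i)"
    "\<And>i. i < length \<Gamma> \<Longrightarrow> eval M e (\<sigma> i) = e' ! i"
  shows "eval M (x # e) (lift \<sigma> i) = (x # e') ! i"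
proof (cases i)
  case (Suc j)
  then have "eval M (x # e) (tsub (\<lambda>k. Var (Suc k)) (\<sigma> j)) = eval M e (\<sigma> j)"
    using assms by (intro eval_tsub[of L \<Delta> _ "\<Gamma> ! j"]) auto
  then show ?thesis using Suc assms by (simp add: lift_def)
qed (simp add: lift_def)

lemma sat_fsub:
  assumes "wf_fm L \<Gamma> \<phi>" "\<And>i. i < length \<Gamma> \<Longrightarrow> has_sort L \<Delta> (\<sigma> i) (\<Gamma> ! i)"
    "\<And>i. i < length \<Gamma> \<Longrightarrow> eval M e (\<sigma> i) = e' ! i"
  shows "sat M e (fsub \<sigma> \<phi>) \<longleftrightarrow> sat M e' \<phi>"
  using assms
proof (induction \<phi> arbitrary: \<Gamma> \<Delta> \<sigma> e e')
  case (Equal t u)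
  then show ?case by (auto simp: eval_tsub)
next
  case (Rel r ts)
  then have "map (\<lambda>t. eval M e (tsub \<sigma> t)) ts = map (eval M e') ts"
    by (auto dest!: list_all2_has_sortD intro: eval_tsub)
  then have "map (eval M e) (map (tsub \<sigma>) ts) = map (eval M e') ts" by simp
  then show ?case by (simp only: fsub.simps sat.simps)
next
  case (Neg \<phi>)
  then show ?case using Neg.IH[of \<Gamma> \<Delta> \<sigma> e e'] by simp
next
  case (Conj \<phi> \<psi>)
  have "sat M e (fsub \<sigma> \<phi>) \<longleftrightarrow> sat M e' \<phi>" "sat M e (fsub \<sigma> \<psi>) \<longleftrightarrow> sat M e' \<psi>"
    using Conj.prems Conj.IH(1)[of \<Gamma> \<Delta> \<sigma> e e'] Conj.IH(2)[of \<Gamma> \<Delta> \<sigma> e e'] by simp_all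
  then show ?case by simp
next
  case (Ex s \<phi>)
  have "sat M (x # e) (fsub (lift \<sigma>) \<phi>) \<longleftrightarrow> sat M (x # e') \<phi>" for x
    using Ex.prems has_sort_lift[of \<Gamma> L \<Delta> \<sigma>] eval_lift[of _ s \<Gamma> L \<Delta> \<sigma> M e e']
    by (intro Ex.IH[of "s # \<Gamma>" "s # \<Delta>"]) auto
  then show ?case by simp
qed

lemma has_sort_weaken: "has_sort L \<Gamma> t s \<Longrightarrow> has_sort L (\<Gamma> @ \<Delta>) t s"
proof (induction t arbitrary: s)
  case (Fn f ts)
  then show ?case by (auto simp: list_all2_conv_all_nth)
qed (auto simp: nth_append)

lemma eval_weaken: "has_sort L \<Gamma> t s \<Longrightarrow> length a = length \<Gamma> \<Longrightarrow> eval M (a @ b) t = eval M a t"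
proof (induction t arbitrary: s)
  case (Fn f ts)
  then have "map (eval M (a @ b)) ts = map (eval M a) ts"
    by (auto dest: list_all2_has_sortD)
  then show ?case by (simp only: eval.simps)
qed (auto simp: nth_append)

text \<open>The renaming that makes room for \<open>k\<close> fresh variables after the first
  \<open>n\<close>. Parameters sit behind the main variables of a formula, so combining two formulas
  with different parameter lists needs weakening in the middle of a context.\<close>

definition ins :: "nat \<Rightarrow> nat \<Rightarrow> nat \<Rightarrow> 'f tm" where
  "ins n k i = (if i < n then Var i else Var (i + k))"

lemma has_sort_ins:
  "i < length (\<Gamma> @ \<Theta>) \<Longrightarrow> has_sort L (\<Gamma> @ \<Delta> @ \<Theta>) (ins (length \<Gamma>) (length \<Delta>) i) ((\<Gamma> @ \<Theta>) ! i)"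
  by (auto simp: ins_def nth_append)

lemma eval_ins:
  "length a = length \<Gamma> \<Longrightarrow> length d = length \<Delta> \<Longrightarrow>
   eval M (a @ d @ c) (ins (length \<Gamma>) (length \<Delta>) i) = (a @ c) ! i"
  by (auto simp: ins_def nth_append)

text \<open>The counting quantifier "at least \<open>m\<close>". The first disjunct is needed since
  \<open>card\<close> is \<open>0\<close> on infinite sets.\<close>

definition atl :: "nat \<Rightarrow> 'b set \<Rightarrow> bool" where
  "atl m X \<longleftrightarrow> infinite X \<or> m \<le> card X"

lemma atl_Suc: "atl (Suc m) X \<longleftrightarrow> (\<exists>x\<in>X. atl m (X - {x}))"
proof (cases "finite X")
  case True
  have "m \<le> card (X - {x}) \<longleftrightarrow> Suc m \<le> card X" if "x \<in> X" for x
    using card_Suc_Diff1[OF True that] by auto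
  moreover have "X \<noteq> {}" if "Suc m \<le> card X" using that by auto
  ultimately show ?thesis using True by (auto simp: atl_def)
next
  case False
  then obtain x where "x \<in> X" by (metis finite.emptyI equals0I)
  then show ?thesis using False by (auto simp: atl_def)
qed

lemma atl_1 [simp]: "atl (Suc 0) X \<longleftrightarrow> X \<noteq> {}"
  unfolding atl_Suc by (auto simp: atl_def)

lemma atl_anti: "atl n X \<Longrightarrow> m \<le> n \<Longrightarrow> atl m X"
  by (auto simp: atl_def)

lemma atl_mono: "atl n X \<Longrightarrow> X \<subseteq> Y \<Longrightarrow> atl n Y"
  by (auto simp: atl_def dest: finite_subset) (meson card_mono le_trans)

section \<open>Predicates definable with parameters\<close>

locale mstructure =
  fixes L :: "('s, 'f, 'r) language" and M :: "('s, 'f, 'r, 'a) struct"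
  assumes str: "is_structure L M"
    and sorts_disjoint: "s \<in> sorts L \<Longrightarrow> t \<in> sorts L \<Longrightarrow> x \<in> carrier M s \<Longrightarrow> x \<in> carrier M t \<Longrightarrow> s = t"
begin

text \<open>In the closure rules for definability the variable bound last is \<open>hd\<close> of the tuple and the other
  variables form its \<open>tl\<close>.\<close>

definition dfn :: "'a set \<Rightarrow> 's list \<Rightarrow> ('a list \<Rightarrow> bool) \<Rightarrow> bool" where
  "dfn A \<Gamma> R \<longleftrightarrow> (\<exists>\<Theta> c \<phi>. set \<Theta> \<subseteq> sorts L \<and> c \<in> tuples M \<Theta> \<and> set c \<subseteq> A \<and> wf_fm L (\<Gamma> @ \<Theta>) \<phi> \<and>
     (\<forall>a\<in>tuples M \<Gamma>. sat M (a @ c) \<phi> \<longleftrightarrow> R a))"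

text \<open>Maps given by terms with parameters, not arbitrary definable maps: composing a definable
  predicate with such a map is plain substitution and introduces no quantifier.\<close>

definition tmfs :: "'a set \<Rightarrow> 's list \<Rightarrow> 's list \<Rightarrow> ('a list \<Rightarrow> 'a list) \<Rightarrow> bool" where
  "tmfs A \<Gamma> \<Delta> F \<longleftrightarrow> (\<exists>\<Theta> c ts. set \<Theta> \<subseteq> sorts L \<and> c \<in> tuples M \<Theta> \<and> set c \<subseteq> A \<and>
     list_all2 (has_sort L (\<Gamma> @ \<Theta>)) ts \<Delta> \<and>
     (\<forall>a\<in>tuples M \<Gamma>. map (eval M (a @ c)) ts = F a))"

definition tmf :: "'a set \<Rightarrow> 's list \<Rightarrow> 's \<Rightarrow> ('a list \<Rightarrow> 'a) \<Rightarrow> bool" where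
  "tmf A \<Gamma> s f \<longleftrightarrow> tmfs A \<Gamma> [s] (\<lambda>a. [f a])"

lemma dfnI:
  assumes "set \<Theta> \<subseteq> sorts L" "c \<in> tuples M \<Theta>" "set c \<subseteq> A" "wf_fm L (\<Gamma> @ \<Theta>) \<phi>"
    "\<And>a. a \<in> tuples M \<Gamma> \<Longrightarrow> sat M (a @ c) \<phi> \<longleftrightarrow> R a"
  shows "dfn A \<Gamma> R"
  using assms unfolding dfn_def by blast

lemma dfn_cong: "dfn A \<Gamma> R \<Longrightarrow> (\<And>a. a \<in> tuples M \<Gamma> \<Longrightarrow> R a = R' a) \<Longrightarrow> dfn A \<Gamma> R'"
  unfolding dfn_def by (elim exE conjE, intro exI conjI) auto

lemma dfn_mono: "dfn A \<Gamma> R \<Longrightarrow> A \<subseteq> B \<Longrightarrow> dfn B \<Gamma> R"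
  unfolding dfn_def by blast

lemma tmfs_cong: "tmfs A \<Gamma> \<Delta> F \<Longrightarrow> (\<And>a. a \<in> tuples M \<Gamma> \<Longrightarrow> F a = F' a) \<Longrightarrow> tmfs A \<Gamma> \<Delta> F'"
  unfolding tmfs_def by (elim exE conjE, intro exI conjI) auto

lemma tmfs_mono: "tmfs A \<Gamma> \<Delta> F \<Longrightarrow> A \<subseteq> B \<Longrightarrow> tmfs B \<Gamma> \<Delta> F"
  unfolding tmfs_def by blast

lemma tmf_mono: "tmf A \<Gamma> s F \<Longrightarrow> A \<subseteq> B \<Longrightarrow> tmf B \<Gamma> s F"
  unfolding tmf_def by (rule tmfs_mono)

lemma dfn_neg: "dfn A \<Gamma> R \<Longrightarrow> dfn A \<Gamma> (\<lambda>a. \<not> R a)"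
  unfolding dfn_def by (metis sat.simps(3) wf_fm.simps(3))

lemma dfn_conj:
  assumes "dfn A \<Gamma> R" "dfn A \<Gamma> S"
  shows "dfn A \<Gamma> (\<lambda>a. R a \<and> S a)"
proof -
  obtain \<Theta> c \<phi> where 1: "set \<Theta> \<subseteq> sorts L" "c \<in> tuples M \<Theta>" "set c \<subseteq> A" "wf_fm L (\<Gamma> @ \<Theta>) \<phi>"
    "\<And>a. a \<in> tuples M \<Gamma> \<Longrightarrow> sat M (a @ c) \<phi> \<longleftrightarrow> R a" using assms(1) unfolding dfn_def by blast
  obtain \<Delta> d \<psi> where 2: "set \<Delta> \<subseteq> sorts L" "d \<in> tuples M \<Delta>" "set d \<subseteq> A" "wf_fm L (\<Gamma> @ \<Delta>) \<psi>"
    "\<And>a. a \<in> tuples M \<Gamma> \<Longrightarrow> sat M (a @ d) \<psi> \<longleftrightarrow> S a" using assms(2) unfolding dfn_def by blast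
  \<comment> \<open>On the variables of \<open>\<phi>\<close> the first renaming is the identity and
    merely enlarges the context; the second lets \<open>\<psi>\<close> skip the parameters of
    \<open>\<phi>\<close>.\<close>
  let ?\<sigma> = "ins (length (\<Gamma> @ \<Theta>)) (length \<Delta>)" and ?\<tau> = "ins (length \<Gamma>) (length \<Theta>)"
  have l: "length c = length \<Theta>" "length d = length \<Delta>" using 1 2 by (auto dest: tuples_length)
  have wf: "wf_fm L (\<Gamma> @ \<Theta> @ \<Delta>) (fsub ?\<sigma> \<phi>)" "wf_fm L (\<Gamma> @ \<Theta> @ \<Delta>) (fsub ?\<tau> \<psi>)"
    using has_sort_ins[of _ "\<Gamma> @ \<Theta>" "[]" L \<Delta>] has_sort_ins[of _ \<Gamma> \<Delta> L \<Theta>]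
    by (auto intro!: wf_fsub[OF 1(4)] wf_fsub[OF 2(4)])
  have "sat M (a @ c @ d) (Conj (fsub ?\<sigma> \<phi>) (fsub ?\<tau> \<psi>)) \<longleftrightarrow> R a \<and> S a" if "a \<in> tuples M \<Gamma>" for a
  proof -
    have la: "length a = length \<Gamma>" using that by (rule tuples_length)
    have "sat M (a @ c @ d) (fsub ?\<sigma> \<phi>) \<longleftrightarrow> sat M (a @ c) \<phi>"
      using has_sort_ins[of _ "\<Gamma> @ \<Theta>" "[]" L \<Delta>] eval_ins[of "a @ c" "\<Gamma> @ \<Theta>" d \<Delta> M "[]"] l la
      by (intro sat_fsub[OF 1(4), of "\<Gamma> @ \<Theta> @ \<Delta>"]) auto
    moreover have "sat M (a @ c @ d) (fsub ?\<tau> \<psi>) \<longleftrightarrow> sat M (a @ d) \<psi>"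
      using has_sort_ins[of _ \<Gamma> \<Delta> L \<Theta>] eval_ins[of a \<Gamma> c \<Theta> M d] l la
      by (intro sat_fsub[OF 2(4), of "\<Gamma> @ \<Theta> @ \<Delta>"]) auto
    ultimately show ?thesis using that 1(5) 2(5) by simp
  qed
  moreover have "c @ d \<in> tuples M (\<Theta> @ \<Delta>)" using 1 2 by (auto intro: tuples_appendI)
  moreover have "set (\<Theta> @ \<Delta>) \<subseteq> sorts L" "set (c @ d) \<subseteq> A"
    using 1(1,3) 2(1,3) by auto
  moreover have "wf_fm L (\<Gamma> @ \<Theta> @ \<Delta>) (Conj (fsub ?\<sigma> \<phi>) (fsub ?\<tau> \<psi>))" using wf by simp
  ultimately show ?thesis by (intro dfnI)
qed

lemma dfn_disj: "dfn A \<Gamma> R \<Longrightarrow> dfn A \<Gamma> S \<Longrightarrow> dfn A \<Gamma> (\<lambda>a. R a \<or> S a)"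
  using dfn_neg[OF dfn_conj[OF dfn_neg dfn_neg], of A \<Gamma> R S] by simp

lemma dfn_imp: "dfn A \<Gamma> R \<Longrightarrow> dfn A \<Gamma> S \<Longrightarrow> dfn A \<Gamma> (\<lambda>a. R a \<longrightarrow> S a)"
  using dfn_disj[OF dfn_neg, of A \<Gamma> R S] by simp

lemma dfn_ex:
  assumes "s \<in> sorts L" "dfn A (s # \<Gamma>) (\<lambda>b. R (hd b) (tl b))"
  shows "dfn A \<Gamma> (\<lambda>a. \<exists>x\<in>carrier M s. R x a)"
proof -
  obtain \<Theta> c \<phi> where 1: "set \<Theta> \<subseteq> sorts L" "c \<in> tuples M \<Theta>" "set c \<subseteq> A" "wf_fm L (s # \<Gamma> @ \<Theta>) \<phi>"
    "\<And>a. a \<in> tuples M (s # \<Gamma>) \<Longrightarrow> sat M (a @ c) \<phi> \<longleftrightarrow> R (hd a) (tl a)"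
    using assms(2) unfolding dfn_def by auto
  have "sat M (x # a @ c) \<phi> \<longleftrightarrow> R x a" if "x \<in> carrier M s" "a \<in> tuples M \<Gamma>" for x a
    using 1(5)[of "x # a"] that by simp
  with 1 assms(1) show ?thesis
    by (intro dfnI[of \<Theta> c A \<Gamma> "Ex s \<phi>"]) auto
qed

lemma dfn_all:
  assumes "s \<in> sorts L" "dfn A (s # \<Gamma>) (\<lambda>b. R (hd b) (tl b))"
  shows "dfn A \<Gamma> (\<lambda>a. \<forall>x\<in>carrier M s. R x a)"
  using dfn_neg[OF dfn_ex[OF assms(1) dfn_neg[OF assms(2)]]] by simp

lemma tmfs_append:
  assumes "tmfs A \<Gamma> \<Delta>1 F" "tmfs A \<Gamma> \<Delta>2 G"
  shows "tmfs A \<Gamma> (\<Delta>1 @ \<Delta>2) (\<lambda>a. F a @ G a)"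
proof -
  obtain \<Theta> c ts where 1: "set \<Theta> \<subseteq> sorts L" "c \<in> tuples M \<Theta>" "set c \<subseteq> A"
    "list_all2 (has_sort L (\<Gamma> @ \<Theta>)) ts \<Delta>1" "\<And>a. a \<in> tuples M \<Gamma> \<Longrightarrow> map (eval M (a @ c)) ts = F a"
    using assms(1) unfolding tmfs_def by blast
  obtain \<Xi> d us where 2: "set \<Xi> \<subseteq> sorts L" "d \<in> tuples M \<Xi>" "set d \<subseteq> A"
    "list_all2 (has_sort L (\<Gamma> @ \<Xi>)) us \<Delta>2" "\<And>a. a \<in> tuples M \<Gamma> \<Longrightarrow> map (eval M (a @ d)) us = G a"
    using assms(2) unfolding tmfs_def by blast
  let ?\<tau> = "ins (length \<Gamma>) (length \<Theta>)"
  have l: "length c = length \<Theta>" "length d = length \<Xi>" using 1 2 by (auto dest: tuples_length)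
  have "list_all2 (has_sort L (\<Gamma> @ \<Theta> @ \<Xi>)) ts \<Delta>1"
    using list_all2_has_sort_cong[OF 1(4), of "\<Gamma> @ \<Theta> @ \<Xi>" "\<lambda>t. t"] has_sort_weaken[of L "\<Gamma> @ \<Theta>" _ _ \<Xi>]
    by auto
  moreover have "list_all2 (has_sort L (\<Gamma> @ \<Theta> @ \<Xi>)) (map (tsub ?\<tau>) us) \<Delta>2"
    by (rule list_all2_has_sort_cong[OF 2(4)], rule has_sort_tsub, assumption)
       (rule has_sort_ins)
  moreover have "map (eval M (a @ c @ d)) (ts @ map (tsub ?\<tau>) us) = F a @ G a"
    if "a \<in> tuples M \<Gamma>" for a
  proof -
    have la: "length a = length \<Gamma>" using that by (rule tuples_length)
    have "eval M (a @ c @ d) t = eval M (a @ c) t" if "t \<in> set ts" for t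
      using list_all2_has_sortD[OF 1(4) that] eval_weaken[of L "\<Gamma> @ \<Theta>" t _ "a @ c" M d] l la by auto
    then have "map (eval M (a @ c @ d)) ts = F a"
      unfolding 1(5)[OF that, symmetric] by simp
    moreover have "eval M (a @ c @ d) (tsub ?\<tau> u) = eval M (a @ d) u" if "u \<in> set us" for u
      using list_all2_has_sortD[OF 2(4) that] eval_ins[of a \<Gamma> c \<Theta> M d] l la by (auto intro: eval_tsub)
    then have "map (eval M (a @ c @ d)) (map (tsub ?\<tau>) us) = G a"
      unfolding 2(5)[OF that, symmetric] by simp
    ultimately show ?thesis by simp
  qed
  moreover have "c @ d \<in> tuples M (\<Theta> @ \<Xi>)" using 1 2 by (auto intro: tuples_appendI)
  moreover have "set (\<Theta> @ \<Xi>) \<subseteq> sorts L" "set (c @ d) \<subseteq> A"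
    using 1(1,3) 2(1,3) by auto
  ultimately show ?thesis unfolding tmfs_def
    by (intro exI[of _ "\<Theta> @ \<Xi>"] exI[of _ "c @ d"] exI[of _ "ts @ map (tsub ?\<tau>) us"] conjI ballI
        list_all2_appendI) 
qed

lemma tmfs_Nil: "tmfs A \<Gamma> [] (\<lambda>_. [])"
  unfolding tmfs_def by (intro exI[of _ "[]"]) auto

lemma tmfs_Cons: "tmf A \<Gamma> s f \<Longrightarrow> tmfs A \<Gamma> \<Delta> F \<Longrightarrow> tmfs A \<Gamma> (s # \<Delta>) (\<lambda>a. f a # F a)"
  unfolding tmf_def using tmfs_append[of A \<Gamma> "[s]" "\<lambda>a. [f a]" \<Delta> F] by simp

lemma tmfs_id: "tmfs A \<Gamma> \<Gamma> (\<lambda>a. a)"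
proof -
  have "map (eval M a) (map Var [0..<length \<Gamma>]) = a" if "a \<in> tuples M \<Gamma>" for a
    using tuples_length[OF that] by (auto simp: comp_def intro: nth_equalityI)
  then show ?thesis unfolding tmfs_def
    by (intro exI[of _ "[]"] exI[of _ "map Var [0..<length \<Gamma>]"]) (auto simp: list_all2_conv_all_nth)
qed

lemma tmfs_sub_eval:
  assumes "tmfs A \<Gamma> \<Delta> F"
  obtains \<Theta> c ts where "set \<Theta> \<subseteq> sorts L" "c \<in> tuples M \<Theta>" "set c \<subseteq> A" "length ts = length \<Delta>"
    "\<And>i. i < length \<Delta> \<Longrightarrow> has_sort L (\<Gamma> @ \<Theta>) (ts ! i) (\<Delta> ! i)"
    "\<And>a i. a \<in> tuples M \<Gamma> \<Longrightarrow> i < length \<Delta> \<Longrightarrow> eval M (a @ c) (ts ! i) = F a ! i"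
    "\<And>a. a \<in> tuples M \<Gamma> \<Longrightarrow> length (F a) = length \<Delta>"
proof -
  obtain \<Theta> c ts where 1: "set \<Theta> \<subseteq> sorts L" "c \<in> tuples M \<Theta>" "set c \<subseteq> A"
    "list_all2 (has_sort L (\<Gamma> @ \<Theta>)) ts \<Delta>" "\<And>a. a \<in> tuples M \<Gamma> \<Longrightarrow> map (eval M (a @ c)) ts = F a"
    using assms unfolding tmfs_def by blast
  have l: "length ts = length \<Delta>" using 1(4) by (rule list_all2_lengthD)
  show ?thesis
  proof (rule that[of \<Theta> c ts])
    fix a assume "a \<in> tuples M \<Gamma>"
    with 1(5) have *: "F a = map (eval M (a @ c)) ts" by simp
    then show "length (F a) = length \<Delta>" using l by simp
    fix i assume "i < length \<Delta>"
    with * l show "eval M (a @ c) (ts ! i) = F a ! i" by simp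
  qed (use 1 l in \<open>auto simp: list_all2_conv_all_nth\<close>)
qed

lemma eval_carrier:
  assumes "has_sort L \<Gamma> t s" "a \<in> tuples M \<Gamma>"
  shows "eval M a t \<in> carrier M s"
  using assms
proof (induction t arbitrary: s)
  case (Var i)
  then show ?case by (auto intro: tuples_nth)
next
  case (Fn f ts)
  then have "map (eval M a) ts \<in> tuples M (fun_dom L f)"
    by (auto simp: tuples_def list_all2_conv_all_nth)
  with Fn str show ?case by (auto simp: is_structure_def)
qed

lemma tmfs_tuples:
  assumes "tmfs A \<Gamma> \<Delta> F" "a \<in> tuples M \<Gamma>"
  shows "F a \<in> tuples M \<Delta>"
proof -
  obtain \<Theta> c ts where 1: "c \<in> tuples M \<Theta>"
    "list_all2 (has_sort L (\<Gamma> @ \<Theta>)) ts \<Delta>" "map (eval M (a @ c)) ts = F a"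
    using assms unfolding tmfs_def by blast
  have "a @ c \<in> tuples M (\<Gamma> @ \<Theta>)" using assms(2) 1(1) by (rule tuples_appendI)
  then have "map (eval M (a @ c)) ts \<in> tuples M \<Delta>"
    using 1(2) eval_carrier[of "\<Gamma> @ \<Theta>"]
    by (auto simp: tuples_def[of M \<Delta>] list_all2_conv_all_nth)
  with 1(3) show ?thesis by simp
qed

text \<open>The leading variables become the terms \<open>ts\<close>. The variables behind them,
  which stand for the parameters of the formula, are renumbered to start at \<open>n\<close>, the
  length of the context in which the terms live.\<close>

definition sub_at :: "'f tm list \<Rightarrow> nat \<Rightarrow> nat \<Rightarrow> 'f tm" where
  "sub_at ts n i = (if i < length ts then ts ! i else Var (n + (i - length ts)))"

lemma sub_at:
  assumes "length ts = length \<Delta>" "\<And>i. i < length \<Delta> \<Longrightarrow> has_sort L (\<Gamma> @ \<Theta>) (ts ! i) (\<Delta> ! i)"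
  shows "i < length (\<Delta> @ \<Xi>) \<Longrightarrow>
      has_sort L (\<Gamma> @ \<Theta> @ \<Xi>) (sub_at ts (length (\<Gamma> @ \<Theta>)) i) ((\<Delta> @ \<Xi>) ! i)"
    and "i < length (\<Delta> @ \<Xi>) \<Longrightarrow> length a = length \<Gamma> \<Longrightarrow> length c = length \<Theta> \<Longrightarrow> length b = length \<Delta> \<Longrightarrow>
      (\<And>i. i < length \<Delta> \<Longrightarrow> eval M (a @ c) (ts ! i) = b ! i) \<Longrightarrow>
      eval M (a @ c @ d) (sub_at ts (length (\<Gamma> @ \<Theta>)) i) = (b @ d) ! i"
proof -
  show "has_sort L (\<Gamma> @ \<Theta> @ \<Xi>) (sub_at ts (length (\<Gamma> @ \<Theta>)) i) ((\<Delta> @ \<Xi>) ! i)" if "i < length (\<Delta> @ \<Xi>)"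
    using assms that has_sort_weaken[OF assms(2), of i \<Xi>] by (auto simp: sub_at_def nth_append)
  show "eval M (a @ c @ d) (sub_at ts (length (\<Gamma> @ \<Theta>)) i) = (b @ d) ! i"
    if "i < length (\<Delta> @ \<Xi>)" "length a = length \<Gamma>" "length c = length \<Theta>" "length b = length \<Delta>"
      "\<And>i. i < length \<Delta> \<Longrightarrow> eval M (a @ c) (ts ! i) = b ! i"
  proof (cases "i < length \<Delta>")
    case True
    then show ?thesis using that assms eval_weaken[OF assms(2), of i "a @ c" M d]
      by (auto simp: sub_at_def nth_append)
  next
    case False
    then show ?thesis using that assms by (auto simp: sub_at_def nth_append)
  qed
qed

lemma dfn_sub:
  assumes "dfn A \<Delta> R" "tmfs A \<Gamma> \<Delta> F"
  shows "dfn A \<Gamma> (\<lambda>a. R (F a))"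
proof -
  obtain \<Xi> d \<phi> where 1: "set \<Xi> \<subseteq> sorts L" "d \<in> tuples M \<Xi>" "set d \<subseteq> A" "wf_fm L (\<Delta> @ \<Xi>) \<phi>"
    "\<And>a. a \<in> tuples M \<Delta> \<Longrightarrow> sat M (a @ d) \<phi> \<longleftrightarrow> R a" using assms(1) unfolding dfn_def by blast
  obtain \<Theta> c ts where 2: "set \<Theta> \<subseteq> sorts L" "c \<in> tuples M \<Theta>" "set c \<subseteq> A" "length ts = length \<Delta>"
    "\<And>i. i < length \<Delta> \<Longrightarrow> has_sort L (\<Gamma> @ \<Theta>) (ts ! i) (\<Delta> ! i)"
    "\<And>a i. a \<in> tuples M \<Gamma> \<Longrightarrow> i < length \<Delta> \<Longrightarrow> eval M (a @ c) (ts ! i) = F a ! i"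
    "\<And>a. a \<in> tuples M \<Gamma> \<Longrightarrow> length (F a) = length \<Delta>"
    using tmfs_sub_eval[OF assms(2)] by blast
  let ?\<sigma> = "sub_at ts (length (\<Gamma> @ \<Theta>))"
  note s = sub_at[OF 2(4,5)]
  have "sat M (a @ c @ d) (fsub ?\<sigma> \<phi>) \<longleftrightarrow> R (F a)" if a: "a \<in> tuples M \<Gamma>" for a
  proof -
    have "F a \<in> tuples M \<Delta>"
      using tmfs_tuples[OF assms(2) a] .
    moreover have "sat M (a @ c @ d) (fsub ?\<sigma> \<phi>) \<longleftrightarrow> sat M (F a @ d) \<phi>"
      using tuples_length[OF a] tuples_length[OF 2(2)] 2(6,7)[OF a]
      by (intro sat_fsub[OF 1(4), of "\<Gamma> @ \<Theta> @ \<Xi>"] s) auto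
    ultimately show ?thesis using 1(5) by simp
  qed
  moreover have "wf_fm L (\<Gamma> @ \<Theta> @ \<Xi>) (fsub ?\<sigma> \<phi>)" using s by (intro wf_fsub[OF 1(4)]) auto
  moreover have "c @ d \<in> tuples M (\<Theta> @ \<Xi>)" using 1 2 by (auto intro: tuples_appendI)
  moreover have "set (\<Theta> @ \<Xi>) \<subseteq> sorts L" "set (c @ d) \<subseteq> A"
    using 1(1,3) 2(1,3) by auto
  ultimately show ?thesis by (intro dfnI)
qed

lemma tmfs_comp:
  assumes "tmfs A \<Delta> \<Xi> G" "tmfs A \<Gamma> \<Delta> F"
  shows "tmfs A \<Gamma> \<Xi> (\<lambda>a. G (F a))"
proof -
  obtain \<Omega> d us where 1: "set \<Omega> \<subseteq> sorts L" "d \<in> tuples M \<Omega>" "set d \<subseteq> A"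
    "list_all2 (has_sort L (\<Delta> @ \<Omega>)) us \<Xi>" "\<And>a. a \<in> tuples M \<Delta> \<Longrightarrow> map (eval M (a @ d)) us = G a"
    using assms(1) unfolding tmfs_def by blast
  obtain \<Theta> c ts where 2: "set \<Theta> \<subseteq> sorts L" "c \<in> tuples M \<Theta>" "set c \<subseteq> A" "length ts = length \<Delta>"
    "\<And>i. i < length \<Delta> \<Longrightarrow> has_sort L (\<Gamma> @ \<Theta>) (ts ! i) (\<Delta> ! i)"
    "\<And>a i. a \<in> tuples M \<Gamma> \<Longrightarrow> i < length \<Delta> \<Longrightarrow> eval M (a @ c) (ts ! i) = F a ! i"
    "\<And>a. a \<in> tuples M \<Gamma> \<Longrightarrow> length (F a) = length \<Delta>"
    using tmfs_sub_eval[OF assms(2)] by blast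
  let ?\<sigma> = "sub_at ts (length (\<Gamma> @ \<Theta>))"
  note s = sub_at[OF 2(4,5)]
  have "map (eval M (a @ c @ d)) (map (tsub ?\<sigma>) us) = G (F a)" if a: "a \<in> tuples M \<Gamma>" for a
  proof -
    have "eval M (a @ c @ d) (tsub ?\<sigma> u) = eval M (F a @ d) u" if u: "u \<in> set us" for u
    proof -
      obtain s where "has_sort L (\<Delta> @ \<Omega>) u s" using list_all2_has_sortD[OF 1(4) u] by blast
      then show ?thesis
        using tuples_length[OF a] tuples_length[OF 2(2)] 2(6,7)[OF a] by (intro eval_tsub s) auto
    qed
    then have "map (eval M (a @ c @ d)) (map (tsub ?\<sigma>) us) = map (eval M (F a @ d)) us" by simp
    also have "\<dots> = G (F a)" using tmfs_tuples[OF assms(2) a] by (rule 1(5))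
    finally show ?thesis .
  qed
  moreover have "list_all2 (has_sort L (\<Gamma> @ \<Theta> @ \<Omega>)) (map (tsub ?\<sigma>) us) \<Xi>"
    by (rule list_all2_has_sort_cong[OF 1(4)], rule has_sort_tsub, assumption, rule s)
  moreover have "c @ d \<in> tuples M (\<Theta> @ \<Omega>)" using 1 2 by (auto intro: tuples_appendI)
  moreover have "set (\<Theta> @ \<Omega>) \<subseteq> sorts L" "set (c @ d) \<subseteq> A"
    using 1(1,3) 2(1,3) by auto
  ultimately show ?thesis unfolding tmfs_def by (intro exI conjI ballI)
qed

lemma tmfs_vars:
  assumes "\<And>i. i < length \<Delta> \<Longrightarrow> f i < length \<Gamma> \<and> \<Gamma> ! (f i) = \<Delta> ! i"
    "\<And>a. length a = length \<Gamma> \<Longrightarrow> map (\<lambda>i. a ! f i) [0..<length \<Delta>] = F a"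
  shows "tmfs A \<Gamma> \<Delta> F"
  unfolding tmfs_def
  by (intro exI[of _ "[]"] exI[of _ "map (\<lambda>i. Var (f i)) [0..<length \<Delta>]"])
     (use assms in \<open>auto simp: list_all2_conv_all_nth comp_def dest: tuples_length\<close>)

lemma tmfs_drop: "tmfs A (\<Delta> @ \<Gamma>) \<Gamma> (drop (length \<Delta>))"
  by (rule tmfs_vars[of _ "\<lambda>i. length \<Delta> + i"]) (auto intro: nth_equalityI)

lemma tmfs_take: "tmfs A (\<Delta> @ \<Gamma>) \<Delta> (take (length \<Delta>))"
  by (rule tmfs_vars[of _ "\<lambda>i. i"]) (auto simp: nth_append intro: nth_equalityI)

lemma tmf_nth: "i < length \<Gamma> \<Longrightarrow> tmf A \<Gamma> (\<Gamma> ! i) (\<lambda>a. a ! i)"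
  unfolding tmf_def by (rule tmfs_vars[of _ "\<lambda>_. i"]) auto

lemma tmf_hd: "tmf A (s # \<Gamma>) s hd"
  unfolding tmf_def by (rule tmfs_vars[of _ "\<lambda>_. 0"]) (auto simp: length_Suc_conv)

lemma tmf_comp: "tmf A \<Delta> s f \<Longrightarrow> tmfs A \<Gamma> \<Delta> F \<Longrightarrow> tmf A \<Gamma> s (\<lambda>a. f (F a))"
  unfolding tmf_def by (rule tmfs_comp)

lemma tmfs_tl_id: "tmfs A (s # \<Gamma>) \<Gamma> tl"
  using tmfs_drop[of A "[s]" \<Gamma>] by (simp add: drop_Suc[abs_def])

lemma tmfs_tl: "tmfs A \<Gamma> \<Delta> F \<Longrightarrow> tmfs A (s # \<Gamma>) \<Delta> (\<lambda>b. F (tl b))"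
  using tmfs_tl_id by (rule tmfs_comp[rotated])

lemma tmf_tl: "tmf A \<Gamma> t f \<Longrightarrow> tmf A (s # \<Gamma>) t (\<lambda>b. f (tl b))"
  using tmfs_tl_id by (rule tmf_comp[rotated])

lemma tmf_const: "p \<in> A \<Longrightarrow> p \<in> carrier M s \<Longrightarrow> s \<in> sorts L \<Longrightarrow> tmf A \<Gamma> s (\<lambda>_. p)"
  unfolding tmf_def tmfs_def
  by (intro exI[of _ "[s]"] exI[of _ "[p]"] exI[of _ "[Var (length \<Gamma>)]"])
     (auto simp: nth_append dest: tuples_length)

lemma tmfs_const: "c \<in> tuples M \<Theta> \<Longrightarrow> set c \<subseteq> A \<Longrightarrow> set \<Theta> \<subseteq> sorts L \<Longrightarrow> tmfs A \<Gamma> \<Theta> (\<lambda>_. c)"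
proof (induction \<Theta> arbitrary: c)
  case (Cons s \<Theta>)
  then show ?case by (auto simp: tuples_Cons intro!: tmfs_Cons tmf_const)
qed (auto intro: tmfs_Nil)

lemma tmf_term: "has_sort L \<Delta> t s \<Longrightarrow> tmfs A \<Gamma> \<Delta> F \<Longrightarrow> tmf A \<Gamma> s (\<lambda>a. eval M (F a) t)"
proof (erule tmf_comp[rotated])
  assume "has_sort L \<Delta> t s"
  then show "tmf A \<Delta> s (\<lambda>a. eval M a t)"
    unfolding tmf_def tmfs_def by (intro exI[of _ "[]"] exI[of _ "[t]"]) auto
qed

lemma dfn_wf: "wf_fm L \<Gamma> \<phi> \<Longrightarrow> dfn A \<Gamma> (\<lambda>a. sat M a \<phi>)"
  by (rule dfnI[of "[]" "[]"]) auto

lemma dfn_eq: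
  assumes "tmf A \<Gamma> s f" "tmf A \<Gamma> s g" "s \<in> sorts L"
  shows "dfn A \<Gamma> (\<lambda>a. f a = g a)"
proof -
  have "dfn A [s, s] (\<lambda>a. sat M a (Equal (Var 0) (Var 1)))"
    using assms(3) by (intro dfn_wf) auto
  from dfn_sub[OF this tmfs_Cons[OF assms(1) tmfs_Cons[OF assms(2) tmfs_Nil]]] show ?thesis by simp
qed

text \<open>Formulas have no symbol for truth. It is expressed by \<open>x = x\<close> for some
  \<open>x\<close> in a non-empty sort, which is why a sort has to be supplied here and in
  \<open>dfn_ball\<close>.\<close>

lemma dfn_const:
  assumes "s \<in> sorts L"
  shows "dfn A \<Gamma> (\<lambda>_. P)"
proof -
  have "dfn A \<Gamma> (\<lambda>a. \<exists>x\<in>carrier M s. x = x)"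
    by (rule dfn_ex[OF assms], rule dfn_eq[OF tmf_hd tmf_hd assms])
  moreover have "carrier M s \<noteq> {}" using assms str by (auto simp: is_structure_def)
  ultimately have "dfn A \<Gamma> (\<lambda>a. True)" by (auto intro: dfn_cong)
  from this dfn_neg[OF this] show ?thesis by (cases P) auto
qed

text \<open>The recursion \<open>atl_Suc\<close> unrolls the counting quantifier into
  \<open>m\<close> nested existential ones: pick \<open>y\<close>, then count the elements different
  from \<open>y\<close>.\<close>

lemma dfn_atl:
  assumes "s \<in> sorts L" "dfn A (s # \<Gamma>) (\<lambda>b. R (hd b) (tl b))"
  shows "dfn A \<Gamma> (\<lambda>a. atl m {x \<in> carrier M s. R x a})"
  using assms(2)
proof (induction m arbitrary: \<Gamma> R)
  case 0
  show ?case using dfn_const[OF assms(1), of A \<Gamma> True] by (simp add: atl_def)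
next
  case (Suc m)
  have "tmfs A (s # s # \<Gamma>) (s # \<Gamma>) (\<lambda>b. hd b # tl (tl b))"
    by (intro tmfs_Cons tmf_hd tmfs_tl tmfs_tl_id)
  from dfn_sub[OF Suc.prems this]
  have "dfn A (s # s # \<Gamma>) (\<lambda>b. R (hd b) (tl (tl b)) \<and> \<not> hd b = hd (tl b))"
    by (intro dfn_conj dfn_neg dfn_eq[of A _ s] assms(1) tmf_hd tmf_tl) simp
  then have "dfn A (s # \<Gamma>) (\<lambda>a. atl m {x \<in> carrier M s. R x (tl a) \<and> x \<noteq> hd a})"
    by (intro Suc.IH) simp
  then have "dfn A \<Gamma> (\<lambda>a. \<exists>y\<in>carrier M s. R y a \<and> atl m {x \<in> carrier M s. R x a \<and> x \<noteq> y})"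
    by (intro dfn_ex assms(1) dfn_conj Suc.prems)
  moreover have "{x \<in> carrier M s. R x a \<and> x \<noteq> y} = {x \<in> carrier M s. R x a} - {y}" for a y
    by auto
  ultimately show ?case by (simp add: atl_Suc Bex_def conj_assoc)
qed

text \<open>Turns the parameters \<open>r\<close> into variables. Every entry of the parameter list
  either lies in \<open>A\<close> and stays a constant, or is a coordinate of \<open>r\<close> and
  becomes a projection; disjointness of the sorts ensures that this projection has the sort at which
  the formula expects the entry.\<close>

lemma dfn_abstract:
  assumes "dfn (A \<union> set r) \<Gamma> R" "r \<in> tuples M \<Delta>" "set \<Delta> \<subseteq> sorts L"
  obtains S where "dfn A (\<Gamma> @ \<Delta>) S" "\<And>a. a \<in> tuples M \<Gamma> \<Longrightarrow> R a = S (a @ r)"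
proof -
  obtain \<Theta> c \<phi> where 1: "set \<Theta> \<subseteq> sorts L" "c \<in> tuples M \<Theta>" "set c \<subseteq> A \<union> set r" "wf_fm L (\<Gamma> @ \<Theta>) \<phi>"
    "\<And>a. a \<in> tuples M \<Gamma> \<Longrightarrow> sat M (a @ c) \<phi> \<longleftrightarrow> R a" using assms(1) unfolding dfn_def by blast
  have "\<exists>G. tmfs A \<Delta> \<Theta> G \<and> G r = c" using 1(1-3)
  proof (induction \<Theta> arbitrary: c)
    case Nil
    then show ?case by (auto intro!: exI[of _ "\<lambda>_. []"] tmfs_Nil)
  next
    case (Cons s \<Theta>)
    then obtain x d where c: "c = x # d" "x \<in> carrier M s" "d \<in> tuples M \<Theta>" by (auto simp: tuples_Cons)
    with Cons obtain G where G: "tmfs A \<Delta> \<Theta> G" "G r = d" by auto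
    have "\<exists>f. tmf A \<Delta> s f \<and> f r = x"
    proof (cases "x \<in> A")
      case True
      then show ?thesis using c(2) Cons.prems by (auto intro!: exI[of _ "\<lambda>_. x"] tmf_const)
    next
      case False
      then obtain j where j: "j < length r" "r ! j = x" using c Cons.prems by (auto simp: in_set_conv_nth)
      then have "j < length \<Delta>" "x \<in> carrier M (\<Delta> ! j)" using assms(2) tuples_length[OF assms(2)]
        by (auto dest: tuples_nth)
      moreover from this have "\<Delta> ! j = s" using c(2) Cons.prems assms(3)
        by (intro sorts_disjoint[of _ _ x]) (auto dest: nth_mem)
      ultimately show ?thesis using tmf_nth[of j \<Delta> A] j by auto
    qed
    then obtain f where "tmf A \<Delta> s f" "f r = x" by blast
    then show ?case using G c by (intro exI[of _ "\<lambda>a. f a # G a"]) (auto intro: tmfs_Cons)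
  qed
  then obtain G where G: "tmfs A \<Delta> \<Theta> G" "G r = c" by blast
  have "tmfs A (\<Gamma> @ \<Delta>) (\<Gamma> @ \<Theta>) (\<lambda>b. take (length \<Gamma>) b @ G (drop (length \<Gamma>) b))"
    by (intro tmfs_append tmfs_take tmfs_comp[OF G(1)] tmfs_drop)
  from dfn_sub[OF dfn_wf[OF 1(4)] this]
  have "dfn A (\<Gamma> @ \<Delta>) (\<lambda>b. sat M (take (length \<Gamma>) b @ G (drop (length \<Gamma>) b)) \<phi>)" .
  then show ?thesis by (rule that) (use 1(5) G tuples_length in \<open>fastforce\<close>)
qed

lemma dfn_apply:
  assumes "dfn A (\<Gamma> @ \<Delta>) S" "r \<in> tuples M \<Delta>" "set r \<subseteq> A" "set \<Delta> \<subseteq> sorts L"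
  shows "dfn A \<Gamma> (\<lambda>a. S (a @ r))"
  using assms by (intro dfn_sub[OF assms(1)] tmfs_append tmfs_id tmfs_const)

lemma dfn_Cons: "dfn A (s # \<Gamma>) R \<Longrightarrow> dfn A (s # \<Gamma>) (\<lambda>b. R (hd b # tl b))"
  by (erule dfn_cong) (auto simp: tuples_Cons)

section \<open>Algebraic closure\<close>

lemma acl_iff:
  "b \<in> acl L M A \<longleftrightarrow> (\<exists>s\<in>sorts L. b \<in> carrier M s \<and>
     (\<exists>R. dfn A [s] R \<and> R [b] \<and> finite {x \<in> carrier M s. R [x]}))"
proof
  assume "b \<in> acl L M A"
  then obtain s \<phi> \<Theta> c where 1: "s \<in> sorts L" "b \<in> carrier M s"
    "set \<Theta> \<subseteq> sorts L" "c \<in> tuples M \<Theta>" "set c \<subseteq> A" "wf_fm L (s # \<Theta>) \<phi>"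
    "sat M (b # c) \<phi>" "finite {x \<in> carrier M s. sat M (x # c) \<phi>}" unfolding acl_def by blast
  then have "dfn A [s] (\<lambda>a. sat M (a @ c) \<phi>)" by (intro dfnI[of \<Theta> c]) auto
  then show "\<exists>s\<in>sorts L. b \<in> carrier M s \<and>
     (\<exists>R. dfn A [s] R \<and> R [b] \<and> finite {x \<in> carrier M s. R [x]})"
    using 1 by (intro bexI[of _ s] conjI exI[of _ "\<lambda>a. sat M (a @ c) \<phi>"]) auto
next
  assume "\<exists>s\<in>sorts L. b \<in> carrier M s \<and>
     (\<exists>R. dfn A [s] R \<and> R [b] \<and> finite {x \<in> carrier M s. R [x]})"
  then obtain s R where s: "s \<in> sorts L" "b \<in> carrier M s" "dfn A [s] R" "R [b]"
    "finite {x \<in> carrier M s. R [x]}" by blast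
  then obtain \<Theta> c \<phi> where 1: "set \<Theta> \<subseteq> sorts L" "c \<in> tuples M \<Theta>" "set c \<subseteq> A" "wf_fm L ([s] @ \<Theta>) \<phi>"
    "\<And>a. a \<in> tuples M [s] \<Longrightarrow> sat M (a @ c) \<phi> \<longleftrightarrow> R a" unfolding dfn_def by blast
  have "{x \<in> carrier M s. sat M (x # c) \<phi>} = {x \<in> carrier M s. R [x]}"
    using 1(5)[of "[x]" for x] by auto
  then show "b \<in> acl L M A" unfolding acl_def
    using s 1(1-4) 1(5)[of "[b]"]
    by (auto intro!: exI[of _ s] exI[of _ \<phi>] exI[of _ \<Theta>] exI[of _ c])
qed

lemma acl_mono: "b \<in> acl L M A \<Longrightarrow> A \<subseteq> B \<Longrightarrow> b \<in> acl L M B"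
  unfolding acl_iff by (blast intro: dfn_mono)

lemma not_acl_mono: "b \<notin> acl L M B \<Longrightarrow> A \<subseteq> B \<Longrightarrow> b \<notin> acl L M A"
  using acl_mono by blast

lemma not_acl_infinite:
  assumes "b \<notin> acl L M A" "s \<in> sorts L" "b \<in> carrier M s" "dfn A [s] (\<lambda>a. R (hd a))" "R b"
  shows "infinite {x \<in> carrier M s. R x}"
  using assms unfolding acl_iff by (auto dest!: bspec[of _ _ s] spec[of _ "\<lambda>a. R (hd a)"])

lemma acl_dcl:
  assumes "s \<in> sorts L" "b \<in> carrier M s" "dfn A [s] (\<lambda>a. R (hd a))" "R b" "finite {x \<in> carrier M s. R x}"
  shows "b \<in> acl L M A"
  unfolding acl_iff using assms by (intro bexI[of _ s] conjI exI[of _ "\<lambda>a. R (hd a)"]) auto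

lemma acl_incl: "b \<in> A \<Longrightarrow> b \<in> elements L M \<Longrightarrow> b \<in> acl L M A"
proof -
  assume b: "b \<in> A" "b \<in> elements L M"
  then obtain s where "s \<in> sorts L" "b \<in> carrier M s" by (auto simp: elements_def)
  then show ?thesis using b
    by (intro acl_dcl[of s b A "\<lambda>x. x = b"] dfn_eq[of A _ s] tmf_hd tmf_const) auto
qed

text \<open>Let \<open>y\<close> run through the finitely many solutions of the formula that makes
  \<open>z\<close> algebraic. Then \<open>c\<close> lies in the union of the fibres over these
  \<open>y\<close>. Only the fibre over \<open>z\<close> is known to be finite, so the formula for
  \<open>c\<close> also demands that the fibre over \<open>y\<close> has fewer than \<open>m\<close>
  elements, with \<open>m\<close> one more than the size of the fibre over \<open>z\<close>.\<close>

lemma acl_trans: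
  assumes "c \<in> acl L M (insert z A)" "z \<in> acl L M A"
  shows "c \<in> acl L M A"
proof -
  obtain s R where s: "s \<in> sorts L" "c \<in> carrier M s" "dfn (insert z A) [s] R" "R [c]"
    "finite {x \<in> carrier M s. R [x]}" using assms(1) unfolding acl_iff by blast
  obtain t Q where t: "t \<in> sorts L" "z \<in> carrier M t" "dfn A [t] Q" "Q [z]"
    "finite {x \<in> carrier M t. Q [x]}" using assms(2) unfolding acl_iff by blast
  have "dfn (A \<union> set [z]) [s] R" "[z] \<in> tuples M [t]" "set [t] \<subseteq> sorts L" using s(3) t(1,2) by auto
  from dfn_abstract[OF this]
  obtain S where S': "dfn A ([s] @ [t]) S" "\<And>a. a \<in> tuples M [s] \<Longrightarrow> R a = S (a @ [z])" by blast
  then have S: "dfn A [s, t] S" "\<And>x. x \<in> carrier M s \<Longrightarrow> R [x] = S [x, z]" by (auto simp: S'(2))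
  define m where "m = Suc (card {x \<in> carrier M s. R [x]})"
  let ?P = "\<lambda>x y. Q [y] \<and> S [x, y] \<and> \<not> atl m {x' \<in> carrier M s. S [x', y]}"
  have "dfn A [t, s] (\<lambda>b. Q [hd b])" by (rule dfn_sub[OF t(3)]) (intro tmfs_Cons tmfs_Nil tmf_hd)
  moreover have "dfn A [t, s] (\<lambda>b. S [hd (tl b), hd b])"
    by (rule dfn_sub[OF S(1)]) (intro tmfs_Cons tmfs_Nil tmf_hd tmf_tl)
  moreover have "dfn A [t, s] (\<lambda>b. atl m {x' \<in> carrier M s. S [x', hd b]})"
    by (intro dfn_atl s(1), rule dfn_sub[OF S(1)]) (intro tmfs_Cons tmfs_Nil tmf_hd tmf_tl)
  ultimately have "dfn A [s] (\<lambda>a. \<exists>y\<in>carrier M t. ?P (hd a) y)"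
    by (intro dfn_ex t(1) dfn_conj dfn_neg) auto
  moreover have "\<exists>y\<in>carrier M t. ?P c y"
  proof (intro bexI[of _ z] conjI)
    have "{x' \<in> carrier M s. S [x', z]} = {x \<in> carrier M s. R [x]}" using S(2) by auto
    then show "\<not> atl m {x' \<in> carrier M s. S [x', z]}" using s(5) by (simp add: atl_def m_def)
  qed (use S(2) s t in auto)
  moreover have "finite {x \<in> carrier M s. \<exists>y\<in>carrier M t. ?P x y}"
  proof (rule finite_subset)
    show "{x \<in> carrier M s. \<exists>y\<in>carrier M t. ?P x y} \<subseteq>
      (\<Union>y\<in>{y \<in> carrier M t. Q [y]}. if atl m {x' \<in> carrier M s. S [x', y]} then {} else {x' \<in> carrier M s. S [x', y]})"
      by auto
    show "finite (\<Union>y\<in>{y \<in> carrier M t. Q [y]}. if atl m {x' \<in> carrier M s. S [x', y]} then {} else {x' \<in> carrier M s. S [x', y]})"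
      using t(5) by (auto simp: atl_def)
  qed
  ultimately show ?thesis using s(1,2) by (intro acl_dcl[of s c A "\<lambda>x. \<exists>y\<in>carrier M t. ?P x y"])
qed

lemma dfn_ball:
  assumes "finite F" "\<And>S. S \<in> F \<Longrightarrow> dfn A \<Gamma> (f S)" "s \<in> sorts L"
  shows "dfn A \<Gamma> (\<lambda>a. \<forall>S\<in>F. f S a)"
  using assms(1,2)
proof (induction F)
  case empty
  then show ?case using dfn_const[OF assms(3), of A \<Gamma> True] by simp
next
  case (insert S F)
  then show ?case by (auto intro!: dfn_conj)
qed

lemma dfn_eqs:
  assumes "tmfs A \<Gamma> \<Delta> F" "tmfs A \<Gamma> \<Delta> G" "set \<Delta> \<subseteq> sorts L" "s \<in> sorts L"
  shows "dfn A \<Gamma> (\<lambda>a. F a = G a)"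
proof (rule dfn_cong)
  show "dfn A \<Gamma> (\<lambda>a. \<forall>i\<in>{..<length \<Delta>}. F a ! i = G a ! i)"
  proof (rule dfn_ball[OF _ _ assms(4)])
    fix i assume "i \<in> {..<length \<Delta>}"
    then show "dfn A \<Gamma> (\<lambda>a. F a ! i = G a ! i)"
      using assms(3) by (intro dfn_eq[of A \<Gamma> "\<Delta> ! i"] tmf_comp[OF tmf_nth] assms(1,2)) auto
  qed simp
  fix a assume "a \<in> tuples M \<Gamma>"
  then have "length (F a) = length \<Delta>" "length (G a) = length \<Delta>"
    using tmfs_tuples assms(1,2) by (blast dest: tuples_length)+
  then show "(\<forall>i\<in>{..<length \<Delta>}. F a ! i = G a ! i) \<longleftrightarrow> F a = G a"
    by (auto simp: list_eq_iff_nth_eq)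
qed

lemma dfn_exs:
  assumes "dfn A (\<Gamma> @ \<Delta>) S" "set \<Delta> \<subseteq> sorts L"
  shows "dfn A \<Gamma> (\<lambda>a. \<exists>y\<in>tuples M \<Delta>. S (a @ y))"
  using assms
proof (induction \<Delta> arbitrary: \<Gamma>)
  case (Cons s \<Delta>)
  then have "dfn A (\<Gamma> @ [s]) (\<lambda>b. \<exists>y\<in>tuples M \<Delta>. S (b @ y))" by (intro Cons.IH) auto
  moreover have "tmfs A (s # \<Gamma>) (\<Gamma> @ [s]) (\<lambda>b. tl b @ [hd b])"
    by (intro tmfs_append tmfs_tl_id tmfs_Cons tmfs_Nil tmf_hd)
  ultimately have "dfn A (s # \<Gamma>) (\<lambda>b. \<exists>y\<in>tuples M \<Delta>. S ((tl b @ [hd b]) @ y))"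
    by (rule dfn_sub)
  then have "dfn A \<Gamma> (\<lambda>a. \<exists>x\<in>carrier M s. \<exists>y\<in>tuples M \<Delta>. S ((a @ [x]) @ y))"
    using Cons.prems by (intro dfn_ex) auto
  moreover have "(\<exists>y\<in>tuples M (s # \<Delta>). P y) \<longleftrightarrow> (\<exists>x\<in>carrier M s. \<exists>y\<in>tuples M \<Delta>. P (x # y))" for P
    by (auto simp: tuples_Cons) blast+
  ultimately show ?case by simp
qed simp

lemma dfn_empty:
  assumes "dfn {} \<Gamma> R"
  obtains \<phi> where "wf_fm L \<Gamma> \<phi>" "\<And>a. a \<in> tuples M \<Gamma> \<Longrightarrow> sat M a \<phi> \<longleftrightarrow> R a"
  using assms unfolding dfn_def by auto

text \<open>Equality of types over \<open>A\<close>, phrased through \<open>dfn\<close> so that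
  formulas need not be unfolded; \<open>realizations_iff\<close> ties it to
  \<open>tp\<close>.\<close>

definition eqv :: "'a set \<Rightarrow> 's list \<Rightarrow> 'a list \<Rightarrow> 'a list \<Rightarrow> bool" where
  "eqv A \<Gamma> a b \<longleftrightarrow> a \<in> tuples M \<Gamma> \<and> b \<in> tuples M \<Gamma> \<and> (\<forall>R. dfn A \<Gamma> R \<longrightarrow> R a = R b)"

lemma eqvD: "eqv A \<Gamma> a b \<Longrightarrow> dfn A \<Gamma> R \<Longrightarrow> R a = R b"
  unfolding eqv_def by blast

lemma eqv_tuples: "eqv A \<Gamma> a b \<Longrightarrow> a \<in> tuples M \<Gamma>" "eqv A \<Gamma> a b \<Longrightarrow> b \<in> tuples M \<Gamma>"
  unfolding eqv_def by auto

lemma eqv_sym: "eqv A \<Gamma> a b \<Longrightarrow> eqv A \<Gamma> b a"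
  and eqv_mono: "eqv B \<Gamma> a b \<Longrightarrow> A \<subseteq> B \<Longrightarrow> eqv A \<Gamma> a b"
  unfolding eqv_def using dfn_mono by auto

lemma eqv_map: "eqv A \<Gamma> a b \<Longrightarrow> tmfs A \<Gamma> \<Delta> F \<Longrightarrow> eqv A \<Delta> (F a) (F b)"
  unfolding eqv_def using tmfs_tuples dfn_sub by blast

lemma realizations_iff:
  assumes "a \<in> tuples M \<Gamma>"
  shows "b \<in> realizations L M \<Gamma> A a \<longleftrightarrow> eqv A \<Gamma> a b"
proof
  assume b: "b \<in> realizations L M \<Gamma> A a"
  have "R a = R b" if R: "dfn A \<Gamma> R" for R
  proof -
    obtain \<Theta> c \<phi> where 1: "set \<Theta> \<subseteq> sorts L" "c \<in> tuples M \<Theta>" "set c \<subseteq> A" "wf_fm L (\<Gamma> @ \<Theta>) \<phi>"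
      "\<And>a. a \<in> tuples M \<Gamma> \<Longrightarrow> sat M (a @ c) \<phi> \<longleftrightarrow> R a" using R unfolding dfn_def by blast
    then have "(\<phi>, c) \<in> param_formulas L M \<Gamma> A" by (auto simp: param_formulas_def)
    moreover have "tp L M \<Gamma> A b = tp L M \<Gamma> A a" using b by (simp add: realizations_def)
    ultimately have "sat M (b @ c) \<phi> = sat M (a @ c) \<phi>" unfolding tp_def by blast
    then show ?thesis using 1 assms b by (simp add: realizations_def)
  qed
  then show "eqv A \<Gamma> a b" using assms b by (simp add: eqv_def realizations_def)
next
  assume b: "eqv A \<Gamma> a b"
  have "sat M (b @ c) \<phi> = sat M (a @ c) \<phi>" if "(\<phi>, c) \<in> param_formulas L M \<Gamma> A" for \<phi> c
  proof -
    obtain \<Theta> where "set \<Theta> \<subseteq> sorts L" "c \<in> tuples M \<Theta>" "set c \<subseteq> A" "wf_fm L (\<Gamma> @ \<Theta>) \<phi>"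
      using \<open>(\<phi>, c) \<in> param_formulas L M \<Gamma> A\<close> by (auto simp: param_formulas_def)
    then have "dfn A \<Gamma> (\<lambda>a. sat M (a @ c) \<phi>)" by (intro dfnI[of \<Theta> c]) auto
    then show ?thesis using eqvD[OF b] by blast
  qed
  then show "b \<in> realizations L M \<Gamma> A a" using b by (auto simp: realizations_def tp_def eqv_def)
qed

text \<open>Algebraicity is visible in the type of \<open>r @ [x]\<close>: the formula satisfied by
  \<open>x'\<close> over \<open>r'\<close>, together with the bound on the number of its solutions,
  transfers to \<open>x\<close> over \<open>r\<close>.\<close>

lemma eqv_acl:
  assumes "eqv A (\<Gamma> @ [s]) (r @ [x]) (r' @ [x'])" "r \<in> tuples M \<Gamma>" "r' \<in> tuples M \<Gamma>"
    "set \<Gamma> \<subseteq> sorts L" "s \<in> sorts L" "x' \<in> acl L M (A \<union> set r')"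
  shows "x \<in> acl L M (A \<union> set r)"
proof -
  have x: "x \<in> carrier M s" "x' \<in> carrier M s"
    using tuples_nth[OF eqv_tuples(1)[OF assms(1)], of "length \<Gamma>"] tuples_length[OF assms(2)]
      tuples_nth[OF eqv_tuples(2)[OF assms(1)], of "length \<Gamma>"] tuples_length[OF assms(3)]
    by (auto simp: nth_append)
  obtain t R where t: "t \<in> sorts L" "x' \<in> carrier M t" "dfn (A \<union> set r') [t] R" "R [x']"
    "finite {x \<in> carrier M t. R [x]}" using assms(6) unfolding acl_iff by blast
  have [simp]: "t = s" using sorts_disjoint t x assms(5) by blast
  obtain S where S: "dfn A ([s] @ \<Gamma>) S" "\<And>a. a \<in> tuples M [s] \<Longrightarrow> R a = S (a @ r')"
    using dfn_abstract[OF t(3) assms(3,4)] by auto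
  have S2: "{x \<in> carrier M s. R [x]} = {x \<in> carrier M s. S (x # r')}" using S(2) by force
  define m where "m = Suc (card {x \<in> carrier M s. R [x]})"
  have 1: "tmfs A (\<Gamma> @ [s]) ([s] @ \<Gamma>) (\<lambda>b. drop (length \<Gamma>) b @ take (length \<Gamma>) b)"
    by (intro tmfs_append tmfs_drop tmfs_take)
  have "dfn A \<Gamma> (\<lambda>a. atl m {x \<in> carrier M s. S (x # a)})"
  proof (rule dfn_atl[OF assms(5)])
    have "tmfs A (s # \<Gamma>) ([s] @ \<Gamma>) (\<lambda>b. [hd b] @ tl b)"
      by (intro tmfs_append tmfs_tl_id tmfs_Cons tmf_hd tmfs_Nil)
    from dfn_sub[OF S(1) this] show "dfn A (s # \<Gamma>) (\<lambda>b. S (hd b # tl b))" by simp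
  qed
  from dfn_sub[OF this tmfs_take[of A \<Gamma> "[s]"]] dfn_sub[OF S(1) 1]
  have "dfn A (\<Gamma> @ [s]) (\<lambda>b. S (drop (length \<Gamma>) b @ take (length \<Gamma>) b) \<and>
      \<not> atl m {x \<in> carrier M s. S (x # take (length \<Gamma>) b)})"
    by (intro dfn_conj dfn_neg)
  from eqvD[OF assms(1) this] have "S (x # r) \<and> \<not> atl m {x \<in> carrier M s. S (x # r)}"
    using assms(2,3) t(4) S(2)[of "[x']"] x t(5) S2
    by (auto simp: tuples_length atl_def m_def)
  moreover have "dfn (A \<union> set r) [s] (\<lambda>a. S (a @ r))"
    using assms(2,4) dfn_mono[OF S(1), of "A \<union> set r"] by (intro dfn_apply[of _ _ \<Gamma>]) auto
  ultimately show ?thesis unfolding acl_iff using x(1) assms(5)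
    by (intro bexI[of _ s] conjI exI[of _ "\<lambda>a. S (a @ r)"]) (auto simp: atl_def)
qed

end

subsection \<open>Saturated structures\<close>

locale saturated_structure = mstructure L M
  for L :: "('s, 'f, 'r) language" and M :: "('s, 'f, 'r, 'a) struct" +
  fixes \<kappa> :: "'k rel"
  assumes sat: "saturated L \<kappa> M" and card: "Card_order \<kappa>" and inf: "infinite (Field \<kappa>)"
begin

definition small :: "'a set \<Rightarrow> bool" where
  "small A \<longleftrightarrow> A \<subseteq> elements L M \<and> |A| <o \<kappa>"

lemma small_Un: "small A \<Longrightarrow> small B \<Longrightarrow> small (A \<union> B)"
  unfolding small_def using card_of_Un_ordLess_infinite_Field[OF inf card] by auto

lemma small_finite: "finite A \<Longrightarrow> A \<subseteq> elements L M \<Longrightarrow> small A"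
  unfolding small_def using finite_ordLess_infinite[of "|A|" \<kappa>] inf card card_of_Well_order[of A]
  by (auto simp: Field_card_of card_order_on_well_order_on)

lemma small_set: "a \<in> tuples M \<Gamma> \<Longrightarrow> set \<Gamma> \<subseteq> sorts L \<Longrightarrow> small (set a)"
  using set_tuples[of a M \<Gamma> L] by (intro small_finite) auto

text \<open>Choosing one formula with parameters for each predicate turns a family of definable
  predicates into a set of formulas over \<open>A\<close>.\<close>

lemma saturation:
  assumes "small A" "set \<Gamma> \<subseteq> sorts L" "\<And>R. R \<in> \<R> \<Longrightarrow> dfn A \<Gamma> R"
    "\<And>F. F \<subseteq> \<R> \<Longrightarrow> finite F \<Longrightarrow> \<exists>a\<in>tuples M \<Gamma>. \<forall>R\<in>F. R a"
  shows "\<exists>a\<in>tuples M \<Gamma>. \<forall>R\<in>\<R>. R a"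
proof -
  have "\<exists>p\<in>param_formulas L M \<Gamma> A. \<forall>a\<in>tuples M \<Gamma>. sat M (a @ snd p) (fst p) \<longleftrightarrow> R a" if R: "R \<in> \<R>" for R
  proof -
    obtain \<Theta> c \<phi> where "set \<Theta> \<subseteq> sorts L" "c \<in> tuples M \<Theta>" "set c \<subseteq> A" "wf_fm L (\<Gamma> @ \<Theta>) \<phi>"
      "\<forall>a\<in>tuples M \<Gamma>. sat M (a @ c) \<phi> \<longleftrightarrow> R a" using assms(3)[OF R] unfolding dfn_def by blast
    then show ?thesis by (intro bexI[of _ "(\<phi>, c)"]) (auto simp: param_formulas_def)
  qed
  then obtain f where f: "\<And>R. R \<in> \<R> \<Longrightarrow> f R \<in> param_formulas L M \<Gamma> A"
    "\<And>R a. R \<in> \<R> \<Longrightarrow> a \<in> tuples M \<Gamma> \<Longrightarrow> sat M (a @ snd (f R)) (fst (f R)) \<longleftrightarrow> R a" by metis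
  have "\<exists>a\<in>tuples M \<Gamma>. \<forall>p\<in>f ` \<R>. case p of (\<phi>, c) \<Rightarrow> sat M (a @ c) \<phi>"
  proof (rule sat[unfolded saturated_def, rule_format])
    show "A \<subseteq> elements L M" "|A| <o \<kappa>" using assms(1) by (auto simp: small_def)
    show "f ` \<R> \<subseteq> param_formulas L M \<Gamma> A" using f by auto
    fix F assume F: "F \<subseteq> f ` \<R>" "finite F"
    obtain G where G: "G \<subseteq> \<R>" "finite G" "F = f ` G" using finite_subset_image[OF F(2,1)] by blast
    obtain a where a: "a \<in> tuples M \<Gamma>" "\<forall>R\<in>G. R a" using assms(4)[OF G(1,2)] by blast
    have "sat M (a @ snd (f R)) (fst (f R))" if "R \<in> G" for R
      using f(2)[of R a] a G(1) that by blast
    then show "\<exists>a\<in>tuples M \<Gamma>. \<forall>p\<in>F. case p of (\<phi>, c) \<Rightarrow> sat M (a @ c) \<phi>"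
      using a(1) G(3) by (intro bexI[of _ a]) (auto simp: case_prod_beta)
  qed (use assms in auto)
  then obtain a where a: "a \<in> tuples M \<Gamma>" "\<forall>p\<in>f ` \<R>. case p of (\<phi>, c) \<Rightarrow> sat M (a @ c) \<phi>"
    by blast
  have "R a" if "R \<in> \<R>" for R
    using bspec[OF a(2), of "f R"] that f(2)[OF that a(1)] by (simp add: case_prod_beta)
  then show ?thesis using a(1) by blast
qed

text \<open>Besides extending an equality of types by one element, this keeps the new element
  generic over an additional small set \<open>D\<close>. If \<open>x\<close> is not algebraic over
  \<open>B\<close> and \<open>r\<close>, each formula of its type has infinitely many solutions,
  over \<open>r\<close> and hence over \<open>r'\<close>, and these are not covered by the finitely
  many finite sets that a finite part of the requirements excludes.\<close>

lemma extend_avoiding: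
  assumes "small B" "small D" "eqv B \<Gamma> r r'" "x \<in> carrier M s" "s \<in> sorts L" "set \<Gamma> \<subseteq> sorts L"
  obtains x' where "x' \<in> carrier M s" "eqv B (\<Gamma> @ [s]) (r @ [x]) (r' @ [x'])"
    "x \<notin> acl L M (B \<union> set r) \<Longrightarrow> x' \<notin> acl L M (B \<union> D \<union> set r')"
proof -
  have r: "r \<in> tuples M \<Gamma>" "r' \<in> tuples M \<Gamma>" using eqv_tuples[OF assms(3)] by auto
  let ?C = "B \<union> D \<union> set r'"
  let ?N = "x \<notin> acl L M (B \<union> set r)"
  let ?P = "\<lambda>R. \<exists>S. dfn B (\<Gamma> @ [s]) S \<and> S (r @ [x]) \<and> R = (\<lambda>a. S (r' @ a))"
  \<comment> \<open>The type of \<open>x\<close> over \<open>B\<close> and \<open>r\<close>, read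
    over \<open>r'\<close>; and, when \<open>x\<close> is not algebraic, all predicates over
    \<open>?C\<close> with finite complement, which together keep the realization outside
    \<open>acl\<close> of \<open>?C\<close>.\<close>
  let ?\<R> = "{R. dfn ?C [s] R \<and> (?P R \<or> ?N \<and> finite {z \<in> carrier M s. \<not> R [z]})}"
  have "\<exists>a\<in>tuples M [s]. \<forall>R\<in>?\<R>. R a"
  proof (rule saturation)
    show "small ?C" using assms r by (intro small_Un small_set)
    fix F assume F: "F \<subseteq> ?\<R>" "finite F"
    define F1 where "F1 = {R \<in> F. ?P R}"
    have "\<forall>R\<in>F1. ?P R" by (auto simp: F1_def)
    then obtain S where S: "\<And>R. R \<in> F1 \<Longrightarrow> dfn B (\<Gamma> @ [s]) (S R)" "\<And>R. R \<in> F1 \<Longrightarrow> S R (r @ [x])"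
      "\<And>R a. R \<in> F1 \<Longrightarrow> R a \<longleftrightarrow> S R (r' @ a)" by metis
    define T where "T b = (\<forall>R\<in>F1. S R b)" for b
    have T: "dfn B (\<Gamma> @ [s]) T" unfolding T_def
      by (rule dfn_ball[of F1, OF _ _ assms(5)]) (use F S in \<open>auto simp: F1_def\<close>)
    have Tx: "T (r @ [x])" using S by (simp add: T_def)
    have "tmfs B (s # \<Gamma>) (\<Gamma> @ [s]) (\<lambda>b. tl b @ [hd b])"
      by (intro tmfs_append tmfs_tl_id tmfs_Cons tmf_hd tmfs_Nil)
    \<comment> \<open>Being at least \<open>m\<close> in number is part of the type of
      \<open>r\<close>, so infinitely many solutions over \<open>r\<close> give infinitely many over
      \<open>r'\<close>.\<close>
    from dfn_atl[OF assms(5), of B \<Gamma> "\<lambda>x a. T (a @ [x])", OF dfn_sub[OF T this]]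
    have "atl m {y \<in> carrier M s. T (r @ [y])} \<longleftrightarrow> atl m {y \<in> carrier M s. T (r' @ [y])}" for m
      by (rule eqvD[OF assms(3)])
    note atl = this
    have "dfn (B \<union> set r) [s] (\<lambda>a. T (r @ a))"
      using r assms(6) by (intro dfn_sub[OF dfn_mono[OF T]] tmfs_append tmfs_const tmfs_id) auto
    then have Ninf: "infinite {y \<in> carrier M s. T (r @ [y])}" if ?N
      using Tx that assms(4,5) unfolding acl_iff by blast
    define X where "X = {y \<in> carrier M s. T (r' @ [y])}"
    have "\<exists>y\<in>X. \<forall>R\<in>F - F1. R [y]"
    proof (cases ?N)
      case True
      have "infinite X"
        using Ninf[OF True] atl[of "Suc (card X)"] by (auto simp: X_def atl_def)
      moreover have "finite (\<Union>R\<in>F - F1. {z \<in> carrier M s. \<not> R [z]})"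
        using F by (auto simp: F1_def)
      ultimately have "\<exists>y\<in>X. y \<notin> (\<Union>R\<in>F - F1. {z \<in> carrier M s. \<not> R [z]})"
        by (meson finite_subset subsetI)
      then show ?thesis by (auto simp: X_def)
    next
      case False
      then have "F - F1 = {}" using F by (auto simp: F1_def)
      moreover have "X \<noteq> {}" using atl[of "Suc 0"] Tx assms(4) by (auto simp: X_def)
      ultimately show ?thesis by auto
    qed
    then obtain y where y: "y \<in> X" "\<forall>R\<in>F - F1. R [y]" by blast
    then have "\<forall>R\<in>F. R [y]" using S(3) by (auto simp: X_def T_def)
    then show "\<exists>a\<in>tuples M [s]. \<forall>R\<in>F. R a" using y by (auto simp: X_def intro: bexI[of _ "[y]"])
  qed (use assms(5) in auto)
  then obtain a where a: "a \<in> tuples M [s]" "\<forall>R\<in>?\<R>. R a" by (rule bexE)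
  obtain x' where x'0: "a = [x']" "x' \<in> carrier M s" using a(1) by (auto simp: tuples_Cons)
  have x': "x' \<in> carrier M s" "\<And>R. R \<in> ?\<R> \<Longrightarrow> R [x']"
    using x'0 bspec[OF a(2)] by (simp_all only:)
  have 1: "S (r' @ [x'])" if S: "dfn B (\<Gamma> @ [s]) S" "S (r @ [x])" for S
  proof -
    have "dfn ?C [s] (\<lambda>a. S (r' @ a))"
      using r assms(6) by (intro dfn_sub[OF dfn_mono[OF S(1)]] tmfs_append tmfs_const tmfs_id) auto
    then show ?thesis using x'(2)[of "\<lambda>a. S (r' @ a)"] S by auto
  qed
  show ?thesis
  proof (rule that[OF x'(1)])
    have "S (r @ [x]) = S (r' @ [x'])" if "dfn B (\<Gamma> @ [s]) S" for S
      using 1[OF that] 1[OF dfn_neg[OF that]] by blast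
    then show "eqv B (\<Gamma> @ [s]) (r @ [x]) (r' @ [x'])"
      using r assms(4) x'(1) unfolding eqv_def by (auto intro!: tuples_appendI)
    show "x' \<notin> acl L M ?C" if ?N
    proof
      assume "x' \<in> acl L M ?C"
      then obtain t R where t: "t \<in> sorts L" "x' \<in> carrier M t" "dfn ?C [t] R" "R [x']"
        "finite {x \<in> carrier M t. R [x]}" unfolding acl_iff by blast
      then have "t = s" using sorts_disjoint x' assms(5) by blast
      then show False using x'(2)[of "\<lambda>a. \<not> R a"] t that dfn_neg[OF t(3)] by auto
    qed
  qed
qed

text \<open>Realizes the type of \<open>r\<close> over \<open>B\<close> without making any further
  coordinate algebraic when \<open>D\<close> is added, by applying \<open>extend_avoiding\<close> to
  one coordinate after the other.\<close>

lemma move: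
  assumes "small B" "small D" "r \<in> tuples M \<Gamma>" "set \<Gamma> \<subseteq> sorts L"
  shows "\<exists>r'. eqv B \<Gamma> r r' \<and> (\<forall>i<length r. r ! i \<notin> acl L M (B \<union> set (take i r)) \<longrightarrow>
     r' ! i \<notin> acl L M (B \<union> D \<union> set (take i r')))"
  using assms(3,4)
proof (induction \<Gamma> arbitrary: r rule: rev_induct)
  case Nil
  then show ?case by (auto simp: eqv_def)
next
  case (snoc s \<Gamma>)
  then obtain q x where r: "r = q @ [x]" "q \<in> tuples M \<Gamma>" "x \<in> carrier M s"
    by (auto simp: tuples_append tuples_Cons)
  obtain q' where q': "eqv B \<Gamma> q q'" "\<And>i. i < length q \<Longrightarrow> q ! i \<notin> acl L M (B \<union> set (take i q)) \<Longrightarrow>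
     q' ! i \<notin> acl L M (B \<union> D \<union> set (take i q'))" using snoc.IH[OF r(2)] snoc.prems by auto
  obtain x' where x': "x' \<in> carrier M s" "eqv B (\<Gamma> @ [s]) (q @ [x]) (q' @ [x'])"
    "x \<notin> acl L M (B \<union> set q) \<Longrightarrow> x' \<notin> acl L M (B \<union> D \<union> set q')"
    using extend_avoiding[OF assms(1,2) q'(1) r(3)] snoc.prems by auto
  have "length q = length q'" 
    using tuples_length[OF eqv_tuples(1)[OF q'(1)]] tuples_length[OF eqv_tuples(2)[OF q'(1)]] by simp
  then show ?case using r(1) x' q' by (intro exI[of _ "q' @ [x']"]) (auto simp: less_Suc_eq nth_append)
qed

lemma extend:
  assumes "small A" "eqv A \<Gamma> r r'" "x \<in> tuples M \<Delta>" "set \<Gamma> \<subseteq> sorts L" "set \<Delta> \<subseteq> sorts L"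
  shows "\<exists>x'. eqv A (\<Gamma> @ \<Delta>) (r @ x) (r' @ x')"
  using assms(3,5)
proof (induction \<Delta> arbitrary: x rule: rev_induct)
  case Nil
  then show ?case using assms(2) by (auto intro!: exI[of _ "[]"])
next
  case (snoc s \<Delta>)
  then obtain q y where x: "x = q @ [y]" "q \<in> tuples M \<Delta>" "y \<in> carrier M s"
    by (auto simp: tuples_append tuples_Cons)
  then obtain q' where q': "eqv A (\<Gamma> @ \<Delta>) (r @ q) (r' @ q')" using snoc by auto
  obtain y' where "eqv A ((\<Gamma> @ \<Delta>) @ [s]) ((r @ q) @ [y]) ((r' @ q') @ [y'])"
    by (rule extend_avoiding[OF assms(1) assms(1) q' x(3)]) (use snoc.prems assms(4) in auto)
  then show ?case using x by auto
qed

text \<open>An infinite set is not covered by finitely many finite ones, so by saturation it has a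
  point in the complement of every finite set definable over \<open>A\<close>.\<close>

lemma generic:
  assumes "small A" "dfn A [s] (\<lambda>a. R (hd a))" "infinite {x \<in> carrier M s. R x}" "s \<in> sorts L"
  obtains x where "x \<in> carrier M s" "R x" "x \<notin> acl L M A"
proof -
  have "\<exists>a\<in>tuples M [s]. \<forall>Q\<in>insert (\<lambda>a. R (hd a)) {Q. dfn A [s] Q \<and> finite {z \<in> carrier M s. \<not> Q [z]}}. Q a"
  proof (rule saturation[OF assms(1)])
    fix F assume F: "F \<subseteq> insert (\<lambda>a. R (hd a)) {Q. dfn A [s] Q \<and> finite {z \<in> carrier M s. \<not> Q [z]}}" "finite F"
    then have "finite (\<Union>Q\<in>F - {\<lambda>a. R (hd a)}. {z \<in> carrier M s. \<not> Q [z]})" by auto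
    then obtain y where "y \<in> carrier M s" "R y" "y \<notin> (\<Union>Q\<in>F - {\<lambda>a. R (hd a)}. {z \<in> carrier M s. \<not> Q [z]})"
      using assms(3) by (metis (no_types, lifting) finite_subset mem_Collect_eq subsetI)
    then show "\<exists>a\<in>tuples M [s]. \<forall>Q\<in>F. Q a" by (intro bexI[of _ "[y]"]) auto
  qed (use assms in auto)
  then obtain x where x0: "x \<in> carrier M s" "R x" "\<forall>Q. dfn A [s] Q \<and> finite {z \<in> carrier M s. \<not> Q [z]} \<longrightarrow> Q [x]"
    by (auto simp: tuples_Cons)
  then have x: "x \<in> carrier M s" "R x" "\<And>Q. dfn A [s] Q \<Longrightarrow> finite {z \<in> carrier M s. \<not> Q [z]} \<Longrightarrow> Q [x]"
    by auto
  moreover have "x \<notin> acl L M A"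
  proof
    assume "x \<in> acl L M A"
    then obtain t Q where t: "t \<in> sorts L" "x \<in> carrier M t" "dfn A [t] Q" "Q [x]"
      "finite {x \<in> carrier M t. Q [x]}" unfolding acl_iff by blast
    then have "t = s" using sorts_disjoint x assms(4) by blast
    then show False using x(3)[OF dfn_neg[of A "[s]" Q]] t by auto
  qed
  ultimately show ?thesis using that by blast
qed

text \<open>The non-algebraic coordinate is moved away from all elements that occur in
  \<open>E\<close>, and the rest of the tuple is carried along by \<open>extend\<close>.\<close>

lemma infinite_eqv:
  assumes "small A" "a \<in> tuples M \<Gamma>" "set \<Gamma> \<subseteq> sorts L" "x \<in> set a" "x \<notin> acl L M A" "finite E"
  obtains b where "eqv A \<Gamma> a b" "b \<notin> E"
proof -
  \<comment> \<open>The finite set \<open>E\<close> is arbitrary and may contain lists with entries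
    outside the structure, whereas a small set consists of elements of the structure.\<close>
  define D where "D = elements L M \<inter> (\<Union>b\<in>E. set b)"
  obtain i where i: "i < length a" "a ! i = x" using assms(4) by (auto simp: in_set_conv_nth)
  have l: "length a = length \<Gamma>" using assms(2) by (rule tuples_length)
  define s where "s = \<Gamma> ! i"
  have s: "s \<in> sorts L" "x \<in> carrier M s" using i l assms(2,3) by (auto simp: s_def dest: tuples_nth nth_mem)
  have "small D" unfolding D_def using assms(6) by (intro small_finite) auto
  have "eqv A [] [] []" by (simp add: eqv_def)
  from extend_avoiding[OF assms(1) \<open>small D\<close> this s(2,1)]
  obtain x' where x': "x' \<in> carrier M s" "eqv A ([] @ [s]) ([] @ [x]) ([] @ [x'])"
    "x \<notin> acl L M (A \<union> set []) \<Longrightarrow> x' \<notin> acl L M (A \<union> D \<union> set [])" by auto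
  obtain a' where a': "eqv A ([s] @ \<Gamma>) ([x] @ a) ([x'] @ a')"
    using extend[OF assms(1) _ assms(2), of "[s]" "[x]" "[x']"] x' s assms(3) by auto
  have "tmfs A ([s] @ \<Gamma>) \<Gamma> (drop (length [s]))" by (rule tmfs_drop)
  from eqv_map[OF a' this] have 1: "eqv A \<Gamma> a a'" by simp
  have "dfn A ([s] @ \<Gamma>) (\<lambda>b. hd b = tl b ! i)"
    using i l s tmf_tl[OF tmf_nth[of i \<Gamma> A]] by (intro dfn_eq[of A _ s] tmf_hd) (auto simp: s_def tmf_hd)
  from eqvD[OF a' this] have "a' ! i = x'" using i by simp
  moreover have "i < length a'" using i l eqv_tuples(2)[OF 1] by (auto dest: tuples_length)
  ultimately have "x' \<in> set a'" by auto
  moreover have "x' \<notin> D" using x' assms(5) s(1) acl_incl[of x' "A \<union> D"] by (auto simp: elements_def)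
  moreover have "x' \<in> elements L M" using x'(1) s(1) by (auto simp: elements_def)
  ultimately show ?thesis using 1 that[of a'] by (auto simp: D_def)
qed

text \<open>Each coordinate has only finitely many possible values. Together with
  \<open>infinite_eqv\<close> this translates the clause of strong dividing that asks for infinitely
  many realizations into a coordinate outside \<open>acl\<close>.\<close>

lemma algebraic_finite:
  assumes "a \<in> tuples M \<Gamma>" "set \<Gamma> \<subseteq> sorts L" "set a \<subseteq> acl L M A"
  shows "finite {b. eqv A \<Gamma> a b}"
proof -
  have l: "length a = length \<Gamma>" using assms(1) by (rule tuples_length)
  have "\<exists>X. finite X \<and> (\<forall>b. eqv A \<Gamma> a b \<longrightarrow> b ! i \<in> X)" if i: "i < length \<Gamma>" for i
  proof -
    have "a ! i \<in> acl L M A" using i l assms(3) by auto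
    then obtain t Q where t: "t \<in> sorts L" "a ! i \<in> carrier M t" "dfn A [t] Q" "Q [a ! i]"
      "finite {x \<in> carrier M t. Q [x]}" unfolding acl_iff by blast
    have "t = \<Gamma> ! i" using t i assms(1,2) by (intro sorts_disjoint[of _ _ "a ! i"]) (auto dest: tuples_nth)
    with t have "dfn A \<Gamma> (\<lambda>b. Q [b ! i])"
      using i by (intro dfn_sub[OF t(3)] tmfs_Cons tmfs_Nil) (auto intro: tmf_nth)
    then have "Q [b ! i]" if "eqv A \<Gamma> a b" for b using eqvD[OF that] t by blast
    moreover have "b ! i \<in> carrier M t" if "eqv A \<Gamma> a b" for b
      using eqv_tuples(2)[OF that] i \<open>t = \<Gamma> ! i\<close> by (auto dest: tuples_nth)
    ultimately show ?thesis using t(5) by (intro exI[of _ "{x \<in> carrier M t. Q [x]}"]) auto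
  qed
  then obtain X where X: "\<And>i. i < length \<Gamma> \<Longrightarrow> finite (X i)"
    "\<And>i b. i < length \<Gamma> \<Longrightarrow> eqv A \<Gamma> a b \<Longrightarrow> b ! i \<in> X i" by metis
  let ?X = "\<Union>i<length \<Gamma>. X i"
  have "set b \<subseteq> ?X \<and> length b = length \<Gamma>" if "eqv A \<Gamma> a b" for b
    using X(2)[OF _ that] eqv_tuples(2)[OF that] by (auto simp: in_set_conv_nth dest!: tuples_length) force
  then have "{b. eqv A \<Gamma> a b} \<subseteq> {b. set b \<subseteq> ?X \<and> length b = length \<Gamma>}" by blast
  moreover have "finite ?X" using X by auto
  ultimately show ?thesis using finite_lists_length_eq finite_subset by blast
qed

end

subsection \<open>Definability of infinity\<close>

text \<open>The intended structure is \<open>M\<^sup>e\<^sup>q\<close> with home sort \<open>h\<close> and \<open>g x c w = x + cw\<close>; of the field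
  structure on \<open>h\<close> only the stated properties of \<open>g\<close> matter.\<close>

locale rosy_pregeometric_field = saturated_structure L M \<kappa>
  for L :: "('s, 'f, 'r) language" and M :: "('s, 'f, 'r, 'a) struct" and \<kappa> :: "'k rel" +
  fixes h :: 's and g :: "'a \<Rightarrow> 'a \<Rightarrow> 'a \<Rightarrow> 'a" and zero :: 'a
  assumes h: "h \<in> sorts L"
    and infinite_h: "infinite (carrier M h)"
    and reps: "\<And>s x. s \<in> sorts L \<Longrightarrow> x \<in> carrier M s \<Longrightarrow>
      \<exists>n t r. has_sort L (replicate n h) t s \<and> r \<in> tuples M (replicate n h) \<and> eval M r t = x"
    and exchange: "\<And>A a b. A \<subseteq> carrier M h \<Longrightarrow> a \<in> carrier M h \<Longrightarrow> b \<in> carrier M h \<Longrightarrow>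
      a \<in> acl L M (insert b A) \<Longrightarrow> a \<notin> acl L M A \<Longrightarrow> b \<in> acl L M (insert a A)"
    and finite_ranks: "finite_local_ranks L M"
    and g_term: "\<exists>t. has_sort L [h, h, h] t h \<and>
      (\<forall>x\<in>carrier M h. \<forall>c\<in>carrier M h. \<forall>w\<in>carrier M h. eval M [x, c, w] t = g x c w)"
    and zero_term: "\<exists>t. has_sort L [] t h \<and> eval M [] t = zero"
    and g_slope: "\<And>x y z w c c'. {x, y, z, w, c, c'} \<subseteq> carrier M h \<Longrightarrow> z \<noteq> w \<Longrightarrow>
      g x c w = g y c z \<Longrightarrow> g x c' w = g y c' z \<Longrightarrow> c = c'"
    and g_inj: "\<And>x c w z. {x, c, w, z} \<subseteq> carrier M h \<Longrightarrow> c \<noteq> zero \<Longrightarrow> g x c w = g x c z \<Longrightarrow> w = z"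
    and g_cancel: "\<And>x y c w. {x, y, c, w} \<subseteq> carrier M h \<Longrightarrow> g x c w = g y c w \<Longrightarrow> x = y"
begin

abbreviation "H \<equiv> carrier M h"

lemma tmf_g:
  assumes "tmf A \<Gamma> h x" "tmf A \<Gamma> h c" "tmf A \<Gamma> h w"
  shows "tmf A \<Gamma> h (\<lambda>a. g (x a) (c a) (w a))"
proof -
  obtain t where t: "has_sort L [h, h, h] t h"
    "\<And>x c w. x \<in> H \<Longrightarrow> c \<in> H \<Longrightarrow> w \<in> H \<Longrightarrow> eval M [x, c, w] t = g x c w"
    using g_term by blast
  have F: "tmfs A \<Gamma> [h, h, h] (\<lambda>a. [x a, c a, w a])" using assms by (intro tmfs_Cons tmfs_Nil)
  have "tmfs A \<Gamma> [h] (\<lambda>a. [eval M [x a, c a, w a] t])"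
    using tmf_term[OF t(1) F] unfolding tmf_def .
  then show ?thesis unfolding tmf_def
  proof (rule tmfs_cong)
    fix a assume "a \<in> tuples M \<Gamma>"
    from tmfs_tuples[OF F this] show "[eval M [x a, c a, w a] t] = [g (x a) (c a) (w a)]"
      using t(2) by simp
  qed
qed

lemma g_closed: "x \<in> H \<Longrightarrow> c \<in> H \<Longrightarrow> w \<in> H \<Longrightarrow> g x c w \<in> H"
proof -
  assume x: "x \<in> H" "c \<in> H" "w \<in> H"
  obtain t where "has_sort L [h, h, h] t h" "eval M [x, c, w] t = g x c w"
    using g_term x by blast
  then show ?thesis using eval_carrier[of "[h, h, h]" t h "[x, c, w]"] x by simp
qed

lemma tmf_zero: "tmf A \<Gamma> h (\<lambda>_. zero)"
  using zero_term tmf_term[of "[]" _ h A \<Gamma> "\<lambda>_. []"] tmfs_Nil by auto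

lemma zero_closed: "zero \<in> H"
  using zero_term eval_carrier[of "[]" _ h "[]"] by auto

lemma zero_acl: "zero \<in> acl L M A"
  by (rule acl_dcl[of h _ _ "\<lambda>x. x = zero"]) (auto intro!: h zero_closed dfn_eq[of _ _ h] tmf_hd tmf_zero)

lemma home_elements: "A \<subseteq> H \<Longrightarrow> A \<subseteq> elements L M"
  using h by (auto simp: elements_def)

lemma small_home: "finite A \<Longrightarrow> A \<subseteq> H \<Longrightarrow> small A"
  by (intro small_finite home_elements)

text \<open>Over the reals of a representative an imaginary is the value of a term, so it can be
  treated as a named constant.\<close>

lemma home_rep:
  assumes "e \<in> elements L M"
  obtains Q where "finite Q" "Q \<subseteq> H"
    "\<And>A \<Gamma> s. Q \<subseteq> A \<Longrightarrow> s \<in> sorts L \<Longrightarrow> e \<in> carrier M s \<Longrightarrow> tmf A \<Gamma> s (\<lambda>_. e)"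
proof -
  obtain s where s: "s \<in> sorts L" "e \<in> carrier M s" using assms by (auto simp: elements_def)
  obtain n t r where t: "has_sort L (replicate n h) t s" "r \<in> tuples M (replicate n h)" "eval M r t = e"
    using reps[OF s] by blast
  have "set (replicate n h) \<subseteq> sorts L" using h by auto
  then have "tmf A \<Gamma> s (\<lambda>_. e)" if "set r \<subseteq> A" for A \<Gamma>
    using tmf_term[OF t(1) tmfs_const[OF t(2) that]] t(3) by simp
  then have "tmf A \<Gamma> s' (\<lambda>_. e)" if "set r \<subseteq> A" "s' \<in> sorts L" "e \<in> carrier M s'" for A \<Gamma> s'
    using that s sorts_disjoint[of s s' e] by auto
  then show ?thesis using t(2) by (intro that[of "set r"]) (auto simp: tuples_replicate)
qed

text \<open>Exchange is assumed over real parameters only. Hence imaginary parameters are replaced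
  by representatives before exchange is applied.\<close>

lemma home_params:
  assumes "dfn A \<Gamma> R"
  obtains Q where "finite Q" "Q \<subseteq> H" "dfn Q \<Gamma> R"
proof -
  obtain \<Theta> c \<phi> where 1: "set \<Theta> \<subseteq> sorts L" "c \<in> tuples M \<Theta>" "set c \<subseteq> A" "wf_fm L (\<Gamma> @ \<Theta>) \<phi>"
      "\<And>a. a \<in> tuples M \<Gamma> \<Longrightarrow> sat M (a @ c) \<phi> \<longleftrightarrow> R a" using assms unfolding dfn_def by blast
  have "\<exists>Q. finite Q \<and> Q \<subseteq> H \<and> tmfs Q \<Gamma> \<Theta> (\<lambda>_. c)" using 1(1,2)
  proof (induction \<Theta> arbitrary: c)
    case Nil
    then show ?case by (auto intro!: exI[of _ "{}"] tmfs_Nil)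
  next
    case (Cons s \<Theta>)
    then obtain x d where c: "c = x # d" "x \<in> carrier M s" "d \<in> tuples M \<Theta>" by (auto simp: tuples_Cons)
    obtain Q where Q: "finite Q" "Q \<subseteq> H" "tmfs Q \<Gamma> \<Theta> (\<lambda>_. d)"
      using Cons.IH[OF _ c(3)] Cons.prems by auto
    have "x \<in> elements L M" using c Cons.prems by (auto simp: elements_def)
    then obtain Q' where "finite Q'" "Q' \<subseteq> H" "\<And>A. Q' \<subseteq> A \<Longrightarrow> tmf A \<Gamma> s (\<lambda>_. x)"
      using home_rep[of x] c Cons.prems by (metis list.set_intros(1) subsetD)
    then show ?case using Q c tmfs_mono[OF Q(3), of "Q \<union> Q'"]
      by (intro exI[of _ "Q \<union> Q'"]) (auto intro: tmfs_Cons)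
  qed
  then obtain Q where Q: "finite Q" "Q \<subseteq> H" "tmfs Q \<Gamma> \<Theta> (\<lambda>_. c)" by blast
  have "dfn Q \<Gamma> (\<lambda>a. sat M (a @ c) \<phi>)"
    by (rule dfn_sub[OF dfn_wf[OF 1(4)]]) (intro tmfs_append tmfs_id Q(3))
  then have "dfn Q \<Gamma> R" by (rule dfn_cong) (use 1(5) in auto)
  then show ?thesis using that Q by blast
qed

text \<open>The list is read from the right: its head is chosen last, generically over the tail.
  Dropping the head therefore preserves independence, as the induction over coordinates
  needs.\<close>

fun indep :: "'a set \<Rightarrow> 'a list \<Rightarrow> bool" where
  "indep A [] \<longleftrightarrow> True"
| "indep A (u # v) \<longleftrightarrow> u \<notin> acl L M (A \<union> set v) \<and> indep A v"

lemma acl_home_eq: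
  assumes "x \<in> H" "tmf A [h] h F" "tmf A [h] h G" "F [x] = G [x]"
    "\<And>y. y \<in> H \<Longrightarrow> F [y] = G [y] \<Longrightarrow> y = x"
  shows "x \<in> acl L M A"
proof -
  have "{y \<in> H. F [y] = G [y]} \<subseteq> {x}" using assms(5) by auto
  then have "finite {y \<in> H. F [y] = G [y]}" by (rule finite_subset) simp
  moreover have "dfn A [h] (\<lambda>a. F a = G a)" by (rule dfn_eq[OF assms(2,3) h])
  ultimately show ?thesis unfolding acl_iff
    by (intro bexI[of _ h] conjI exI[of _ "\<lambda>a. F a = G a"] assms(1,4) h)
qed

text \<open>Since \<open>x + cw\<close> has dimension at most one, the fibre of \<open>(x, w) \<mapsto> x + cw\<close> on \<open>Z \<times> Z\<close>
  through a generic point is infinite.\<close>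

lemma additive_collision:
  assumes "finite Q" "Q \<subseteq> H" "c \<in> Q" "c \<noteq> zero"
    "dfn Q [h] (\<lambda>a. Z (hd a))" "infinite {x \<in> H. Z x}"
  obtains x w y z where "{x, w, y, z} \<subseteq> H" "Z x" "Z w" "Z y" "Z z" "z \<noteq> w"
    "g x c w = g y c z" "x \<notin> acl L M Q" "w \<notin> acl L M (insert x Q)" "y \<notin> acl L M (insert w (insert x Q))"
proof -
  have c: "c \<in> H" using assms by auto
  obtain x where x: "x \<in> H" "Z x" "x \<notin> acl L M Q"
    by (rule generic[where R = Z, OF small_home[OF assms(1,2)] assms(5,6) h])
  have Q1: "finite (insert x Q)" "insert x Q \<subseteq> H" using assms x by auto
  have "dfn (insert x Q) [h] (\<lambda>a. Z (hd a))" using assms(5) by (rule dfn_mono) auto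
  then obtain w where w: "w \<in> H" "Z w" "w \<notin> acl L M (insert x Q)"
    by (rule generic[where R = Z, OF small_home[OF Q1] _ assms(6) h])
  define s where "s = g x c w"
  have s: "s \<in> H" using x w c by (simp add: s_def g_closed)
  have "w \<in> acl L M (insert s (insert x Q))"
  proof (rule acl_home_eq)
    show "tmf (insert s (insert x Q)) [h] h (\<lambda>a. g x c (hd a))"
      using x c assms(3) h by (intro tmf_g tmf_const tmf_hd) auto
    show "tmf (insert s (insert x Q)) [h] h (\<lambda>a. s)" using s h by (intro tmf_const) auto
    show "y = w" if "y \<in> H" "g x c (hd [y]) = s" for y
      using g_inj[of x c w y] that x w c assms(4) by (simp add: s_def)
  qed (use w in \<open>auto simp: s_def\<close>)
  \<comment> \<open>Were \<open>x\<close> algebraic over \<open>s\<close> and \<open>Q\<close>,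
    exchange would make \<open>s\<close> algebraic over \<open>x\<close> and \<open>Q\<close>, and
    with it \<open>w\<close>, which was chosen generic over \<open>x\<close> and
    \<open>Q\<close>.\<close>
  then have xs: "x \<notin> acl L M (insert s Q)"
    using exchange[OF assms(2) x(1) s] acl_trans[of w s "insert x Q"] x(3) w(3) by blast
  \<comment> \<open>The projection of the fibre over \<open>s\<close> to its first coordinate. It
    contains \<open>x\<close>, which is not algebraic over the parameters of \<open>S\<close>, so it
    is infinite and has a point \<open>y\<close> that is generic over everything chosen so
    far.\<close>
  define S where "S y \<longleftrightarrow> Z y \<and> (\<exists>z\<in>H. Z z \<and> g y c z = s)" for y
  have S: "dfn (insert s Q) [h] (\<lambda>a. S (hd a))"
    unfolding S_def
  proof (intro dfn_conj dfn_ex h)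
    show "dfn (insert s Q) [h] (\<lambda>a. Z (hd a))" using assms(5) by (rule dfn_mono) auto
    show "dfn (insert s Q) [h, h] (\<lambda>b. Z (hd b))"
      using dfn_sub[OF dfn_mono[OF assms(5) subset_insertI], where \<Gamma> = "[h, h]" and F = "\<lambda>b. [hd b]"]
      by (simp add: tmfs_Cons tmfs_Nil tmf_hd)
    show "dfn (insert s Q) [h, h] (\<lambda>b. g (hd (tl b)) c (hd b) = s)"
      using s c assms(3) h by (intro dfn_eq[of _ _ h] tmf_g tmf_const tmf_hd tmf_tl) auto
  qed
  have "S x" using x w by (auto simp: S_def s_def)
  then have Sinf: "infinite {y \<in> H. S y}" by (rule not_acl_infinite[OF xs h x(1) S])
  have Q2: "finite (insert w (insert x (insert s Q)))" "insert w (insert x (insert s Q)) \<subseteq> H"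
    using assms x s w by auto
  have "dfn (insert w (insert x (insert s Q))) [h] (\<lambda>a. S (hd a))" using S by (rule dfn_mono) auto
  then obtain y where y: "y \<in> H" "S y" "y \<notin> acl L M (insert w (insert x (insert s Q)))"
    by (rule generic[where R = S, OF small_home[OF Q2] _ Sinf h])
  have y': "y \<notin> acl L M (insert w (insert x Q))" 
    by (rule not_acl_mono[OF y(3)]) auto
  obtain z where z: "z \<in> H" "Z z" "g y c z = s" using y(2) by (auto simp: S_def)
  have "y \<noteq> x" using y' acl_incl[of x "insert w (insert x Q)"] x home_elements[of "{x}"] by auto
  then have "z \<noteq> w" using g_cancel[of x y c w] x y w c z by (auto simp: s_def)
  then show ?thesis using that[of x w y z] x w y z y' by (simp add: s_def S_def)
qed

lemma exchange_out:
  assumes "finite A" "A \<subseteq> H" "c \<in> H" "x \<in> H" "c \<notin> acl L M A"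
    "x \<notin> acl L M (insert c A)"
  shows "c \<notin> acl L M (insert x A)"
  using exchange[of A c x] assms by blast

text \<open>The elements \<open>x\<close>, \<open>w\<close>, \<open>y\<close> are chosen independent
  over \<open>A\<close> and \<open>c\<close>, so by symmetry \<open>c\<close> remains generic over
  \<open>A\<close>, \<open>x\<close>, \<open>w\<close>, \<open>y\<close>. As the quadruple
  determines its slope \<open>c\<close>, the point \<open>z\<close> cannot be algebraic over the
  other three: otherwise \<open>c\<close> would be.\<close>

lemma generic_collision:
  assumes "finite A" "A \<subseteq> H" "c \<in> H" "c \<notin> acl L M A"
    "dfn A [h] (\<lambda>a. Z (hd a))" "infinite {x \<in> H. Z x}"
  obtains x w y z where "{x, w, y, z} \<subseteq> H" "Z x" "Z w" "Z y" "Z z" "z \<noteq> w"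
    "g x c w = g y c z" "indep A [z, y, w, x]"
proof -
  have D: "dfn (insert c A) [h] (\<lambda>a. Z (hd a))" using assms(5) by (rule dfn_mono) auto
  have c0: "c \<noteq> zero" using zero_acl[of A] assms(4) by auto
  have A: "finite (insert c A)" "insert c A \<subseteq> H" using assms by auto
  obtain x w y z where *: "{x, w, y, z} \<subseteq> H" "Z x" "Z w" "Z y" "Z z" "z \<noteq> w"
    "g x c w = g y c z" "x \<notin> acl L M (insert c A)" "w \<notin> acl L M (insert x (insert c A))"
    "y \<notin> acl L M (insert w (insert x (insert c A)))"
    by (rule additive_collision[where Z = Z, OF A insertI1 c0 D assms(6)])
  have H: "x \<in> H" "w \<in> H" "y \<in> H" "z \<in> H" using *(1) by auto
  have sub: "finite (insert x A)" "insert x A \<subseteq> H"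
    "finite (insert w (insert x A))" "insert w (insert x A) \<subseteq> H" using H assms(1,2) by auto
  have c1: "c \<notin> acl L M (insert x A)"
    by (rule exchange_out[OF assms(1,2,3) H(1) assms(4) *(8)])
  have c2: "c \<notin> acl L M (insert w (insert x A))"
    by (rule exchange_out[OF sub(1,2) assms(3) H(2) c1]) (use *(9) in \<open>simp add: insert_commute\<close>)
  have c3: "c \<notin> acl L M (insert y (insert w (insert x A)))"
    by (rule exchange_out[OF sub(3,4) assms(3) H(3) c2]) (use *(10) in \<open>simp add: insert_commute\<close>)
  let ?B = "insert y (insert w (insert x A))"
  have "c \<in> acl L M (insert z ?B)"
  proof (rule acl_home_eq)
    show "tmf (insert z ?B) [h] h (\<lambda>a. g x (hd a) w)"
      using H h by (intro tmf_g tmf_const tmf_hd) auto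
    show "tmf (insert z ?B) [h] h (\<lambda>a. g y (hd a) z)"
      using H h by (intro tmf_g tmf_const tmf_hd) auto
    show "c' = c" if "c' \<in> H" "g x (hd [c']) w = g y (hd [c']) z" for c'
      using g_slope[of x y z w c' c] that H *(6,7) assms(3) by simp
  qed (use *(7) assms(3) in auto)
  then have "z \<notin> acl L M ?B" using acl_trans c3 by blast
  moreover have "y \<notin> acl L M (insert w (insert x A))" "w \<notin> acl L M (insert x A)" "x \<notin> acl L M A"
    by (rule not_acl_mono[OF *(10)] not_acl_mono[OF *(9)] not_acl_mono[OF *(8)]; auto)+
  ultimately have "indep A [z, y, w, x]" by (simp add: Un_insert_right)
  then show ?thesis using that[of x w y z] *(1-7) by simp
qed

text \<open>The condition \<open>z \<noteq> w\<close> rules out the trivial coincidence of a pair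
  with itself and makes \<open>c\<close> the unique slope of the quadruple.\<close>

definition collision :: "('a \<Rightarrow> bool) \<Rightarrow> 'a \<Rightarrow> bool" where
  "collision Z c \<longleftrightarrow> (\<exists>x\<in>H. \<exists>w\<in>H. \<exists>y\<in>H. \<exists>z\<in>H.
      Z x \<and> Z w \<and> Z y \<and> Z z \<and> z \<noteq> w \<and> g x c w = g y c z)"

lemma infinite_iff_collision:
  assumes "dfn P [h] (\<lambda>a. Z (hd a))"
  shows "infinite {x \<in> H. Z x} \<longleftrightarrow> (\<forall>c\<in>H. c \<noteq> zero \<longrightarrow> collision Z c)"
proof
  assume inf: "infinite {x \<in> H. Z x}"
  obtain Q where Q: "finite Q" "Q \<subseteq> H" "dfn Q [h] (\<lambda>a. Z (hd a))"
    using home_params[OF assms] by blast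
  show "\<forall>c\<in>H. c \<noteq> zero \<longrightarrow> collision Z c"
  proof (intro ballI impI)
    fix c assume c: "c \<in> H" "c \<noteq> zero"
    have D: "dfn (insert c Q) [h] (\<lambda>a. Z (hd a))" using Q(3) by (rule dfn_mono) auto
    have cQ: "finite (insert c Q)" "insert c Q \<subseteq> H" using c Q by auto
    obtain x w y z where "{x, w, y, z} \<subseteq> H" "Z x" "Z w" "Z y" "Z z" "z \<noteq> w" "g x c w = g y c z"
      by (rule additive_collision[where Z = Z, OF cQ insertI1 c(2) D inf]) blast
    then show "collision Z c" unfolding collision_def by blast
  qed
next
  assume *: "\<forall>c\<in>H. c \<noteq> zero \<longrightarrow> collision Z c"
  show "infinite {x \<in> H. Z x}"
  proof
    assume fin: "finite {x \<in> H. Z x}"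
    let ?Z = "{x \<in> H. Z x}"
    have "\<forall>c\<in>H - {zero}. \<exists>q. q \<in> ?Z \<times> ?Z \<times> ?Z \<times> ?Z \<and>
      (case q of (x, w, y, z) \<Rightarrow> z \<noteq> w \<and> g x c w = g y c z)"
    proof
      fix c assume c: "c \<in> H - {zero}"
      obtain x w y z where "x \<in> H" "w \<in> H" "y \<in> H" "z \<in> H"
        "Z x" "Z w" "Z y" "Z z" "z \<noteq> w" "g x c w = g y c z" using * c unfolding collision_def by blast
      then show "\<exists>q. q \<in> ?Z \<times> ?Z \<times> ?Z \<times> ?Z \<and> (case q of (x, w, y, z) \<Rightarrow> z \<noteq> w \<and> g x c w = g y c z)"
        by (intro exI[of _ "(x, w, y, z)"]) auto
    qed
    from bchoice[OF this]
    obtain f where f0: "\<forall>c\<in>H - {zero}. f c \<in> ?Z \<times> ?Z \<times> ?Z \<times> ?Z \<and>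
      (case f c of (x, w, y, z) \<Rightarrow> z \<noteq> w \<and> g x c w = g y c z)" by (rule exE)
    note f = bspec[OF f0, THEN conjunct1] bspec[OF f0, THEN conjunct2]
    \<comment> \<open>A quadruple with \<open>z \<noteq> w\<close> has only one slope, so a finite
      \<open>Z\<close> could serve only finitely many \<open>c\<close>.\<close>
    have "inj_on f (H - {zero})"
    proof (rule inj_onI)
      fix c c' assume c: "c \<in> H - {zero}" "c' \<in> H - {zero}" "f c = f c'"
      obtain x w y z where "f c = (x, w, y, z)" by (metis prod_cases4)
      then show "c = c'" using f[OF c(1)] f[OF c(2)] c g_slope[of x y z w c c'] by auto
    qed
    moreover have "f ` (H - {zero}) \<subseteq> ?Z \<times> ?Z \<times> ?Z \<times> ?Z" using f(1) by blast
    moreover have "finite (?Z \<times> ?Z \<times> ?Z \<times> ?Z)" using fin by blast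
    ultimately have "finite (H - {zero})" by (meson finite_imageD finite_subset)
    then show False using infinite_h by simp
  qed
qed

text \<open>The criterion of \<open>infinite_iff_collision\<close> is first-order uniformly in the
  parameters. This is elimination of the quantifier "there are infinitely many" on the home sort,
  and it adds nothing to the parameter set \<open>P\<close>.\<close>

lemma dfn_infinite:
  assumes R: "dfn P (h # \<Gamma>) (\<lambda>b. R (hd b) (tl b))" and \<Gamma>: "set \<Gamma> \<subseteq> sorts L"
  shows "dfn P \<Gamma> (\<lambda>a. infinite {x \<in> H. R x a})"
proof (rule dfn_cong)
  have R': "dfn P \<Delta> (\<lambda>b. R (f b) (F b))" if "tmf P \<Delta> h f" "tmfs P \<Delta> \<Gamma> F" for \<Delta> f F
    using dfn_sub[OF R tmfs_Cons[OF that]] by simp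
  show "dfn P \<Gamma> (\<lambda>a. \<forall>c\<in>H. c \<noteq> zero \<longrightarrow> collision (\<lambda>x. R x a) c)"
    unfolding collision_def
    by (intro dfn_all dfn_ex dfn_imp dfn_conj dfn_neg dfn_eq[of _ _ h] h R' tmf_g tmf_hd tmf_zero
      tmf_tl tmfs_tl_id tmfs_tl)
  fix a assume a: "a \<in> tuples M \<Gamma>"
  have "dfn (P \<union> set a) [h] (\<lambda>b. R (hd b) a)"
    using dfn_sub[OF dfn_mono[OF R Un_upper1[of P "set a"]], where \<Gamma> = "[h]" and F = "\<lambda>b. hd b # a"] a \<Gamma>
    by (simp add: tmfs_Cons tmf_hd tmfs_const)
  from infinite_iff_collision[OF this]
  show "(\<forall>c\<in>H. c \<noteq> zero \<longrightarrow> collision (\<lambda>x. R x a) c) \<longleftrightarrow> infinite {x \<in> H. R x a}"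
    by simp
qed

subsection \<open>Exchange between reals and imaginaries\<close>

text \<open>If every infinite definable \<open>R \<subseteq> Y\<close> had infinitely many infinite subsets \<open>R \<inter> G(_, e, t)\<close> for some
  \<open>t\<close>, then the local rank of \<open>Y\<close> with respect to \<open>G\<close> and the equation \<open>t = t'\<close> would be infinite.\<close>

lemma thin_out_uniform:
  assumes s: "s \<in> sorts L" and \<Theta>: "set \<Theta> \<subseteq> sorts L" and G: "dfn {} (h # s # \<Theta>) G"
    and bd: "\<And>t u. t \<in> tuples M \<Theta> \<Longrightarrow> u \<in> H \<Longrightarrow> \<not> atl (Suc m) {e \<in> carrier M s. G (u # e # t)}"
    and Y: "dfn P [h] (\<lambda>a. Y (hd a))" "infinite {u \<in> H. Y u}"
  obtains R where "dfn UNIV [h] (\<lambda>a. R (hd a))" "infinite {u \<in> H. R u}" "\<forall>u. R u \<longrightarrow> Y u"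
    "\<forall>t\<in>tuples M \<Theta>. finite {e \<in> carrier M s. infinite {u \<in> H. R u \<and> G (u # e # t)}}"
proof -
  obtain \<delta> where \<delta>: "wf_fm L (h # s # \<Theta>) \<delta>" "\<And>a. a \<in> tuples M (h # s # \<Theta>) \<Longrightarrow> sat M a \<delta> \<longleftrightarrow> G a"
    using dfn_empty[OF G] by blast
  let ?n = "length \<Theta>" and ?\<Delta> = "s # \<Theta>"
  \<comment> \<open>In the local rank \<open>y\<close> is the pair of \<open>e\<close> and
    \<open>t\<close>, while \<open>z\<close> is another tuple of sorts \<open>\<Theta>\<close>. The
    formula \<open>t = z\<close> fixes \<open>t\<close> and lets \<open>e\<close> vary, so each
    family that is tested is indexed by \<open>e\<close> alone.\<close>
  have "dfn {} (?\<Delta> @ \<Theta>) (\<lambda>b. take ?n (tl b) = drop ?n (tl b))"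
    using tmfs_tl[OF tmfs_take[of "{}" \<Theta> \<Theta>], of s] tmfs_tl[OF tmfs_drop[of "{}" \<Theta> \<Theta>], of s]
    by (intro dfn_eqs[OF _ _ \<Theta> s]) simp_all
  from dfn_empty[OF this] obtain \<pi> where \<pi>: "wf_fm L (?\<Delta> @ \<Theta>) \<pi>"
    "\<And>a. a \<in> tuples M (?\<Delta> @ \<Theta>) \<Longrightarrow> sat M a \<pi> \<longleftrightarrow> take ?n (tl a) = drop ?n (tl a)"
    by blast
  \<comment> \<open>By \<open>bd\<close> no \<open>u\<close> lies in \<open>G(_, e, t)\<close> for
    \<open>m + 1\<close> different \<open>e\<close>, hence the inconsistency constant
    \<open>Suc m\<close>.\<close>
  let ?rank = "local_rank_ge M [h] ?\<Delta> \<Theta> {\<delta>} {\<pi>} (Suc m)"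
  have inst_\<pi>: "inst M ?\<Delta> \<pi> c = (\<lambda>e. e # c) ` carrier M s" if c: "c \<in> tuples M \<Theta>" for c
  proof -
    have "sat M ((e # t) @ c) \<pi> \<longleftrightarrow> t = c" if "e \<in> carrier M s" "t \<in> tuples M \<Theta>" for e t
      using \<pi>(2)[of "(e # t) @ c"] that c tuples_appendI[of "e # t" M ?\<Delta> c \<Theta>]
      by (simp add: tuples_length)
    then show ?thesis using c by (auto simp: inst_def tuples_Cons)
  qed
  have inst_\<delta>: "(\<lambda>u. [u]) ` {u \<in> H. R u} \<inter> inst M [h] \<delta> (e # t) =
      (\<lambda>u. [u]) ` {u \<in> H. R u \<and> G (u # e # t)}"
    if "e \<in> carrier M s" "t \<in> tuples M \<Theta>" for R e t
    using that \<delta>(2) by (auto simp: inst_def)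
  have k: "k_inconsistent M (Suc m) [h] \<delta> (inst M ?\<Delta> \<pi> c)" if c: "c \<in> tuples M \<Theta>" for c
    unfolding k_inconsistent_def
  proof (intro allI impI notI)
    fix S assume S: "S \<subseteq> inst M ?\<Delta> \<pi> c" "finite S" "card S = Suc m"
      and "\<exists>x\<in>tuples M [h]. \<forall>a\<in>S. x \<in> inst M [h] \<delta> a"
    then obtain u where u: "u \<in> H" "\<And>a. a \<in> S \<Longrightarrow> [u] \<in> inst M [h] \<delta> a"
      by (auto simp: tuples_Cons)
    have S': "a = hd a # c \<and> hd a \<in> carrier M s" if "a \<in> S" for a using S(1) inst_\<pi>[OF c] that by auto
    then have "inj_on hd S" by (intro inj_onI) metis
    then have "card (hd ` S) = Suc m" using S(3) by (simp add: card_image)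
    moreover have "hd ` S \<subseteq> {e \<in> carrier M s. G (u # e # c)}"
    proof clarify
      fix a assume a: "a \<in> S"
      then have "sat M (u # a) \<delta>" using u(2)[OF a] by (simp add: inst_def)
      moreover obtain e where "a = e # c" "e \<in> carrier M s" using S'[OF a] by blast
      ultimately show "hd a \<in> carrier M s \<and> G (u # hd a # c)" using u(1) c \<delta>(2)[of "u # e # c"] by simp
    qed
    ultimately have "atl (Suc m) {e \<in> carrier M s. G (u # e # c)}"
      by (metis atl_def atl_mono order_refl)
    then show False using bd c u(1) by blast
  qed
  note c = that
  show ?thesis
  proof (rule ccontr)
    assume "\<not> thesis"
    then have no: "\<exists>t\<in>tuples M \<Theta>. infinite {e \<in> carrier M s. infinite {u \<in> H. R u \<and> G (u # e # t)}}"
      if "dfn UNIV [h] (\<lambda>a. R (hd a))" "infinite {u \<in> H. R u}" "\<And>u. R u \<Longrightarrow> Y u" for R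
      using that c[of R] by blast
    \<comment> \<open>The claim is proved for all such \<open>R\<close> at once because the sets
      \<open>R \<inter> G(_, e, t)\<close> reached one level lower are again infinite definable
      subsets of \<open>Y\<close>.\<close>
    have rank: "?rank n ((\<lambda>u. [u]) ` {u \<in> H. R u})"
      if "dfn UNIV [h] (\<lambda>a. R (hd a))" "infinite {u \<in> H. R u}" "\<And>u. R u \<Longrightarrow> Y u" for R n
      using that
    proof (induction n arbitrary: R)
      case 0
      then have "{u \<in> H. R u} \<noteq> {}" by (metis finite.emptyI)
      then show ?case by simp
    next
      case (Suc n)
      obtain t where t: "t \<in> tuples M \<Theta>"
        "infinite {e \<in> carrier M s. infinite {u \<in> H. R u \<and> G (u # e # t)}}"
        using no[OF Suc.prems] by blast
      let ?E = "{e \<in> carrier M s. infinite {u \<in> H. R u \<and> G (u # e # t)}}"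
      let ?X = "(\<lambda>u. [u]) ` {u \<in> H. R u}"
      have "?rank n (?X \<inter> inst M [h] \<delta> (e # t))"
        if e: "e \<in> ?E" for e
      proof -
        have "tmfs UNIV [h] (h # s # \<Theta>) (\<lambda>a. hd a # e # t)"
          using e t(1) s \<Theta> by (intro tmfs_Cons tmf_hd tmf_const tmfs_const) auto
        from dfn_sub[OF dfn_mono[OF G] this]
        have "dfn UNIV [h] (\<lambda>a. R (hd a) \<and> G (hd a # e # t))"
          by (intro dfn_conj Suc.prems(1)) auto
        then have "?rank n
            ((\<lambda>u. [u]) ` {u \<in> H. R u \<and> G (u # e # t)})"
          using e Suc.prems(3) by (intro Suc.IH) auto
        then show ?thesis using inst_\<delta>[of e t R] e t(1) by simp
      qed
      then have "(\<lambda>e. e # t) ` ?E \<subseteq> {a \<in> inst M ?\<Delta> \<pi> t.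
          ?rank n (?X \<inter> inst M [h] \<delta> a)}"
        using inst_\<pi>[OF t(1)] by auto
      moreover have "infinite ((\<lambda>e. e # t) ` ?E)"
        using t(2) finite_imageD[of "\<lambda>e. e # t" ?E] by (auto simp: inj_on_def)
      ultimately have "infinite {a \<in> inst M ?\<Delta> \<pi> t.
          ?rank n (?X \<inter> inst M [h] \<delta> a)}"
        by (rule infinite_super)
      then show ?case using k[OF t(1)] t(1) by auto
    qed
    obtain \<Xi> e \<theta> where \<theta>: "set \<Xi> \<subseteq> sorts L" "e \<in> tuples M \<Xi>" "wf_fm L ([h] @ \<Xi>) \<theta>"
      "\<forall>a\<in>tuples M [h]. sat M (a @ e) \<theta> \<longleftrightarrow> Y (hd a)" using Y(1) unfolding dfn_def by blast
    have "inst M [h] \<theta> e = (\<lambda>u. [u]) ` {u \<in> H. Y u}"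
      using \<theta>(4) by (auto simp: inst_def tuples_Cons dest: bspec[of _ _ "[_]"])
    moreover have "\<exists>n. \<not> ?rank n (inst M [h] \<theta> e)"
      using finite_ranks[unfolded finite_local_ranks_def, THEN spec[of _ "[h]"], THEN spec[of _ ?\<Delta>],
        THEN spec[of _ \<Theta>], THEN spec[of _ "{\<delta>}"], THEN spec[of _ "{\<pi>}"], THEN spec[of _ "Suc m"],
        THEN spec[of _ \<Xi>], THEN spec[of _ \<theta>], THEN spec[of _ e]] s \<Theta> h \<delta>(1) \<pi>(1) \<theta>(1-3)
      by simp
    ultimately show False using rank[OF dfn_mono[OF Y(1)] Y(2)] by auto
  qed
qed

text \<open>Two improvements on \<open>thin_out_uniform\<close>. Parameters of \<open>G\<close> are
  allowed: they are moved into \<open>t\<close>, because local ranks are taken with respect to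
  formulas without parameters. And the finite sets of remaining \<open>e\<close> are bounded
  uniformly in \<open>t\<close>, by definability of infinity and saturation.\<close>

lemma thin_out:
  assumes s: "s \<in> sorts L" and \<Theta>: "set \<Theta> \<subseteq> sorts L" and G: "dfn P (h # s # \<Theta>) G"
    and bd: "\<And>t u. t \<in> tuples M \<Theta> \<Longrightarrow> u \<in> H \<Longrightarrow> \<not> atl (Suc m) {e \<in> carrier M s. G (u # e # t)}"
    and Y: "dfn P' [h] (\<lambda>a. Y (hd a))" "infinite {u \<in> H. Y u}"
  obtains R m' where "dfn UNIV [h] (\<lambda>a. R (hd a))" "infinite {u \<in> H. R u}" "\<forall>u. R u \<longrightarrow> Y u"
    "\<forall>t\<in>tuples M \<Theta>.
      \<not> atl (Suc m') {e \<in> carrier M s. infinite {u \<in> H. R u \<and> G (u # e # t)}}"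
proof -
  obtain \<Xi> c \<phi> where 1: "set \<Xi> \<subseteq> sorts L" "c \<in> tuples M \<Xi>" "set c \<subseteq> P" "wf_fm L ((h # s # \<Theta>) @ \<Xi>) \<phi>"
    "\<forall>a\<in>tuples M (h # s # \<Theta>). sat M (a @ c) \<phi> \<longleftrightarrow> G a" using G unfolding dfn_def by blast
  \<comment> \<open>The bound \<open>m\<close> is known only at the actual parameters
    \<open>c\<close>. The second conjunct enforces it at every value of the parameter variables and
    leaves \<open>G\<close> unchanged at \<open>c\<close>.\<close>
  define G0 where "G0 b \<longleftrightarrow> sat M b \<phi> \<and> \<not> atl (Suc m) {e \<in> carrier M s. sat M (hd b # e # tl (tl b)) \<phi>}" for b
  have \<phi>: "dfn {} (h # s # \<Theta> @ \<Xi>) (\<lambda>b. sat M b \<phi>)" using dfn_wf[OF 1(4)] by simp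
  have "tmfs {} (s # h # s # \<Theta> @ \<Xi>) (h # s # \<Theta> @ \<Xi>) (\<lambda>b. hd (tl b) # hd b # tl (tl (tl b)))"
    by (intro tmfs_Cons tmf_hd tmf_tl tmfs_tl tmfs_tl_id)
  from dfn_sub[OF \<phi> this] have G0: "dfn {} (h # s # \<Theta> @ \<Xi>) G0"
    unfolding G0_def by (intro dfn_conj dfn_neg \<phi> dfn_atl s)
  have sub: "{e \<in> carrier M s. G0 (u # e # t)} \<subseteq> {e \<in> carrier M s. sat M (u # e # t) \<phi>}" for u t
    by (auto simp: G0_def)
  have "\<not> atl (Suc m) {e \<in> carrier M s. G0 (u # e # t)}" for u t
  proof
    assume a: "atl (Suc m) {e \<in> carrier M s. G0 (u # e # t)}"
    then have "{e \<in> carrier M s. G0 (u # e # t)} \<noteq> {}" using atl_anti[OF a, of "Suc 0"] by simp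
    moreover have "atl (Suc m) {e \<in> carrier M s. sat M (u # e # t) \<phi>}" using atl_mono[OF a sub] .
    ultimately show False by (auto simp: G0_def)
  qed
  note bd0 = this
  have \<Theta>\<Xi>: "set (\<Theta> @ \<Xi>) \<subseteq> sorts L" using 1(1) \<Theta> by simp
  obtain R where R: "dfn UNIV [h] (\<lambda>a. R (hd a))" "infinite {u \<in> H. R u}"
    "\<forall>u. R u \<longrightarrow> Y u" "\<forall>t\<in>tuples M (\<Theta> @ \<Xi>).
      finite {e \<in> carrier M s. infinite {u \<in> H. R u \<and> G0 (u # e # t)}}"
    by (rule thin_out_uniform[OF s \<Theta>\<Xi> G0 bd0 Y])
  define K where "K t = {e \<in> carrier M s. infinite {u \<in> H. R u \<and> G (u # e # t)}}" for t
  have K: "finite (K t)" if t: "t \<in> tuples M \<Theta>" for t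
  proof -
    have sat: "sat M (u # e # t @ c) \<phi> \<longleftrightarrow> G (u # e # t)" if "u \<in> H" "e \<in> carrier M s" for u e
      using bspec[OF 1(5), of "u # e # t"] that t by simp
    have "{e \<in> carrier M s. sat M (u # e # t @ c) \<phi>} = {e \<in> carrier M s. G (u # e # t)}"
      if "u \<in> H" for u using sat that by auto
    then have "G0 (u # e # t @ c) \<longleftrightarrow> G (u # e # t)" if "u \<in> H" "e \<in> carrier M s" for u e
      using sat that bd[OF t] by (simp add: G0_def)
    then have "{u \<in> H. R u \<and> G (u # e # t)} = {u \<in> H. R u \<and> G0 (u # e # t @ c)}"
      if "e \<in> carrier M s" for e using that by auto
    then have "K t = {e \<in> carrier M s. infinite {u \<in> H. R u \<and> G0 (u # e # t @ c)}}"
      by (auto simp: K_def)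
    then show ?thesis using bspec[OF R(4) tuples_appendI[OF t 1(2)]] by simp
  qed
  have "tmfs UNIV (h # s # \<Theta>) [h] (\<lambda>b. [hd b])" by (intro tmfs_Cons tmf_hd tmfs_Nil)
  from dfn_conj[OF dfn_sub[OF R(1) this] dfn_Cons[OF dfn_mono[OF G]]]
  have "dfn UNIV (h # s # \<Theta>) (\<lambda>b. R (hd b) \<and> G (hd b # tl b))" by simp
  then obtain Q where Q: "finite Q" "Q \<subseteq> H" "dfn Q (h # s # \<Theta>) (\<lambda>b. R (hd b) \<and> G (hd b # tl b))"
    by (rule home_params)
  have "dfn Q (s # \<Theta>) (\<lambda>b. infinite {u \<in> H. R u \<and> G (u # b)})"
    using s \<Theta> by (intro dfn_infinite[OF Q(3)]) auto
  from dfn_Cons[OF this] have KD: "dfn Q \<Theta> (\<lambda>t. atl n (K t))" for n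
    unfolding K_def by (intro dfn_atl[OF s])
  \<comment> \<open>Every \<open>K t\<close> is finite, and having at least \<open>n\<close>
    elements is definable in \<open>t\<close>. If the sizes were unbounded, saturation would produce
    a \<open>t\<close> with \<open>K t\<close> infinite.\<close>
  have "\<exists>m'. \<forall>t\<in>tuples M \<Theta>. \<not> atl (Suc m') (K t)"
  proof (rule ccontr)
    assume "\<not> ?thesis"
    then have ex: "\<exists>t\<in>tuples M \<Theta>. atl (Suc n) (K t)" for n by auto
    have "\<exists>t\<in>tuples M \<Theta>. \<forall>S\<in>range (\<lambda>n t. atl n (K t)). S t"
    proof (rule saturation[OF small_home[OF Q(1,2)] \<Theta>])
      fix F assume "F \<subseteq> range (\<lambda>n t. atl n (K t))" "finite F"
      then obtain N where N: "finite N" "F = (\<lambda>n t. atl n (K t)) ` N" by (meson finite_subset_image)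
      obtain t where t: "t \<in> tuples M \<Theta>" "atl (Suc (Max N)) (K t)" using ex by blast
      have "atl n (K t)" if "n \<in> N" for n
        by (rule atl_anti[OF t(2)]) (use that N(1) in \<open>simp add: le_SucI\<close>)
      then have "\<forall>S\<in>F. S t" unfolding N(2) by simp
      then show "\<exists>t\<in>tuples M \<Theta>. \<forall>S\<in>F. S t" using t(1) by (rule bexI)
    qed (use KD in auto)
    then obtain t where t: "t \<in> tuples M \<Theta>" "\<forall>S\<in>range (\<lambda>n t. atl n (K t)). S t" by (rule bexE)
    have "atl (Suc (card (K t))) (K t)" by (rule bspec[OF t(2)]) simp
    then show False using K[OF t(1)] by (simp add: atl_def)
  qed
  then obtain m' where m': "\<forall>t\<in>tuples M \<Theta>. \<not> atl (Suc m') (K t)" by blast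
  show ?thesis
    by (rule that[OF R(1-3), of m']) (use m' in \<open>auto simp: K_def\<close>)
qed

text \<open>Thinning out one coordinate after the other: the set of \<open>e\<close> with \<open>G(e, u, v)\<close> is bounded for all
  \<open>(u, v)\<close>, hence so is the set of \<open>e\<close> such that \<open>G(e, u, v)\<close> for infinitely many \<open>u\<close>.\<close>

lemma dependent_on_generic:
  assumes s: "s \<in> sorts L"
  shows "dfn P (s # replicate n h) G \<Longrightarrow>
    (\<forall>v\<in>tuples M (replicate n h). \<not> atl (Suc m) {e \<in> carrier M s. G (e # v)}) \<Longrightarrow>
    dfn P' [h] (\<lambda>a. Y (hd a)) \<Longrightarrow> infinite {u \<in> H. Y u} \<Longrightarrow>
    \<exists>Q R F. finite Q \<and> Q \<subseteq> H \<and> dfn Q [h] (\<lambda>a. R (hd a)) \<and> infinite {u \<in> H. R u} \<and>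
      (\<forall>u. R u \<longrightarrow> Y u) \<and> finite F \<and>
      (\<forall>e\<in>carrier M s. \<forall>A v. Q \<subseteq> A \<longrightarrow> (\<forall>\<Gamma>. tmf A \<Gamma> s (\<lambda>_. e)) \<longrightarrow> v \<in> tuples M (replicate n h) \<longrightarrow>
        (\<forall>u\<in>set v. R u) \<longrightarrow> indep A v \<longrightarrow> G (e # v) \<longrightarrow> e \<in> F)"
proof (induction n arbitrary: P P' G m Y)
  case 0
  obtain Q where Q: "finite Q" "Q \<subseteq> H" "dfn Q [h] (\<lambda>a. Y (hd a))" by (rule home_params[OF 0(3)])
  have "finite {e \<in> carrier M s. G [e]}" using 0(2) by (auto simp: atl_def)
  then show ?case using Q 0(4)
    by (intro exI[of _ Q] exI[of _ Y] exI[of _ "{e \<in> carrier M s. G [e]}"]) auto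
next
  case (Suc n)
  let ?\<Theta> = "replicate n h"
  define G1 where "G1 b = G (hd (tl b) # hd b # tl (tl b))" for b
  have \<Theta>: "set ?\<Theta> \<subseteq> sorts L" using h by auto
  have "tmfs P (h # s # ?\<Theta>) (s # h # ?\<Theta>) (\<lambda>b. hd (tl b) # hd b # tl (tl b))"
    by (intro tmfs_Cons tmf_hd tmf_tl tmfs_tl tmfs_tl_id)
  from dfn_sub[OF _ this, of G] Suc.prems(1) have G1: "dfn P (h # s # ?\<Theta>) G1" by (simp add: G1_def[abs_def])
  have "\<not> atl (Suc m) {e \<in> carrier M s. G1 (u # e # t)}" if "t \<in> tuples M ?\<Theta>" "u \<in> H" for t u
    using bspec[OF Suc.prems(2), of "u # t"] that by (simp add: G1_def)
  then obtain R1 m' where R1: "dfn UNIV [h] (\<lambda>a. R1 (hd a))" "infinite {u \<in> H. R1 u}"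
    "\<forall>u. R1 u \<longrightarrow> Y u" "\<forall>t\<in>tuples M ?\<Theta>.
      \<not> atl (Suc m') {e \<in> carrier M s. infinite {u \<in> H. R1 u \<and> G1 (u # e # t)}}"
    by (rule thin_out[OF s \<Theta> G1 _ Suc.prems(3,4)])
  have "tmfs UNIV (h # s # ?\<Theta>) [h] (\<lambda>b. [hd b])" by (intro tmfs_Cons tmf_hd tmfs_Nil)
  from dfn_conj[OF dfn_sub[OF R1(1) this] dfn_Cons[OF dfn_mono[OF G1]]]
  have RG: "dfn UNIV (h # s # ?\<Theta>) (\<lambda>b. R1 (hd b) \<and> G1 (hd b # tl b))" by simp
  \<comment> \<open>By definability of infinity the condition left on \<open>e\<close> and the other
    \<open>n\<close> coordinates is again a formula; \<open>R1(4)\<close> supplies its bound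
    \<open>m'\<close>, so the induction hypothesis applies with \<open>R1\<close> in the place of
    \<open>Y\<close>.\<close>
  have "dfn UNIV (s # ?\<Theta>) (\<lambda>b. infinite {u \<in> H. R1 u \<and> G1 (u # b)})"
    using s \<Theta> by (intro dfn_infinite[OF RG]) auto
  from Suc.IH[OF this R1(4) R1(1,2)]
  obtain Q R F where Q: "finite Q" "Q \<subseteq> H" "dfn Q [h] (\<lambda>a. R (hd a))"
    "infinite {u \<in> H. R u}" "\<forall>u. R u \<longrightarrow> R1 u" "finite F" and
    F0: "\<forall>e\<in>carrier M s. \<forall>A v. Q \<subseteq> A \<longrightarrow> (\<forall>\<Gamma>. tmf A \<Gamma> s (\<lambda>_. e)) \<longrightarrow> v \<in> tuples M ?\<Theta> \<longrightarrow>
        (\<forall>u\<in>set v. R u) \<longrightarrow> indep A v \<longrightarrow> infinite {u \<in> H. R1 u \<and> G1 (u # e # v)} \<longrightarrow> e \<in> F"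
    by (elim exE conjE) (rule that; assumption)
  have F: "e \<in> F" if "e \<in> carrier M s" "Q \<subseteq> A" "\<And>\<Gamma>. tmf A \<Gamma> s (\<lambda>_. e)" "v \<in> tuples M ?\<Theta>"
        "\<And>u. u \<in> set v \<Longrightarrow> R u" "indep A v" "infinite {u \<in> H. R1 u \<and> G1 (u # e # v)}" for e A v
    using F0[rule_format, OF that] .
  obtain Q0 where Q0: "finite Q0" "Q0 \<subseteq> H"
    "dfn Q0 (h # s # ?\<Theta>) (\<lambda>b. R1 (hd b) \<and> G1 (hd b # tl b))" by (rule home_params[OF RG])
  have "e \<in> F" if e: "e \<in> carrier M s" "Q \<union> Q0 \<subseteq> A" "\<And>\<Gamma>. tmf A \<Gamma> s (\<lambda>_. e)"
    "v \<in> tuples M (replicate (Suc n) h)" "\<And>u. u \<in> set v \<Longrightarrow> R u" "indep A v" "G (e # v)" for e A v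
  proof -
    obtain u t where v: "v = u # t" "u \<in> H" "t \<in> tuples M ?\<Theta>" using e(4) by (auto simp: tuples_Cons)
    have "tmfs (A \<union> set t) [h] (h # s # ?\<Theta>) (\<lambda>a. hd a # e # t)"
      using v(3) \<Theta> by (intro tmfs_Cons tmf_hd tmfs_const tmf_mono[OF e(3)]) auto
    from dfn_sub[OF dfn_mono[OF Q0(3)] this] e(2)
    have "dfn (A \<union> set t) [h] (\<lambda>a. R1 (hd a) \<and> G1 (hd a # e # t))" by auto
    \<comment> \<open>This set is definable over \<open>A\<close> and \<open>t\<close> and contains
      a \<open>u\<close> that is not algebraic over them. So \<open>e\<close> and \<open>t\<close>
      satisfy the formula of the induction hypothesis, and \<open>t\<close> is still
      independent.\<close>
    then have "infinite {u \<in> H. R1 u \<and> G1 (u # e # t)}"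
      using e(5-7) v Q(5) by (intro not_acl_infinite[of u "A \<union> set t" h] h) (auto simp: G1_def)
    then show ?thesis using e v by (intro F[of e A t]) auto
  qed
  moreover have "dfn (Q \<union> Q0) [h] (\<lambda>a. R (hd a))" using Q(3) by (rule dfn_mono) auto
  ultimately show ?case using Q Q0(1,2) R1(3)
    by (intro exI[of _ "Q \<union> Q0"] exI[of _ R] exI[of _ F]) auto
qed

text \<open>The sets \<open>X_e\<close> are the fibres \<open>{c \<in> H. \<psi> c e}\<close>. The
  bound on \<open>e\<close> for a single \<open>c\<close> becomes a bound for quadruples, which is
  what the coordinatewise thinning can work with.\<close>

lemma finitely_many_infinite_fibres:
  assumes s: "s \<in> sorts L" and \<psi>: "dfn P [h, s] (\<lambda>b. \<psi> (hd b) (hd (tl b)))"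
    and bd: "\<And>c. c \<in> H \<Longrightarrow> \<not> atl (Suc m) {e \<in> carrier M s. \<psi> c e}"
  shows "finite {e \<in> carrier M s. infinite {c \<in> H. \<psi> c e}}"
proof (rule ccontr)
  assume inf: "infinite {e \<in> carrier M s. infinite {c \<in> H. \<psi> c e}}"
  let ?H = "[h, h, h, h]"
  \<comment> \<open>The arguments behind \<open>e\<close> are \<open>z\<close>, \<open>y\<close>,
    \<open>w\<close>, \<open>x\<close>, the order in which \<open>generic_collision\<close> delivers
    an independent quadruple; \<open>G\<close> says that its slope lies in
    \<open>X_e\<close>.\<close>
  define G where "G b \<longleftrightarrow> (\<exists>c\<in>H. \<psi> c (hd b) \<and> hd (tl b) \<noteq> hd (tl (tl (tl b))) \<and>
    g (hd (tl (tl (tl (tl b))))) c (hd (tl (tl (tl b)))) = g (hd (tl (tl b))) c (hd (tl b)))" for b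
  have G': "G [e, z, y, w, x] \<longleftrightarrow> (\<exists>c\<in>H. \<psi> c e \<and> z \<noteq> w \<and> g x c w = g y c z)" for e z y w x
    by (simp add: G_def)
  have "dfn P (h # s # ?H) (\<lambda>b. \<psi> (hd b) (hd (tl b)))"
    using dfn_sub[OF \<psi>, where \<Gamma> = "h # s # ?H" and F = "\<lambda>b. [hd b, hd (tl b)]"]
    by (simp add: tmfs_Cons tmfs_Nil tmf_hd tmf_tl)
  then have G: "dfn P (s # replicate 4 h) G"
    unfolding G_def
    by (simp add: numeral_eq_Suc, intro dfn_ex h dfn_conj dfn_neg dfn_eq[of _ _ h] tmf_g tmf_hd tmf_tl)
  have "\<forall>v\<in>tuples M (replicate 4 h). \<not> atl (Suc m) {e \<in> carrier M s. G (e # v)}"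
  proof (intro ballI notI)
    fix v assume v: "v \<in> tuples M (replicate 4 h)" and a: "atl (Suc m) {e \<in> carrier M s. G (e # v)}"
    obtain z y w x where v: "v = [z, y, w, x]" "{z, y, w, x} \<subseteq> H"
      using v by (auto simp: numeral_eq_Suc tuples_Cons)
    have "{e \<in> carrier M s. G (e # v)} \<noteq> {}" using atl_anti[OF a, of "Suc 0"] by simp
    then obtain c where c: "c \<in> H" "z \<noteq> w" "g x c w = g y c z" by (auto simp: v(1) G')
    \<comment> \<open>By \<open>g_slope\<close> the quadruple has no slope besides \<open>c\<close>,
      so it inherits the bound for \<open>c\<close>.\<close>
    have "{e \<in> carrier M s. G (e # v)} \<subseteq> {e \<in> carrier M s. \<psi> c e}"
    proof clarify
      fix e assume "G (e # v)"
      then obtain c' where c': "c' \<in> H" "\<psi> c' e" "g x c' w = g y c' z" by (auto simp: v(1) G')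
      then have "c' = c" using g_slope[of x y z w c' c] c v(2) by simp
      then show "\<psi> c e" using c' by simp
    qed
    then show False using bd[OF c(1)] atl_mono[OF a] by blast
  qed
  from dependent_on_generic[OF s G this, of "{}" "\<lambda>_. True"] infinite_h dfn_const[OF h, of "{}" "[h]" True]
  obtain Q R F where Q: "finite Q" "Q \<subseteq> H" "dfn Q [h] (\<lambda>a. R (hd a))"
    "infinite {u \<in> H. R u}" "finite F" and
    F: "\<And>e A v. e \<in> carrier M s \<Longrightarrow> Q \<subseteq> A \<Longrightarrow> (\<And>\<Gamma>. tmf A \<Gamma> s (\<lambda>_. e)) \<Longrightarrow> v \<in> tuples M (replicate 4 h) \<Longrightarrow>
        (\<And>u. u \<in> set v \<Longrightarrow> R u) \<Longrightarrow> indep A v \<Longrightarrow> G (e # v) \<Longrightarrow> e \<in> F"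
    by auto
  obtain e where e: "e \<in> carrier M s" "infinite {c \<in> H. \<psi> c e}" "e \<notin> F"
    using inf Q(5) by (metis (no_types, lifting) finite_subset mem_Collect_eq subsetI)
  have "e \<in> elements L M" using e(1) s by (auto simp: elements_def)
  then obtain E where E: "finite E" "E \<subseteq> H" "\<And>A \<Gamma>. E \<subseteq> A \<Longrightarrow> tmf A \<Gamma> s (\<lambda>_. e)"
    using home_rep[of e] s e(1) by metis
  obtain P0 where P0: "finite P0" "P0 \<subseteq> H" "dfn P0 [h, s] (\<lambda>b. \<psi> (hd b) (hd (tl b)))"
    by (rule home_params[OF \<psi>])
  \<comment> \<open>\<open>Q\<close> carries the parameters of \<open>R\<close>, \<open>P0\<close>
    those of \<open>\<psi>\<close>, and over \<open>E\<close> the imaginary \<open>e\<close> is a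
    term. Thus \<open>X_e\<close> and \<open>R\<close> are both definable over \<open>?A\<close>,
    and \<open>F\<close> may be applied to a quadruple independent over \<open>?A\<close>.\<close>
  let ?A = "Q \<union> E \<union> P0"
  have A: "finite ?A" "?A \<subseteq> H" using Q E P0 by auto
  have "tmfs ?A [h] [h, s] (\<lambda>a. [hd a, e])" by (intro tmfs_Cons tmfs_Nil tmf_hd E(3)) auto
  from dfn_sub[OF dfn_mono[OF P0(3)] this] have "dfn ?A [h] (\<lambda>a. \<psi> (hd a) e)" by auto
  then obtain c where c: "c \<in> H" "\<psi> c e" "c \<notin> acl L M ?A"
    by (rule generic[OF small_home[OF A] _ e(2) h])
  have R: "dfn ?A [h] (\<lambda>a. R (hd a))" using Q(3) by (rule dfn_mono) auto
  obtain x w y z where *: "{x, w, y, z} \<subseteq> H" "R x" "R w" "R y" "R z" "z \<noteq> w"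
    "g x c w = g y c z" "indep ?A [z, y, w, x]"
    by (rule generic_collision[where Z = R, OF A c(1,3) R Q(4)])
  have "e \<in> F"
  proof (rule F[of e ?A "[z, y, w, x]"])
    show "G (e # [z, y, w, x])" unfolding G' using c * by blast
    show "tmf ?A \<Gamma> s (\<lambda>_. e)" for \<Gamma> by (rule E(3)) auto
  qed (use * e(1) in \<open>auto simp: numeral_eq_Suc\<close>)
  then show False using e(3) by simp
qed

text \<open>A formula \<open>\<psi>\<close> over \<open>C\<close> witnesses that \<open>e\<close> is
  algebraic over \<open>x\<close> and \<open>C\<close>. If \<open>x\<close> were not algebraic over
  \<open>e\<close> and \<open>C\<close>, the fibre of \<open>\<psi>\<close> over \<open>e\<close>
  would be infinite. Only finitely many elements have an infinite fibre, and they form a set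
  definable over \<open>C\<close>; so \<open>e\<close> would be algebraic over
  \<open>C\<close>.\<close>

lemma surgical_exchange:
  assumes x: "x \<in> H" and e: "e \<in> acl L M (insert x C)" "e \<notin> acl L M C"
  shows "x \<in> acl L M (insert e C)"
proof (rule ccontr)
  assume xe: "x \<notin> acl L M (insert e C)"
  obtain s S0 where s: "s \<in> sorts L" "e \<in> carrier M s" "dfn (insert x C) [s] S0" "S0 [e]"
    "finite {e \<in> carrier M s. S0 [e]}" using e(1) unfolding acl_iff by blast
  have "dfn (C \<union> set [x]) [s] S0" "[x] \<in> tuples M [h]" "set [h] \<subseteq> sorts L" using s(3) x h by auto
  from dfn_abstract[OF this]
  obtain S where S': "dfn C ([s] @ [h]) S" "\<And>a. a \<in> tuples M [s] \<Longrightarrow> S0 a = S (a @ [x])" by blast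
  then have S: "dfn C [s, h] S" "\<And>e. e \<in> carrier M s \<Longrightarrow> S0 [e] = S [e, x]" by (auto simp: S'(2))
  define m where "m = card {e \<in> carrier M s. S0 [e]}"
  \<comment> \<open>The second conjunct extends to every \<open>c\<close> the bound \<open>m\<close>
    on the number of \<open>e\<close>, which is known for \<open>x\<close> only.\<close>
  define \<psi> where "\<psi> c e \<longleftrightarrow> S [e, c] \<and> \<not> atl (Suc m) {e \<in> carrier M s. S [e, c]}" for c e
  have SF: "dfn A \<Gamma> (\<lambda>b. S [f b, F b])" if "dfn A [s, h] S" "tmf A \<Gamma> s f" "tmf A \<Gamma> h F" for A \<Gamma> f F
    by (rule dfn_sub[OF that(1)]) (intro tmfs_Cons tmfs_Nil that)
  have \<psi>: "dfn A [h, s] (\<lambda>b. \<psi> (hd b) (hd (tl b)))" if "dfn A [s, h] S" for A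
    unfolding \<psi>_def by (intro dfn_conj dfn_neg dfn_atl SF[OF that] tmf_hd tmf_tl s(1))
  have \<psi>x: "\<psi> x e" using s(2,4,5) S(2) by (simp add: \<psi>_def m_def atl_def cong: conj_cong)
  have "\<not> atl (Suc m) {e \<in> carrier M s. \<psi> c e}" for c
  proof
    assume a: "atl (Suc m) {e \<in> carrier M s. \<psi> c e}"
    then have "{e \<in> carrier M s. \<psi> c e} \<noteq> {}" using atl_anti[OF a, of "Suc 0"] by simp
    moreover have "atl (Suc m) {e \<in> carrier M s. S [e, c]}" by (rule atl_mono[OF a]) (auto simp: \<psi>_def)
    ultimately show False by (auto simp: \<psi>_def)
  qed
  then have fin: "finite {e \<in> carrier M s. infinite {c \<in> H. \<psi> c e}}"
    by (intro finitely_many_infinite_fibres[OF s(1) \<psi>[OF S(1)]])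
  have "tmfs (insert e C) [h] [h, s] (\<lambda>a. [hd a, e])"
    using s(1,2) by (intro tmfs_Cons tmfs_Nil tmf_hd tmf_const) auto
  from dfn_sub[OF dfn_mono[OF \<psi>[OF S(1)]] this]
  have "dfn (insert e C) [h] (\<lambda>a. \<psi> (hd a) e)" by auto
  then have "infinite {c \<in> H. \<psi> c e}"
    using \<psi>x by (intro not_acl_infinite[OF xe h x])
  moreover have "dfn C [s] (\<lambda>a. infinite {c \<in> H. \<psi> c (hd a)})"
    using s(1) by (intro dfn_infinite \<psi>[OF S(1)]) auto
  ultimately have "e \<in> acl L M C" using fin s(1,2)
    by (intro acl_dcl[of s e C "\<lambda>e. infinite {c \<in> H. \<psi> c e}"])
  then show False using e(2) by blast
qed

subsection \<open>Thorn-rank\<close>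

text \<open>Its cardinality is the dimension of \<open>r\<close> over \<open>A\<close>. The index
  set itself is kept since enlarging \<open>A\<close> can only remove indices, so a strict drop is
  shown by exhibiting one that disappears.\<close>

definition gen_coords :: "'a set \<Rightarrow> 'a list \<Rightarrow> nat set" where
  "gen_coords A r = {i. i < length r \<and> r ! i \<notin> acl L M (A \<union> set (take i r))}"

lemma finite_gen_coords: "finite (gen_coords A r)"
  by (simp add: gen_coords_def)

lemma gen_coords_anti: "A \<subseteq> B \<Longrightarrow> gen_coords B r \<subseteq> gen_coords A r"
proof
  fix i assume "A \<subseteq> B" and i: "i \<in> gen_coords B r"
  then have "A \<union> set (take i r) \<subseteq> B \<union> set (take i r)" by blast
  from not_acl_mono[OF _ this, of "r ! i"] show "i \<in> gen_coords A r"
    using i by (simp add: gen_coords_def)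
qed

lemma card_gen_coords_anti: "A \<subseteq> B \<Longrightarrow> card (gen_coords B r) \<le> card (gen_coords A r)"
  by (intro card_mono gen_coords_anti finite_gen_coords)

text \<open>Whether a coordinate is algebraic over the earlier ones depends only on the type of an
  initial segment.\<close>

lemma gen_coords_eqv:
  assumes "eqv A \<Gamma> r r'" "set \<Gamma> \<subseteq> sorts L"
  shows "gen_coords A r = gen_coords A r'"
proof -
  have *: "gen_coords A r \<subseteq> gen_coords A r'" if e: "eqv A \<Gamma> r r'" for r r'
  proof
    fix i assume i: "i \<in> gen_coords A r"
    have t: "r \<in> tuples M \<Gamma>" "r' \<in> tuples M \<Gamma>" using eqv_tuples[OF e] by auto
    have l: "length r = length \<Gamma>" "length r' = length \<Gamma>" using t by (auto dest: tuples_length)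
    have i': "i < length \<Gamma>" using i l by (simp add: gen_coords_def)
    have "eqv A (take (Suc i) \<Gamma>) (take (Suc i) r) (take (Suc i) r')"
      using eqv_map[OF e, of "take (Suc i) \<Gamma>" "take (Suc i)"] i'
        tmfs_take[of A "take (Suc i) \<Gamma>" "drop (Suc i) \<Gamma>"] by simp
    then have e': "eqv A (take i \<Gamma> @ [\<Gamma> ! i]) (take i r @ [r ! i]) (take i r' @ [r' ! i])"
      using i' l by (simp add: take_Suc_conv_app_nth)
    have "take i r \<in> tuples M (take i \<Gamma>)" "take i r' \<in> tuples M (take i \<Gamma>)"
      using t by (simp_all add: tuples_def list_all2_takeI)
    moreover have "set (take i \<Gamma>) \<subseteq> sorts L" "\<Gamma> ! i \<in> sorts L"
      using assms(2) i' set_take_subset[of i \<Gamma>] nth_mem[OF i'] by blast+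
    ultimately show "i \<in> gen_coords A r'"
      using eqv_acl[OF e'] i l by (auto simp: gen_coords_def)
  qed
  show ?thesis using *[OF assms(1)] *[OF eqv_sym[OF assms(1)]] by blast
qed

text \<open>By inconsistency only finitely many realizations \<open>b\<close> of the type of
  \<open>a\<close> satisfy \<open>\<delta>(r, b)\<close>, so \<open>a\<close> is algebraic over
  \<open>A\<close> and \<open>r\<close>; since there are infinitely many realizations, some entry
  \<open>e\<close> of \<open>a\<close> is not algebraic over \<open>A\<close>. At the first
  coordinate of \<open>r\<close> that makes \<open>e\<close> algebraic, exchange can be applied:
  this coordinate is generic over \<open>A\<close> and its predecessors but algebraic once
  \<open>a\<close> is added.\<close>

lemma strongly_divides_drop:
  assumes A: "small A" and r: "r \<in> tuples M \<Gamma>" "set r \<subseteq> H" "set \<Gamma> \<subseteq> sorts L"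
    and div: "strongly_divides L M \<Gamma> \<Delta> \<delta> a A" and \<Delta>: "set \<Delta> \<subseteq> sorts L" and a: "a \<in> tuples M \<Delta>"
    and \<delta>: "wf_fm L (\<Gamma> @ \<Delta>) \<delta>" and ra: "r \<in> inst M \<Gamma> \<delta> a"
  shows "card (gen_coords (A \<union> set a) r) < card (gen_coords A r)"
proof -
  have real: "realizations L M \<Delta> A a = {b. eqv A \<Delta> a b}" using realizations_iff[OF a] by blast
  obtain k where k: "infinite {b. eqv A \<Delta> a b}" "k_inconsistent M k \<Gamma> \<delta> {b. eqv A \<Delta> a b}"
    using div unfolding strongly_divides_def real by blast
  define S where "S = {b. eqv A \<Delta> a b \<and> r \<in> inst M \<Gamma> \<delta> b}"
  have "finite S"
  proof (rule ccontr)
    assume "infinite S"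
    then obtain T where T: "T \<subseteq> S" "finite T" "card T = k" using infinite_arbitrarily_large by metis
    have "T \<subseteq> {b. eqv A \<Delta> a b}" "\<forall>b\<in>T. r \<in> inst M \<Gamma> \<delta> b" using T(1) by (auto simp: S_def)
    then show False using k(2) T(2,3) r(1) unfolding k_inconsistent_def by blast
  qed
  obtain e where e: "e \<in> set a" "e \<notin> acl L M A"
    using algebraic_finite[OF a \<Delta>, of A] k(1) by blast
  have "small (A \<union> set r)" using A small_set[OF r(1,3)] by (rule small_Un)
  have er: "e \<in> acl L M (A \<union> set r)"
  proof (rule ccontr)
    assume "e \<notin> acl L M (A \<union> set r)"
    \<comment> \<open>Otherwise \<open>a\<close> has a conjugate over \<open>A\<close> and
      \<open>r\<close> outside the finite set \<open>S\<close>. But \<open>\<delta>(r, _)\<close>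
      belongs to the type over \<open>A\<close> and \<open>r\<close>, which forces the conjugate
      into \<open>S\<close>.\<close>
    then obtain b where b: "eqv (A \<union> set r) \<Delta> a b" "b \<notin> S"
      using infinite_eqv[OF \<open>small (A \<union> set r)\<close> a \<Delta> e(1) _ \<open>finite S\<close>] by blast
    have "tmfs (A \<union> set r) \<Delta> (\<Gamma> @ \<Delta>) (\<lambda>b. r @ b)"
      using r by (intro tmfs_append tmfs_const tmfs_id) auto
    from eqvD[OF b(1) dfn_sub[OF dfn_wf[OF \<delta>] this]] have "r \<in> inst M \<Gamma> \<delta> b"
      using ra by (simp add: inst_def)
    moreover have "eqv A \<Delta> a b" using b(1) by (rule eqv_mono) auto
    ultimately show False using b(2) by (simp add: S_def)
  qed
  \<comment> \<open>The shortest initial segment of \<open>r\<close> over which \<open>e\<close>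
    becomes algebraic. It is not empty as \<open>e\<close> is not algebraic over \<open>A\<close>,
    so it ends in a coordinate \<open>j\<close>.\<close>
  define i where "i = (LEAST i. e \<in> acl L M (A \<union> set (take i r)))"
  have i: "e \<in> acl L M (A \<union> set (take i r))"
    unfolding i_def by (rule LeastI[of _ "length r"]) (use er in simp)
  have least: "e \<notin> acl L M (A \<union> set (take j r))" if "j < i" for j
    using that not_less_Least unfolding i_def by blast
  obtain j where j: "i = Suc j" using i e(2) by (cases i) auto
  have jr: "j < length r" using least[of j] i j by (cases "j < length r") auto
  let ?C = "A \<union> set (take j r)"
  have ej: "e \<notin> acl L M ?C" "e \<in> acl L M (insert (r ! j) ?C)"
    using least[of j] i j jr by (auto simp: take_Suc_conv_app_nth)
  have "r ! j \<in> acl L M (insert e ?C)"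
    by (rule surgical_exchange[OF subsetD[OF r(2) nth_mem[OF jr]] ej(2,1)])
  then have "r ! j \<in> acl L M (A \<union> set a \<union> set (take j r))" by (rule acl_mono) (use e in auto)
  moreover have "r ! j \<notin> acl L M ?C" using acl_trans[OF ej(2)] ej(1) by blast
  ultimately have "j \<in> gen_coords A r - gen_coords (A \<union> set a) r" using jr by (simp add: gen_coords_def)
  moreover have "gen_coords (A \<union> set a) r \<subseteq> gen_coords A r" by (rule gen_coords_anti) auto
  ultimately show ?thesis by (intro psubset_card_mono finite_gen_coords) auto
qed

text \<open>If the dimension did not drop from \<open>A\<close> to \<open>B\<close>, a realization
  \<open>r'\<close> of the type over \<open>B\<close> could be chosen with the same dimension even
  over \<open>B\<close> and all parameters of the dividing formulas. But \<open>r'\<close> satisfies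
  one of these formulas, and \<open>strongly_divides_drop\<close> makes the dimension smaller over
  its parameters.\<close>

lemma thorn_forking_drop:
  assumes B: "small B" "A \<subseteq> B" and r: "r \<in> tuples M \<Gamma>" "set \<Gamma> \<subseteq> {h}"
    and forks: "type_thorn_forks L M \<Gamma> (tp L M \<Gamma> B r) A"
  shows "card (gen_coords B r) < card (gen_coords A r)"
proof (rule ccontr)
  assume "\<not> ?thesis"
  then have ge: "card (gen_coords A r) \<le> card (gen_coords B r)" by simp
  have \<Gamma>: "set \<Gamma> \<subseteq> sorts L" using r(2) h by auto
  have A: "small A" using B card_of_mono1[of A B] unfolding small_def
    by (auto intro: ordLeq_ordLess_trans)
  obtain \<phi> b where \<phi>: "(\<phi>, b) \<in> tp L M \<Gamma> B r" "thorn_forks L M \<Gamma> \<phi> b A"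
    using forks unfolding type_thorn_forks_def by blast
  then obtain D where D: "finite D" "\<forall>(\<Delta>, \<delta>, a)\<in>D. set \<Delta> \<subseteq> sorts L \<and> a \<in> tuples M \<Delta> \<and>
      wf_fm L (\<Gamma> @ \<Delta>) \<delta> \<and> thorn_divides L M \<Gamma> \<Delta> \<delta> a A"
      "inst M \<Gamma> \<phi> b \<subseteq> (\<Union>(\<Delta>, \<delta>, a)\<in>D. inst M \<Gamma> \<delta> a)" unfolding thorn_forks_def by blast
  have "\<forall>d\<in>D. \<exists>c. set c \<subseteq> elements L M \<and>
      (case d of (\<Delta>, \<delta>, a) \<Rightarrow> strongly_divides L M \<Gamma> \<Delta> \<delta> a (A \<union> set c))"
  proof
    fix d assume "d \<in> D"
    then obtain \<Delta> \<delta> a where d: "d = (\<Delta>, \<delta>, a)" "thorn_divides L M \<Gamma> \<Delta> \<delta> a A" using D(2) by (cases d) auto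
    then obtain \<Theta> c where "set \<Theta> \<subseteq> sorts L" "c \<in> tuples M \<Theta>" "strongly_divides L M \<Gamma> \<Delta> \<delta> a (A \<union> set c)"
      unfolding thorn_divides_def by blast
    then show "\<exists>c. set c \<subseteq> elements L M \<and>
        (case d of (\<Delta>, \<delta>, a) \<Rightarrow> strongly_divides L M \<Gamma> \<Delta> \<delta> a (A \<union> set c))"
      using d(1) set_tuples[of c M \<Theta> L] by (intro exI[of _ c]) auto
  qed
  from bchoice[OF this] obtain f where f: "\<forall>d\<in>D. set (f d) \<subseteq> elements L M \<and>
      (case d of (\<Delta>, \<delta>, a) \<Rightarrow> strongly_divides L M \<Gamma> \<Delta> \<delta> a (A \<union> set (f d)))" by (rule exE)
  \<comment> \<open>For each formula of the covering disjunction both its own parameters and the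
    tuple over which it strongly divides.\<close>
  define E where "E = (\<Union>d\<in>D. set (f d) \<union> set (snd (snd d)))"
  have "set (snd (snd d)) \<subseteq> elements L M" if "d \<in> D" for d
    using D(2) that set_tuples by (cases d) fastforce
  then have E: "small E" using D(1) f unfolding E_def by (intro small_finite) auto
  obtain r' where r': "eqv B \<Gamma> r r'" "\<And>i. i < length r \<Longrightarrow> r ! i \<notin> acl L M (B \<union> set (take i r)) \<Longrightarrow>
     r' ! i \<notin> acl L M (B \<union> E \<union> set (take i r'))" using move[OF B(1) E r(1) \<Gamma>] by blast
  have t': "r' \<in> tuples M \<Gamma>" using eqv_tuples[OF r'(1)] by auto
  have "length r' = length r" using t' r(1) by (simp add: tuples_length)
  then have "gen_coords B r \<subseteq> gen_coords (B \<union> E) r'" using r'(2) by (auto simp: gen_coords_def)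
  then have "card (gen_coords B r) \<le> card (gen_coords (B \<union> E) r')" by (intro card_mono finite_gen_coords)
  moreover have "gen_coords A r' = gen_coords A r"
    using gen_coords_eqv[OF eqv_mono[OF r'(1) B(2)] \<Gamma>] by simp
  ultimately have ge': "card (gen_coords A r') \<le> card (gen_coords (B \<union> E) r')" using ge by simp
  have "r' \<in> realizations L M \<Gamma> B r" using r'(1) realizations_iff[OF r(1)] by simp
  then have "(\<phi>, b) \<in> tp L M \<Gamma> B r'" using \<phi>(1) by (simp add: realizations_def)
  then have "r' \<in> inst M \<Gamma> \<phi> b" using t' by (simp add: tp_def inst_def)
  then obtain d where d: "d \<in> D" "r' \<in> (case d of (\<Delta>, \<delta>, a) \<Rightarrow> inst M \<Gamma> \<delta> a)" using D(3) by blast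
  obtain \<Delta> \<delta> a where d': "d = (\<Delta>, \<delta>, a)" by (cases d)
  have sub: "A \<union> set (f d) \<union> set a \<subseteq> B \<union> E" using B(2) d(1) d' unfolding E_def by force
  have "small (A \<union> set (f d))" using f d(1) by (intro small_Un[OF A] small_finite) auto
  moreover have "set r' \<subseteq> H"
  proof
    fix x assume "x \<in> set r'"
    then obtain i where "i < length \<Gamma>" "x = r' ! i" using tuples_length[OF t'] by (auto simp: in_set_conv_nth)
    then show "x \<in> H" using tuples_nth[OF t'] r(2) nth_mem[of i \<Gamma>] by fastforce
  qed
  moreover have "strongly_divides L M \<Gamma> \<Delta> \<delta> a (A \<union> set (f d))" "set \<Delta> \<subseteq> sorts L" "a \<in> tuples M \<Delta>"
    "wf_fm L (\<Gamma> @ \<Delta>) \<delta>" "r' \<in> inst M \<Gamma> \<delta> a"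
    using bspec[OF f d(1)] bspec[OF D(2) d(1)] d(2) d' by auto
  \<comment> \<open>The middle step of a chain: the dimension of \<open>r'\<close> does not increase
    from \<open>A\<close> to \<open>A \<union> set (f d)\<close>, drops when \<open>set a\<close> is
    added, and does not increase on the way to \<open>B \<union> E\<close>. This contradicts
    \<open>ge'\<close>.\<close>
  ultimately have "card (gen_coords (A \<union> set (f d) \<union> set a) r') < card (gen_coords (A \<union> set (f d)) r')"
    using t' \<Gamma> by (intro strongly_divides_drop)
  moreover have "card (gen_coords (A \<union> set (f d)) r') \<le> card (gen_coords A r')"
    by (rule card_gen_coords_anti) auto
  moreover have "card (gen_coords (B \<union> E) r') \<le> card (gen_coords (A \<union> set (f d) \<union> set a) r')"
    by (rule card_gen_coords_anti[OF sub])
  ultimately show False using ge' by simp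
qed

lemma extension_drop:
  assumes "thorn_forking_extension L \<kappa> M \<Gamma> A r B r'" "r \<in> tuples M \<Gamma>" "set \<Gamma> \<subseteq> {h}"
  shows "r' \<in> tuples M \<Gamma>" "card (gen_coords B r') < card (gen_coords A r)"
proof -
  have e: "A \<subseteq> B" "small B" "eqv A \<Gamma> r r'" "type_thorn_forks L M \<Gamma> (tp L M \<Gamma> B r') A"
    using assms(1) realizations_iff[OF assms(2)] by (auto simp: thorn_forking_extension_def small_def)
  show t: "r' \<in> tuples M \<Gamma>" using eqv_tuples[OF e(3)] by auto
  have "set \<Gamma> \<subseteq> sorts L" using assms(3) h by auto
  then show "card (gen_coords B r') < card (gen_coords A r)"
    using thorn_forking_drop[OF e(2,1) t assms(3) e(4)] gen_coords_eqv[OF e(3)] by simp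
qed

lemma has_ordinal_rank_real:
  assumes "r \<in> tuples M \<Gamma>" "set \<Gamma> \<subseteq> {h}"
  shows "has_ordinal_rank L \<kappa> M \<Gamma> A r"
  using assms(1)
proof (induction "card (gen_coords A r)" arbitrary: A r rule: less_induct)
  case less
  show ?case
    by (rule has_ordinal_rank.intros) (use extension_drop[OF _ less.prems assms(2)] less.hyps in blast)
qed

lemma rank_ge_real:
  assumes "r \<in> tuples M \<Gamma>" "set \<Gamma> \<subseteq> {h}" "rank_ge L \<kappa> M n \<Gamma> A r"
  shows "n \<le> card (gen_coords A r)"
  using assms(1,3)
proof (induction n arbitrary: A r)
  case (Suc n)
  then obtain B r' where B: "thorn_forking_extension L \<kappa> M \<Gamma> A r B r'" "rank_ge L \<kappa> M n \<Gamma> B r'" by auto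
  from extension_drop[OF B(1) Suc.prems(1) assms(2)] Suc.IH[OF _ B(2)] show ?case by simp
qed simp

lemma not_rank_ge_2: "a \<in> H \<Longrightarrow> \<not> rank_ge L \<kappa> M 2 [h] A [a]"
proof
  assume "a \<in> H" "rank_ge L \<kappa> M 2 [h] A [a]"
  then have "2 \<le> card (gen_coords A [a])" by (intro rank_ge_real[of _ "[h]"]) auto
  also have "\<dots> \<le> card {..<1::nat}" by (intro card_mono) (auto simp: gen_coords_def)
  finally show False by simp
qed

text \<open>For \<open>a\<close> outside \<open>acl\<close> of the empty set, the formula
  \<open>x = a\<close> strongly divides: its conjugates are infinitely many and pairwise
  inconsistent. So passing from the type of \<open>a\<close> over the empty set to its type over
  \<open>{a}\<close> is a thorn-forking extension.\<close>

lemma rank_ge_1: "\<exists>a\<in>H. rank_ge L \<kappa> M 1 [h] {} [a]"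
proof -
  have s: "small {}" by (rule small_finite) auto
  have "infinite {x \<in> H. True}" using infinite_h by simp
  then obtain a where a: "a \<in> H" "a \<notin> acl L M {}"
    using generic[OF s, of h "\<lambda>_. True"] dfn_const[OF h, of "{}" "[h]" True] h by auto
  have ae: "a \<in> elements L M" using a(1) h by (auto simp: elements_def)
  let ?\<delta> = "Equal (Var 0) (Var 1) :: ('s, 'f, 'r) fm"
  have wf: "wf_fm L ([h] @ [h]) ?\<delta>" using h by auto
  have "infinite (realizations L M [h] {} [a])"
  proof
    assume fin: "finite (realizations L M [h] {} [a])"
    obtain b where "eqv {} [h] [a] b" "b \<notin> realizations L M [h] {} [a]"
      by (rule infinite_eqv[OF s _ _ _ a(2) fin, of "[a]" "[h]"]) (use a h in auto)
    then show False using realizations_iff[of "[a]" "[h]"] a(1) by simp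
  qed
  moreover have "k_inconsistent M 2 [h] ?\<delta> (realizations L M [h] {} [a])"
    unfolding k_inconsistent_def
  proof (intro allI impI notI)
    fix S assume S: "S \<subseteq> realizations L M [h] {} [a]" "card S = 2"
      and "\<exists>x\<in>tuples M [h]. \<forall>b\<in>S. x \<in> inst M [h] ?\<delta> b"
    then obtain x where x: "\<forall>b\<in>S. [x] \<in> inst M [h] ?\<delta> b" by (auto simp: tuples_Cons)
    have "S \<subseteq> {[x]}"
    proof
      fix b assume b: "b \<in> S"
      then obtain y where "b = [y]" using S(1) by (auto simp: realizations_def tuples_Cons)
      then show "b \<in> {[x]}" using bspec[OF x b] by (simp add: inst_def)
    qed
    then have "card S \<le> 1" using card_mono[of "{[x]}" S] by simp
    then show False using S(2) by simp
  qed
  ultimately have "thorn_divides L M [h] [h] ?\<delta> [a] {}"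
    unfolding thorn_divides_def strongly_divides_def
    by (intro exI[of _ "[]"]) auto
  then have "thorn_forks L M [h] ?\<delta> [a] {}"
    unfolding thorn_forks_def using wf a(1) h
    by (intro exI[of _ "{([h], ?\<delta>, [a])}"]) auto
  moreover have "(?\<delta>, [a]) \<in> tp L M [h] {a} [a]"
    using wf a(1) h by (auto simp: tp_def param_formulas_def intro!: exI[of _ "[h]"])
  ultimately have "type_thorn_forks L M [h] (tp L M [h] {a} [a]) {}"
    unfolding type_thorn_forks_def by blast
  moreover have "small {a}" using ae by (intro small_finite) auto
  ultimately have "thorn_forking_extension L \<kappa> M [h] {} [a] {a} [a]"
    using a(1) by (auto simp: thorn_forking_extension_def small_def realizations_def)
  then show ?thesis using a(1) by (intro bexI[of _ a]) (auto simp: numeral_eq_Suc)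
qed

section \<open>Transfer of rank along maps given by terms\<close>

lemma sub_at_eval:
  assumes ts: "list_all2 (has_sort L \<Gamma>) ts \<Gamma>'" and \<phi>: "wf_fm L (\<Gamma>' @ \<Delta>) \<phi>"
  shows "wf_fm L (\<Gamma> @ \<Delta>) (fsub (sub_at ts (length \<Gamma>)) \<phi>)"
    and "x \<in> tuples M \<Gamma> \<Longrightarrow> a \<in> tuples M \<Delta> \<Longrightarrow>
      sat M (x @ a) (fsub (sub_at ts (length \<Gamma>)) \<phi>) \<longleftrightarrow> sat M (map (eval M x) ts @ a) \<phi>"
proof -
  have l: "length ts = length \<Gamma>'" using ts by (rule list_all2_lengthD)
  have s: "i < length \<Gamma>' \<Longrightarrow> has_sort L (\<Gamma> @ []) (ts ! i) (\<Gamma>' ! i)" for i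
    using ts by (simp add: list_all2_conv_all_nth)
  note sub = sub_at[OF l s, simplified]
  show "wf_fm L (\<Gamma> @ \<Delta>) (fsub (sub_at ts (length \<Gamma>)) \<phi>)"
    using sub(1) by (intro wf_fsub[OF \<phi>]) auto
  show "sat M (x @ a) (fsub (sub_at ts (length \<Gamma>)) \<phi>) \<longleftrightarrow> sat M (map (eval M x) ts @ a) \<phi>"
    if "x \<in> tuples M \<Gamma>" "a \<in> tuples M \<Delta>"
  proof (rule sat_fsub[OF \<phi>, of "\<Gamma> @ \<Delta>"])
    fix i assume "i < length (\<Gamma>' @ \<Delta>)"
    then show "eval M (x @ a) (sub_at ts (length \<Gamma>) i) = (map (eval M x) ts @ a) ! i"
      using sub(2)[of i \<Delta> x "[]" "map (eval M x) ts" a] l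
        tuples_length[OF that(1)] tuples_length[OF that(2)] by simp
  qed (use sub(1) in auto)
qed

text \<open>Only the variables \<open>x\<close> are replaced by terms. The parameters
  \<open>a\<close> and their realizations stay the same, and a common solution \<open>x\<close> of
  pulled-back instances yields the common solution \<open>?F x\<close> of the original ones, so the
  same \<open>k\<close> works.\<close>

lemma thorn_forks_pullback:
  assumes ts: "list_all2 (has_sort L \<Gamma>) ts \<Gamma>'" and \<phi>: "wf_fm L (\<Gamma>' @ \<Delta>) \<phi>" "b \<in> tuples M \<Delta>"
    and forks: "thorn_forks L M \<Gamma>' \<phi> b A"
  shows "thorn_forks L M \<Gamma> (fsub (sub_at ts (length \<Gamma>)) \<phi>) b A"
proof -
  let ?\<sigma> = "sub_at ts (length \<Gamma>)" and ?F = "\<lambda>x. map (eval M x) ts"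
  have F: "?F x \<in> tuples M \<Gamma>'" if "x \<in> tuples M \<Gamma>" for x
    using ts eval_carrier[OF _ that] by (auto simp: tuples_def[of M \<Gamma>'] list_all2_conv_all_nth)
  have inst: "x \<in> inst M \<Gamma> (fsub ?\<sigma> \<delta>) a \<longleftrightarrow> ?F x \<in> inst M \<Gamma>' \<delta> a"
    if "x \<in> tuples M \<Gamma>" "a \<in> tuples M \<Delta>" "wf_fm L (\<Gamma>' @ \<Delta>) \<delta>" for x a \<Delta> \<delta>
    using sub_at_eval(2)[OF ts that(3,1,2)] F[OF that(1)] that(1) by (simp add: inst_def)
  obtain D where D: "finite D" "\<forall>(\<Delta>, \<delta>, a)\<in>D. set \<Delta> \<subseteq> sorts L \<and> a \<in> tuples M \<Delta> \<and>
      wf_fm L (\<Gamma>' @ \<Delta>) \<delta> \<and> thorn_divides L M \<Gamma>' \<Delta> \<delta> a A"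
      "inst M \<Gamma>' \<phi> b \<subseteq> (\<Union>(\<Delta>, \<delta>, a)\<in>D. inst M \<Gamma>' \<delta> a)" using forks unfolding thorn_forks_def by blast
  have sd: "strongly_divides L M \<Gamma> \<Delta> (fsub ?\<sigma> \<delta>) a C"
    if div: "strongly_divides L M \<Gamma>' \<Delta> \<delta> a C" and wf: "wf_fm L (\<Gamma>' @ \<Delta>) \<delta>" for \<Delta> \<delta> a C
  proof -
    obtain k where k: "infinite (realizations L M \<Delta> C a)" "k_inconsistent M k \<Gamma>' \<delta> (realizations L M \<Delta> C a)"
      using div unfolding strongly_divides_def by blast
    have "k_inconsistent M k \<Gamma> (fsub ?\<sigma> \<delta>) (realizations L M \<Delta> C a)"
      unfolding k_inconsistent_def
    proof (intro allI impI notI)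
      fix S assume S: "S \<subseteq> realizations L M \<Delta> C a" "finite S" "card S = k"
        and "\<exists>x\<in>tuples M \<Gamma>. \<forall>a\<in>S. x \<in> inst M \<Gamma> (fsub ?\<sigma> \<delta>) a"
      then obtain x where x: "x \<in> tuples M \<Gamma>" "\<And>a. a \<in> S \<Longrightarrow> x \<in> inst M \<Gamma> (fsub ?\<sigma> \<delta>) a" by blast
      have "?F x \<in> inst M \<Gamma>' \<delta> c" if "c \<in> S" for c
        using inst[OF x(1) _ wf, of c] x(2)[OF that] S(1) that
        by (auto simp: realizations_def)
      then show False using k(2) S F[OF x(1)] unfolding k_inconsistent_def by blast
    qed
    then show ?thesis using k(1) unfolding strongly_divides_def by blast
  qed
  let ?D = "(\<lambda>(\<Delta>, \<delta>, a). (\<Delta>, fsub ?\<sigma> \<delta>, a)) ` D"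
  have "set \<Delta> \<subseteq> sorts L \<and> a \<in> tuples M \<Delta> \<and> wf_fm L (\<Gamma> @ \<Delta>) (fsub ?\<sigma> \<delta>) \<and>
      thorn_divides L M \<Gamma> \<Delta> (fsub ?\<sigma> \<delta>) a A" if "(\<Delta>, \<delta>, a) \<in> D" for \<Delta> \<delta> a
    using bspec[OF D(2) that] sub_at_eval(1)[OF ts] sd unfolding thorn_divides_def by blast
  then have "\<forall>(\<Delta>, \<delta>, a)\<in>?D. set \<Delta> \<subseteq> sorts L \<and> a \<in> tuples M \<Delta> \<and>
      wf_fm L (\<Gamma> @ \<Delta>) \<delta> \<and> thorn_divides L M \<Gamma> \<Delta> \<delta> a A" by auto
  moreover have "inst M \<Gamma> (fsub ?\<sigma> \<phi>) b \<subseteq> (\<Union>(\<Delta>, \<delta>, a)\<in>?D. inst M \<Gamma> \<delta> a)"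
  proof
    fix x assume x: "x \<in> inst M \<Gamma> (fsub ?\<sigma> \<phi>) b"
    then have xt: "x \<in> tuples M \<Gamma>" by (simp add: inst_def)
    then have "?F x \<in> inst M \<Gamma>' \<phi> b" using inst[OF xt \<phi>(2,1)] x by blast
    then obtain d where d: "d \<in> D" "?F x \<in> (case d of (\<Delta>, \<delta>, a) \<Rightarrow> inst M \<Gamma>' \<delta> a)" using D(3) by blast
    obtain \<Delta> \<delta> a where d': "d = (\<Delta>, \<delta>, a)" by (cases d)
    have "x \<in> inst M \<Gamma> (fsub ?\<sigma> \<delta>) a" using inst[OF xt, of a \<Delta> \<delta>] bspec[OF D(2) d(1)] d(2) d' by simp
    then show "x \<in> (\<Union>(\<Delta>, \<delta>, a)\<in>?D. inst M \<Gamma> \<delta> a)" using d(1) d' by force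
  qed
  ultimately show ?thesis unfolding thorn_forks_def using D(1) by blast
qed

text \<open>Given an extension of the type of the image, realized by \<open>a'\<close>, saturation
  completes \<open>a'\<close> to \<open>a' @ r'\<close> with the type of \<open>?F r @ r\<close>
  over \<open>A\<close>. Then \<open>r'\<close> realizes the type of \<open>r\<close>, has image
  \<open>a'\<close>, and inherits the forking formula by pullback; so the induction over the rank of
  \<open>r\<close> applies.\<close>

lemma has_ordinal_rank_image:
  assumes ts: "list_all2 (has_sort L \<Gamma>) ts \<Gamma>'" and \<Gamma>: "set \<Gamma> \<subseteq> sorts L" "set \<Gamma>' \<subseteq> sorts L"
    and r: "has_ordinal_rank L \<kappa> M \<Gamma> A r" "r \<in> tuples M \<Gamma>"
  shows "has_ordinal_rank L \<kappa> M \<Gamma>' A (map (eval M r) ts)"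
  using r
proof (induction rule: has_ordinal_rank.induct)
  case (1 A r)
  let ?F = "\<lambda>x. map (eval M x) ts"
  have tF: "tmfs C \<Gamma> \<Gamma>' ?F" for C
    unfolding tmfs_def using ts by (intro exI[of _ "[]"] exI[of _ ts]) auto
  have Fr: "?F r \<in> tuples M \<Gamma>'" using tmfs_tuples[OF tF "1.prems"] .
  show ?case
  proof (rule has_ordinal_rank.intros)
    fix B a' assume ext: "thorn_forking_extension L \<kappa> M \<Gamma>' A (?F r) B a'"
    then have e: "A \<subseteq> B" "B \<subseteq> elements L M" "|B| <o \<kappa>" "eqv A \<Gamma>' (?F r) a'"
      "type_thorn_forks L M \<Gamma>' (tp L M \<Gamma>' B a') A"
      using realizations_iff[OF Fr] by (auto simp: thorn_forking_extension_def)
    have "small A" using e(1-3) card_of_mono1[of A B] unfolding small_def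
      by (auto intro: ordLeq_ordLess_trans)
    then obtain r' where r': "eqv A (\<Gamma>' @ \<Gamma>) (?F r @ r) (a' @ r')"
      using extend[OF _ e(4) "1.prems" \<Gamma>(2,1)] by blast
    have l: "length a' = length \<Gamma>'" "length (?F r) = length \<Gamma>'"
      using eqv_tuples[OF e(4)] by (auto dest: tuples_length)
    have rr': "eqv A \<Gamma> r r'" using eqv_map[OF r' tmfs_drop] l by simp
    \<comment> \<open>That the first part is the image of the second is definable, hence part of the
      type shared by the two tuples.\<close>
    have "dfn A (\<Gamma>' @ \<Gamma>) (\<lambda>b. take (length \<Gamma>') b = ?F (drop (length \<Gamma>') b))"
      by (rule dfn_eqs[OF tmfs_take tmfs_comp[OF tF tmfs_drop] \<Gamma>(2) h])
    from eqvD[OF r' this] have a': "a' = ?F r'" using l by simp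
    have t': "r' \<in> tuples M \<Gamma>" using eqv_tuples[OF rr'] by auto
    obtain \<phi> b where \<phi>: "(\<phi>, b) \<in> tp L M \<Gamma>' B a'" "thorn_forks L M \<Gamma>' \<phi> b A"
      using e(5) unfolding type_thorn_forks_def by blast
    then obtain \<Theta> where \<Theta>: "set b \<subseteq> B" "set \<Theta> \<subseteq> sorts L" "b \<in> tuples M \<Theta>" "wf_fm L (\<Gamma>' @ \<Theta>) \<phi>"
      "sat M (a' @ b) \<phi>" by (auto simp: tp_def param_formulas_def)
    let ?\<phi> = "fsub (sub_at ts (length \<Gamma>)) \<phi>"
    have "(?\<phi>, b) \<in> tp L M \<Gamma> B r'"
      using \<Theta> sub_at_eval[OF ts \<Theta>(4)] t' a' by (auto simp: tp_def param_formulas_def)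
    moreover have "thorn_forks L M \<Gamma> ?\<phi> b A" by (rule thorn_forks_pullback[OF ts \<Theta>(4,3) \<phi>(2)])
    ultimately have "type_thorn_forks L M \<Gamma> (tp L M \<Gamma> B r') A" unfolding type_thorn_forks_def by blast
    then have "thorn_forking_extension L \<kappa> M \<Gamma> A r B r'"
      using e(1-3) rr' realizations_iff[OF "1.prems"] by (auto simp: thorn_forking_extension_def)
    then show "has_ordinal_rank L \<kappa> M \<Gamma>' B a'" using "1.IH" t' a' by blast
  qed
qed

lemma tuple_rep:
  assumes "a \<in> tuples M \<Gamma>" "set \<Gamma> \<subseteq> sorts L"
  shows "\<exists>n ts r. list_all2 (has_sort L (replicate n h)) ts \<Gamma> \<and> r \<in> tuples M (replicate n h) \<and>
    map (eval M r) ts = a"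
  using assms
proof (induction \<Gamma> arbitrary: a)
  case Nil
  then show ?case by (intro exI[of _ 0] exI[of _ "[]"]) auto
next
  case (Cons s \<Gamma>)
  then obtain x b where a: "a = x # b" "x \<in> carrier M s" "b \<in> tuples M \<Gamma>" by (auto simp: tuples_Cons)
  then obtain n ts r where 1: "list_all2 (has_sort L (replicate n h)) ts \<Gamma>" "r \<in> tuples M (replicate n h)"
    "map (eval M r) ts = b" using Cons.IH[OF a(3)] Cons.prems by auto
  obtain m t q where 2: "has_sort L (replicate m h) t s" "q \<in> tuples M (replicate m h)" "eval M q t = x"
    using reps[of s x] a Cons.prems by auto
  \<comment> \<open>The representatives of the head come first, so the variables in the terms for
    the tail are shifted by \<open>m\<close>.\<close>
  let ?\<sigma> = "ins 0 m"
  have l: "length q = m" "length r = n" using 1 2 by (auto simp: tuples_replicate)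
  have "list_all2 (has_sort L (replicate (m + n) h)) (map (tsub ?\<sigma>) ts) \<Gamma>"
    using has_sort_ins[of _ "[]" "replicate n h" L "replicate m h"]
    by (intro list_all2_has_sort_cong[OF 1(1)] has_sort_tsub) (auto simp: replicate_add)
  moreover have "has_sort L (replicate (m + n) h) t s"
    using has_sort_weaken[OF 2(1)] by (simp add: replicate_add)
  moreover have "q @ r \<in> tuples M (replicate (m + n) h)"
    using 1 2 by (auto simp: replicate_add intro: tuples_appendI)
  moreover have "eval M (q @ r) t = x" using eval_weaken[OF 2(1), of q M r] 2(3) l by simp
  moreover have "map (eval M (q @ r)) (map (tsub ?\<sigma>) ts) = b"
  proof -
    have "eval M (q @ r) (tsub ?\<sigma> u) = eval M r u" if "u \<in> set ts" for u
      using list_all2_has_sortD[OF 1(1) that] eval_ins[of "[]" "[]" q "replicate m h" M r] l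
      by (auto intro: eval_tsub)
    then show ?thesis using 1(3) by auto
  qed
  ultimately show ?case using a(1)
    by (intro exI[of _ "m + n"] exI[of _ "t # map (tsub ?\<sigma>) ts"] exI[of _ "q @ r"]) auto
qed

lemma has_ordinal_rank_all:
  assumes "a \<in> tuples M \<Gamma>" "set \<Gamma> \<subseteq> sorts L"
  shows "has_ordinal_rank L \<kappa> M \<Gamma> A a"
proof -
  obtain n ts r where *: "list_all2 (has_sort L (replicate n h)) ts \<Gamma>" "r \<in> tuples M (replicate n h)"
    "map (eval M r) ts = a" using tuple_rep[OF assms] by blast
  have "has_ordinal_rank L \<kappa> M \<Gamma> A (map (eval M r) ts)"
    by (rule has_ordinal_rank_image[OF *(1) _ assms(2) has_ordinal_rank_real[OF *(2)] *(2)]) (use h in auto)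
  then show ?thesis using *(3) by simp
qed

end

subsection \<open>Imaginaries\<close>

text \<open>The number of reals in a representative of an element of the given sort.\<close>

fun ar :: "('f, 'r) eq_sort \<Rightarrow> nat" where
  "ar Home = 1"
| "ar (Quot n E) = n"

abbreviation units :: "nat \<Rightarrow> unit list" where
  "units n \<equiv> replicate n ()"

abbreviation tot :: "('f, 'r) eq_sort list \<Rightarrow> nat" where
  "tot \<Gamma> \<equiv> sum_list (map ar \<Gamma>)"

fun temb :: "'f tm \<Rightarrow> ('f, 'r) eq_fun tm" where
  "temb (Var i) = Var i"
| "temb (Fn f ts) = Fn (Base f) (map temb ts)"

text \<open>One half of the comparison between definability in \<open>M\<close> and in
  \<open>M\<^sup>e\<^sup>q\<close>; the other half is \<open>formula_translation\<close>.\<close>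

fun femb :: "(unit, 'f, 'r) fm \<Rightarrow> (('f, 'r) eq_sort, ('f, 'r) eq_fun, 'r) fm" where
  "femb (Equal t u) = Equal (temb t) (temb u)"
| "femb (Rel r ts) = Rel r (map temb ts)"
| "femb (Neg \<phi>) = Neg (femb \<phi>)"
| "femb (Conj \<phi> \<psi>) = Conj (femb \<phi>) (femb \<psi>)"
| "femb (Ex s \<phi>) = Ex Home (femb \<phi>)"

locale one_sorted =
  fixes L :: "(unit, 'f, 'r) language" and M :: "(unit, 'f, 'r, 'a) struct"
  assumes str1: "is_structure L M" and unit_sort: "() \<in> sorts L"
begin

abbreviation "LN \<equiv> eq_language L M"
abbreviation "N \<equiv> eq_structure M"

sublocale M: mstructure L M
  by unfold_locales (use str1 in auto)

lemma units_sorts: "set (\<Gamma> :: unit list) \<subseteq> sorts L"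
  using unit_sort by auto

lemma sorts_LN [simp]: "sorts LN = eq_sorts L M"
  by (simp add: eq_language_def)

lemma carrier_Home [simp]: "carrier N Home = Real ` carrier M ()"
  by (simp add: eq_structure_def)

text \<open>Treats all sorts alike as images of a power of \<open>M\<close>: the home sort is the
  quotient of the first power by equality.\<close>

fun pr :: "('f, 'r) eq_sort \<Rightarrow> 'a list \<Rightarrow> ('f, 'r, 'a) eq_elem" where
  "pr Home q = Real (hd q)"
| "pr (Quot n E) q = Class n E (def_rel M n E `` {q})"

lemma carrier_pr: "carrier N s = pr s ` cart_power M (ar s)"
proof (cases s)
  case Home
  then show ?thesis by (force simp: tuples_Cons image_iff)
next
  case (Quot n E)
  then show ?thesis by (auto simp: eq_structure_def quotient_def)
qed

lemma tuples_Home: "a \<in> tuples N (map (\<lambda>_. Home) \<Gamma>) \<longleftrightarrow> (\<exists>b\<in>tuples M \<Gamma>. a = map Real b)"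
proof (induction \<Gamma> arbitrary: a)
  case (Cons s \<Gamma>)
  show ?case
  proof
    assume "a \<in> tuples N (map (\<lambda>_. Home) (s # \<Gamma>))"
    then obtain y c where a: "a = y # c" "y \<in> carrier N Home" "c \<in> tuples N (map (\<lambda>_. Home) \<Gamma>)"
      by (auto simp only: tuples_Cons list.map)
    obtain b where b: "b \<in> tuples M \<Gamma>" "c = map Real b" using a(3) Cons by blast
    moreover obtain x where "y = Real x" "x \<in> carrier M ()" using a(2) by auto
    ultimately have "a = Real x # map Real b" "x \<in> carrier M ()" "b \<in> tuples M \<Gamma>" using a(1) by auto
    then show "\<exists>b\<in>tuples M (s # \<Gamma>). a = map Real b" by (intro bexI[of _ "x # b"]) auto
  next
    assume "\<exists>b\<in>tuples M (s # \<Gamma>). a = map Real b"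
    then obtain x b where "a = Real x # map Real b" "x \<in> carrier M ()" "b \<in> tuples M \<Gamma>"
      by (auto simp: tuples_Cons)
    moreover from this have "map Real b \<in> tuples N (map (\<lambda>_. Home) \<Gamma>)" using Cons by blast
    ultimately show "a \<in> tuples N (map (\<lambda>_. Home) (s # \<Gamma>))" by simp
  qed
qed auto

lemma interp_Base: "fun_interp N (Base f) a = Real (fun_interp M f (map the_real a))"
  and interp_Proj: "fun_interp N (Proj n E) a = Class n E (def_rel M n E `` {map the_real a})"
  and interp_rel: "rel_interp N r a = rel_interp M r (map the_real a)"
  by (simp_all add: eq_structure_def)

lemma tuples_Home_replicate: "a \<in> tuples N (replicate n Home) \<longleftrightarrow> (\<exists>b\<in>cart_power M n. a = map Real b)"
  using tuples_Home[of a "units n"] by simp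

lemma the_real_comp [simp]: "the_real \<circ> Real = id"
  by (rule ext) simp

lemma map_the_real [simp]: "map the_real (map Real b) = b"
  by (simp add: comp_def)

lemma eq_structure: "is_structure LN N"
  unfolding is_structure_def
proof (intro conjI ballI)
  have "carrier M () \<noteq> {}" using str1 unit_sort by (simp add: is_structure_def)
  then obtain x where "x \<in> carrier M ()" by blast
  then have "replicate n x \<in> cart_power M n" for n by (auto simp: tuples_replicate)
  then show "carrier N s \<noteq> {}" for s unfolding carrier_pr by blast
  fix f a assume f: "f \<in> funs LN" "a \<in> tuples N (fun_dom LN f)"
  show "fun_interp N f a \<in> carrier N (fun_cod LN f)"
  proof (cases f)
    case (Base g)
    then obtain b where "g \<in> funs L" "b \<in> tuples M (fun_dom L g)" "a = map Real b"
      using f by (auto simp: eq_language_def tuples_Home)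
    then show ?thesis using Base str1 by (simp add: eq_language_def eq_structure_def is_structure_def)
  next
    case (Proj n E)
    then obtain b where b: "b \<in> cart_power M n" "a = map Real b"
      using f by (auto simp: eq_language_def tuples_Home_replicate)
    then show ?thesis using Proj by (auto simp: eq_language_def eq_structure_def quotient_def)
  qed
qed

lemma eq_sorts_disjoint: "x \<in> carrier N s \<Longrightarrow> x \<in> carrier N t \<Longrightarrow> s = t"
  unfolding carrier_pr by (cases s; cases t) auto

sublocale N: mstructure LN N
  by unfold_locales (use eq_structure eq_sorts_disjoint in auto)

lemma cart_power_add: "cart_power M (m + n) = {p @ q | p q. p \<in> cart_power M m \<and> q \<in> cart_power M n}"
  unfolding replicate_add by (rule set_eqI) (simp add: tuples_append; blast)

lemma pr_eq:
  assumes "s \<in> eq_sorts L M" "q \<in> cart_power M (ar s)" "q' \<in> cart_power M (ar s)"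
  shows "pr s q = pr s q' \<longleftrightarrow> (case s of Home \<Rightarrow> hd q = hd q' | Quot n E \<Rightarrow> sat M (q @ q') E)"
proof (cases s)
  case (Quot n E)
  then have "equiv (cart_power M n) (def_rel M n E)" using assms(1) by (auto simp: eq_sorts_def)
  from eq_equiv_class_iff[OF this] assms(2,3) Quot show ?thesis by (auto simp: def_rel_def)
qed simp

text \<open>Tuples of imaginaries are coded by the concatenation of real representatives.\<close>

fun unflat :: "('f, 'r) eq_sort list \<Rightarrow> 'a list \<Rightarrow> ('f, 'r, 'a) eq_elem list" where
  "unflat [] r = []"
| "unflat (s # \<Gamma>) r = pr s (take (ar s) r) # unflat \<Gamma> (drop (ar s) r)"

lemma unflat_append: "length r = tot \<Gamma> \<Longrightarrow> unflat (\<Gamma> @ \<Delta>) (r @ q) = unflat \<Gamma> r @ unflat \<Delta> q"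
  by (induction \<Gamma> arbitrary: r) auto

abbreviation "flat \<Gamma> \<equiv> units (tot \<Gamma>)"
abbreviation "flats \<Gamma> \<equiv> cart_power M (tot \<Gamma>)"
abbreviation "flat_tmfs \<Gamma> \<equiv> M.tmfs {} (flat \<Gamma>)"

lemma unflat_tuples: "r \<in> flats \<Gamma> \<Longrightarrow> unflat \<Gamma> r \<in> tuples N \<Gamma>"
proof (induction \<Gamma> arbitrary: r)
  case (Cons s \<Gamma>)
  then obtain p q where "r = p @ q" "p \<in> cart_power M (ar s)" "q \<in> flats \<Gamma>"
    by (auto simp: cart_power_add)
  moreover from this have "length p = ar s" by (simp add: tuples_replicate)
  ultimately show ?case using Cons.IH by (simp add: carrier_pr)
qed simp

text \<open>Says that \<open>A'\<close> contains real representatives for the elements of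
  \<open>A\<close>, so that what is definable over \<open>A\<close> in
  \<open>M\<^sup>e\<^sup>q\<close> becomes definable over \<open>A'\<close> in
  \<open>M\<close>.\<close>

definition covers :: "'a set \<Rightarrow> ('f, 'r, 'a) eq_elem set \<Rightarrow> bool" where
  "covers A' A \<longleftrightarrow> (\<forall>x\<in>A. \<forall>s. x \<in> carrier N s \<longrightarrow> (\<exists>q\<in>cart_power M (ar s). pr s q = x \<and> set q \<subseteq> A'))"

lemma covers_tuple:
  assumes "covers A' A" "c \<in> tuples N \<Theta>" "set c \<subseteq> A"
  shows "\<exists>q\<in>flats \<Theta>. unflat \<Theta> q = c \<and> set q \<subseteq> A'"
  using assms(2,3)
proof (induction \<Theta> arbitrary: c)
  case (Cons s \<Theta>)
  then obtain x d where c: "c = x # d" "x \<in> carrier N s" "d \<in> tuples N \<Theta>" by (auto simp: tuples_Cons)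
  then obtain q where q: "q \<in> flats \<Theta>" "unflat \<Theta> q = d" "set q \<subseteq> A'"
    using Cons by auto
  obtain p where p: "p \<in> cart_power M (ar s)" "pr s p = x" "set p \<subseteq> A'"
    using assms(1) c Cons.prems(2) unfolding covers_def by auto
  have "p @ q \<in> flats (s # \<Theta>)" using p q by (auto simp: cart_power_add)
  moreover have "unflat (s # \<Theta>) (p @ q) = c" using p q c by (auto dest: tuples_length)
  ultimately show ?case using p q by (intro bexI[of _ "p @ q"]) auto
qed simp

lemma covers_UNIV: "covers UNIV UNIV"
  unfolding covers_def carrier_pr by auto

lemma tuples_unflat: "tuples N \<Gamma> = unflat \<Gamma> ` flats \<Gamma>"
  using unflat_tuples covers_tuple[OF covers_UNIV] by blast

section \<open>Translation of formulas over \<open>M\<^sup>e\<^sup>q\<close> into formulas about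
  representatives\<close>

lemma unflat_nth_tmfs:
  "i < length \<Gamma> \<Longrightarrow> \<exists>F. flat_tmfs \<Gamma> (units (ar (\<Gamma> ! i))) F \<and> (\<forall>r. unflat \<Gamma> r ! i = pr (\<Gamma> ! i) (F r))"
proof (induction \<Gamma> arbitrary: i)
  case (Cons s \<Gamma>)
  show ?case
  proof (cases i)
    case 0
    then show ?thesis using M.tmfs_take[of "{}" "units (ar s)" "flat \<Gamma>"]
      by (intro exI[of _ "take (ar s)"]) (simp add: replicate_add)
  next
    case (Suc j)
    then obtain F where F: "flat_tmfs \<Gamma> (units (ar (\<Gamma> ! j))) F" "\<forall>r. unflat \<Gamma> r ! j = pr (\<Gamma> ! j) (F r)"
      using Cons by auto
    then show ?thesis using Suc M.tmfs_comp[OF F(1) M.tmfs_drop[of "{}" "units (ar s)" "flat \<Gamma>"]]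
      by (intro exI[of _ "\<lambda>r. F (drop (ar s) r)"]) (simp add: replicate_add)
  qed
qed simp

lemma fun_app_tmfs:
  assumes "f \<in> funs L" "M.tmfs {} \<Gamma> (fun_dom L f) G"
  shows "M.tmfs {} \<Gamma> (units 1) (\<lambda>r. [fun_interp M f (G r)])"
proof -
  let ?n = "length (fun_dom L f)"
  have "has_sort L (fun_dom L f) (Fn f (map Var [0..<?n])) ()"
    using assms(1) by (auto simp: list_all2_conv_all_nth)
  from M.tmf_term[OF this assms(2)]
  have "M.tmfs {} \<Gamma> [()] (\<lambda>r. [fun_interp M f (map (\<lambda>i. G r ! i) [0..<?n])])"
    by (simp add: M.tmf_def comp_def)
  then have "M.tmfs {} \<Gamma> [()] (\<lambda>r. [fun_interp M f (G r)])"
  proof (rule M.tmfs_cong)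
    fix r assume "r \<in> tuples M \<Gamma>"
    then have "length (G r) = ?n" using M.tmfs_tuples[OF assms(2)] by (blast dest: tuples_length)
    then have "map (\<lambda>i. G r ! i) [0..<?n] = G r" by (metis map_nth)
    then show "[fun_interp M f (map (\<lambda>i. G r ! i) [0..<?n])] = [fun_interp M f (G r)]" by simp
  qed
  then show ?thesis by simp
qed

lemma home_args:
  assumes "\<And>u. u \<in> set us \<Longrightarrow> \<exists>F. flat_tmfs \<Gamma> [()] F \<and>
      (\<forall>r\<in>flats \<Gamma>. eval N (unflat \<Gamma> r) u = Real (hd (F r)))"
    and "length us = length (\<Delta> :: unit list)"
  shows "\<exists>G. flat_tmfs \<Gamma> \<Delta> G \<and>
      (\<forall>r\<in>flats \<Gamma>. map (eval N (unflat \<Gamma> r)) us = map Real (G r))"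
  using assms
proof (induction \<Delta> arbitrary: us)
  case Nil
  then show ?case by (auto intro!: exI[of _ "\<lambda>_. []"] M.tmfs_Nil)
next
  case (Cons d \<Delta>)
  then obtain u vs where us: "us = u # vs" "length vs = length \<Delta>" by (auto simp: length_Suc_conv)
  obtain G where G: "flat_tmfs \<Gamma> \<Delta> G"
    "\<forall>r\<in>flats \<Gamma>. map (eval N (unflat \<Gamma> r)) vs = map Real (G r)"
    using Cons.IH[OF Cons.prems(1) us(2)] us(1) by auto
  obtain F where F: "flat_tmfs \<Gamma> [()] F"
    "\<forall>r\<in>flats \<Gamma>. eval N (unflat \<Gamma> r) u = Real (hd (F r))"
    using Cons.prems(1)[of u] us(1) by auto
  have 1: "map (eval N (unflat \<Gamma> r)) us = map Real (F r @ G r)" if r: "r \<in> flats \<Gamma>" for r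
  proof -
    have "F r \<in> tuples M [()]" using M.tmfs_tuples[OF F(1) r] .
    then obtain y where "F r = [y]" by (auto simp: tuples_Cons)
    then show ?thesis using bspec[OF F(2) r] bspec[OF G(2) r] us(1) by simp
  qed
  have "flat_tmfs \<Gamma> (d # \<Delta>) (\<lambda>r. F r @ G r)"
    using M.tmfs_append[OF F(1) G(1)] by simp
  then show ?case using 1 by blast
qed

text \<open>All function symbols take their arguments in the home sort and a projection ends in a
  quotient sort. Hence a projection can only be the outermost symbol, and what lies below it comes
  from terms of \<open>L\<close>.\<close>

lemma term_translation:
  assumes "has_sort LN \<Gamma> t s"
  shows "\<exists>F. flat_tmfs \<Gamma> (units (ar s)) F \<and>
    (\<forall>r\<in>flats \<Gamma>. eval N (unflat \<Gamma> r) t = pr s (F r))"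
  using assms
proof (induction t arbitrary: s)
  case (Var i)
  then show ?case using unflat_nth_tmfs[of i \<Gamma>] by auto
next
  case (Fn f ts)
  have args: "\<exists>G. flat_tmfs \<Gamma> \<Delta> G \<and>
      (\<forall>r\<in>flats \<Gamma>. map (eval N (unflat \<Gamma> r)) ts = map Real (G r))"
    if ts: "list_all2 (has_sort LN \<Gamma>) ts (map (\<lambda>_. Home) \<Delta>)" for \<Delta> :: "unit list"
  proof (rule home_args)
    show "length ts = length \<Delta>" using ts by (auto dest: list_all2_lengthD)
    fix u assume u: "u \<in> set ts"
    then have "has_sort LN \<Gamma> u Home" using ts by (auto simp: list_all2_conv_all_nth in_set_conv_nth)
    from Fn.IH[OF u this] show "\<exists>F. flat_tmfs \<Gamma> [()] F \<and>
      (\<forall>r\<in>flats \<Gamma>. eval N (unflat \<Gamma> r) u = Real (hd (F r)))" by simp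
  qed
  have f: "f \<in> funs LN" "fun_cod LN f = s" "list_all2 (has_sort LN \<Gamma>) ts (fun_dom LN f)" using Fn.prems by auto
  show ?case
  proof (cases f)
    case (Base g)
    then have g: "g \<in> funs L" "s = Home" "list_all2 (has_sort LN \<Gamma>) ts (map (\<lambda>_. Home) (fun_dom L g))"
      using f by (auto simp: eq_language_def)
    obtain G where G: "flat_tmfs \<Gamma> (fun_dom L g) G"
      "\<forall>r\<in>flats \<Gamma>. map (eval N (unflat \<Gamma> r)) ts = map Real (G r)" using args[OF g(3)] by blast
    from fun_app_tmfs[OF g(1) G(1)] show ?thesis using g(2) G(2) Base
      by (intro exI[of _ "\<lambda>r. [fun_interp M g (G r)]"]) (simp add: interp_Base)
  next
    case (Proj n E)
    then have g: "s = Quot n E" "list_all2 (has_sort LN \<Gamma>) ts (replicate n Home)"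
      using f by (auto simp: eq_language_def)
    then have "list_all2 (has_sort LN \<Gamma>) ts (map (\<lambda>_. Home) (units n))" by simp
    from args[OF this] obtain G where G: "flat_tmfs \<Gamma> (units n) G"
      "\<forall>r\<in>flats \<Gamma>. map (eval N (unflat \<Gamma> r)) ts = map Real (G r)" by blast
    then show ?thesis using g(1) Proj by (intro exI[of _ G]) (simp add: interp_Proj)
  qed
qed

lemma home_terms_translation:
  assumes ts: "list_all2 (has_sort LN \<Gamma>) ts (map (\<lambda>_. Home) (\<Delta> :: unit list))"
  shows "\<exists>G. flat_tmfs \<Gamma> \<Delta> G \<and>
      (\<forall>r\<in>flats \<Gamma>. map (eval N (unflat \<Gamma> r)) ts = map Real (G r))"
proof (rule home_args)
  show "length ts = length \<Delta>" using ts by (auto dest: list_all2_lengthD)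
  fix u assume "u \<in> set ts"
  then have "has_sort LN \<Gamma> u Home" using ts by (auto simp: list_all2_conv_all_nth in_set_conv_nth)
  from term_translation[OF this] show "\<exists>F. flat_tmfs \<Gamma> [()] F \<and>
    (\<forall>r\<in>flats \<Gamma>. eval N (unflat \<Gamma> r) u = Real (hd (F r)))" by simp
qed

text \<open>An equation in a quotient sort becomes the formula \<open>E\<close> between
  representatives, and a quantifier over a sort becomes a block of real quantifiers, one for each
  entry of a representative.\<close>

lemma formula_translation:
  assumes "wf_fm LN \<Gamma> \<phi>"
  shows "M.dfn {} (flat \<Gamma>) (\<lambda>r. sat N (unflat \<Gamma> r) \<phi>)"
  using assms
proof (induction \<phi> arbitrary: \<Gamma>)
  case (Equal t u)
  then obtain s where s: "s \<in> eq_sorts L M" "has_sort LN \<Gamma> t s" "has_sort LN \<Gamma> u s" by auto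
  obtain F where F: "flat_tmfs \<Gamma> (units (ar s)) F"
    "\<forall>r\<in>flats \<Gamma>. eval N (unflat \<Gamma> r) t = pr s (F r)" using term_translation[OF s(2)] by blast
  obtain G where G: "flat_tmfs \<Gamma> (units (ar s)) G"
    "\<forall>r\<in>flats \<Gamma>. eval N (unflat \<Gamma> r) u = pr s (G r)" using term_translation[OF s(3)] by blast
  have "M.dfn {} (flat \<Gamma>) (\<lambda>r. case s of Home \<Rightarrow> hd (F r) = hd (G r) | Quot n E \<Rightarrow> sat M (F r @ G r) E)"
  proof (cases s)
    case Home
    then have "flat_tmfs \<Gamma> [()] F" "flat_tmfs \<Gamma> [()] G" using F(1) G(1) by auto
    then show ?thesis using Home M.tmf_comp[OF M.tmf_hd] by (simp add: M.dfn_eq[OF _ _ unit_sort])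
  next
    case (Quot n E)
    then have "wf_fm L (units n @ units n) E" using s(1) by (auto simp: eq_sorts_def replicate_add)
    then show ?thesis using Quot F(1) G(1) by (simp add: M.dfn_sub[OF M.dfn_wf M.tmfs_append])
  qed
  then show ?case
  proof (rule M.dfn_cong)
    fix r assume r: "r \<in> flats \<Gamma>"
    show "(case s of Home \<Rightarrow> hd (F r) = hd (G r) | Quot n E \<Rightarrow> sat M (F r @ G r) E) \<longleftrightarrow>
        sat N (unflat \<Gamma> r) (Equal t u)"
      using pr_eq[OF s(1) M.tmfs_tuples[OF F(1) r] M.tmfs_tuples[OF G(1) r]] F(2) G(2) r by simp
  qed
next
  case (Rel R ts)
  then have R: "R \<in> rels L" "list_all2 (has_sort LN \<Gamma>) ts (map (\<lambda>_. Home) (rel_dom L R))"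
    by (auto simp: eq_language_def)
  obtain G where G: "flat_tmfs \<Gamma> (rel_dom L R) G"
    "\<forall>r\<in>flats \<Gamma>. map (eval N (unflat \<Gamma> r)) ts = map Real (G r)"
    using home_terms_translation[OF R(2)] by blast
  let ?n = "length (rel_dom L R)"
  have "wf_fm L (rel_dom L R) (Rel R (map Var [0..<?n]))"
    using R(1) by (auto simp: list_all2_conv_all_nth)
  from M.dfn_sub[OF M.dfn_wf[OF this] G(1)] show ?case
  proof (rule M.dfn_cong)
    fix r assume r: "r \<in> flats \<Gamma>"
    have "length (G r) = ?n" using M.tmfs_tuples[OF G(1) r] by (rule tuples_length)
    then have "map (eval M (G r)) (map Var [0..<?n]) = G r" by (simp add: comp_def) (metis map_nth)
    moreover have "map the_real (map (eval N (unflat \<Gamma> r)) ts) = G r" using bspec[OF G(2) r] by simp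
    ultimately show "sat M (G r) (Rel R (map Var [0..<?n])) \<longleftrightarrow> sat N (unflat \<Gamma> r) (Rel R ts)"
      by (simp only: sat.simps interp_rel)
  qed
next
  case (Neg \<phi>)
  then show ?case using M.dfn_neg by simp
next
  case (Conj \<phi> \<psi>)
  then show ?case using M.dfn_conj by simp
next
  case (Ex s \<phi>)
  let ?S = "\<lambda>r. sat N (unflat (s # \<Gamma>) r) \<phi>"
  have S: "M.dfn {} (units (ar s) @ flat \<Gamma>) ?S"
    using Ex.IH[of "s # \<Gamma>"] Ex.prems by (simp add: replicate_add)
  \<comment> \<open>The bound variable comes first in the context, so its representative comes first
    as well, whereas \<open>dfn_exs\<close> quantifies over the last block; the two blocks are
    exchanged.\<close>
  have T: "M.tmfs {} (flat \<Gamma> @ units (ar s)) (units (ar s) @ flat \<Gamma>)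
      (\<lambda>b. drop (length (flat \<Gamma>)) b @ take (length (flat \<Gamma>)) b)"
    by (intro M.tmfs_append M.tmfs_drop M.tmfs_take)
  from M.dfn_exs[OF M.dfn_sub[OF S T] units_sorts] show ?case
  proof (rule M.dfn_cong)
    fix r assume "r \<in> flats \<Gamma>"
    then have "length r = tot \<Gamma>" by (simp add: tuples_replicate)
    then show "(\<exists>q\<in>cart_power M (ar s). ?S (drop (length (flat \<Gamma>)) (r @ q) @ take (length (flat \<Gamma>)) (r @ q))) \<longleftrightarrow>
        sat N (unflat \<Gamma> r) (Ex s \<phi>)"
      by (auto simp: carrier_pr tuples_replicate)
  qed
qed

lemma dfn_N_M:
  assumes "N.dfn A \<Gamma> R" "covers A' A"
  shows "M.dfn A' (flat \<Gamma>) (\<lambda>r. R (unflat \<Gamma> r))"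
proof -
  obtain \<Theta> c \<phi> where 1: "c \<in> tuples N \<Theta>" "set c \<subseteq> A" "wf_fm LN (\<Gamma> @ \<Theta>) \<phi>"
    "\<forall>a\<in>tuples N \<Gamma>. sat N (a @ c) \<phi> \<longleftrightarrow> R a" using assms(1) unfolding N.dfn_def by blast
  obtain q where q: "q \<in> flats \<Theta>" "unflat \<Theta> q = c" "set q \<subseteq> A'"
    using covers_tuple[OF assms(2) 1(1,2)] by blast
  have "M.dfn {} (flat \<Gamma> @ flat \<Theta>) (\<lambda>r. sat N (unflat (\<Gamma> @ \<Theta>) r) \<phi>)"
    using formula_translation[OF 1(3)] by (simp add: replicate_add)
  from M.dfn_apply[OF M.dfn_mono[OF this] q(1,3) units_sorts]
  have "M.dfn A' (flat \<Gamma>) (\<lambda>r. sat N (unflat (\<Gamma> @ \<Theta>) (r @ q)) \<phi>)" by simp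
  then show ?thesis
  proof (rule M.dfn_cong)
    fix r assume r: "r \<in> flats \<Gamma>"
    then have "length r = tot \<Gamma>" by (simp add: tuples_replicate)
    then show "sat N (unflat (\<Gamma> @ \<Theta>) (r @ q)) \<phi> \<longleftrightarrow> R (unflat \<Gamma> r)"
      using bspec[OF 1(4) unflat_tuples[OF r]] q(2) by (simp add: unflat_append)
  qed
qed

section \<open>Formulas of \<open>L\<close> read on the reals of
  \<open>M\<^sup>e\<^sup>q\<close>\<close>

lemma eval_temb: "has_sort L \<Gamma> t s \<Longrightarrow> length e = length \<Gamma> \<Longrightarrow> eval N (map Real e) (temb t) = Real (eval M e t)"
proof (induction t arbitrary: s)
  case (Fn f ts)
  then have "map (\<lambda>t. eval N (map Real e) (temb t)) ts = map (\<lambda>t. Real (eval M e t)) ts"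
    by (auto dest: list_all2_has_sortD)
  then have "map the_real (map (eval N (map Real e)) (map temb ts)) = map (eval M e) ts"
    by (simp add: comp_def)
  then show ?case by (simp only: temb.simps eval.simps interp_Base)
qed simp

lemma has_sort_temb: "has_sort L \<Gamma> t s \<Longrightarrow> has_sort LN (map (\<lambda>_. Home) \<Gamma>) (temb t) Home"
proof (induction t arbitrary: s)
  case (Fn f ts)
  then have "list_all2 (has_sort LN (map (\<lambda>_. Home) \<Gamma>)) (map temb ts) (map (\<lambda>_. Home) (fun_dom L f))"
    by (auto simp: list_all2_conv_all_nth)
  then show ?case using Fn.prems by (simp add: eq_language_def)
qed simp

lemma Home_sort [simp]: "Home \<in> eq_sorts L M"
  by (simp add: eq_sorts_def)

lemma wf_femb: "wf_fm L \<Gamma> \<phi> \<Longrightarrow> wf_fm LN (map (\<lambda>_. Home) \<Gamma>) (femb \<phi>)"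
proof (induction \<phi> arbitrary: \<Gamma>)
  case (Equal t u)
  then show ?case by (auto intro!: bexI[of _ Home] has_sort_temb)
next
  case (Rel r ts)
  then show ?case by (auto simp: eq_language_def list_all2_conv_all_nth intro: has_sort_temb[unfolded eq_language_def])
next
  case (Ex s \<phi>)
  then show ?case using Ex.IH[of "s # \<Gamma>"] by simp
qed auto

lemma sat_femb: "wf_fm L \<Gamma> \<phi> \<Longrightarrow> length e = length \<Gamma> \<Longrightarrow> sat N (map Real e) (femb \<phi>) \<longleftrightarrow> sat M e \<phi>"
proof (induction \<phi> arbitrary: \<Gamma> e)
  case (Equal t u)
  then show ?case by (auto simp: eval_temb)
next
  case (Rel r ts)
  then have "map (\<lambda>t. eval N (map Real e) (temb t)) ts = map (\<lambda>t. Real (eval M e t)) ts"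
    by (auto dest: list_all2_has_sortD intro: eval_temb)
  then have "map the_real (map (eval N (map Real e)) (map temb ts)) = map (eval M e) ts"
    by (simp add: comp_def)
  then show ?case by (simp only: femb.simps sat.simps interp_rel)
next
  case (Ex s \<phi>)
  have "sat N (map Real (x # e)) (femb \<phi>) \<longleftrightarrow> sat M (x # e) \<phi>" for x
    using Ex.prems by (intro Ex.IH[of "s # \<Gamma>"]) auto
  then show ?case by simp
qed auto

lemma dfn_M_N:
  assumes "M.dfn A \<Gamma> R"
  shows "N.dfn (Real ` A) (map (\<lambda>_. Home) \<Gamma>) (\<lambda>a. R (map the_real a))"
proof -
  obtain \<Theta> c \<phi> where 1: "c \<in> tuples M \<Theta>" "set c \<subseteq> A" "wf_fm L (\<Gamma> @ \<Theta>) \<phi>"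
    "\<forall>a\<in>tuples M \<Gamma>. sat M (a @ c) \<phi> \<longleftrightarrow> R a" using assms unfolding M.dfn_def by blast
  show ?thesis
  proof (rule N.dfnI)
    show "wf_fm LN (map (\<lambda>_. Home) \<Gamma> @ map (\<lambda>_. Home) \<Theta>) (femb \<phi>)" using wf_femb[OF 1(3)] by simp
    show "map Real c \<in> tuples N (map (\<lambda>_. Home) \<Theta>)" using 1(1) by (auto simp: tuples_Home)
    fix a assume "a \<in> tuples N (map (\<lambda>_. Home) \<Gamma>)"
    then obtain b where b: "b \<in> tuples M \<Gamma>" "a = map Real b" by (auto simp: tuples_Home)
    have "length (b @ c) = length (\<Gamma> @ \<Theta>)" using b(1) 1(1) by (simp add: tuples_length)
    from sat_femb[OF 1(3) this] show "sat N (a @ map Real c) (femb \<phi>) \<longleftrightarrow> R (map the_real a)"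
      using b 1(4) by simp
  qed (use 1 in auto)
qed

text \<open>Reals are their own representatives, so the translations in both directions keep real
  parameters. Thus \<open>M\<^sup>e\<^sup>q\<close> induces no new algebraic dependence between
  reals, and exchange on the home sort is inherited from \<open>M\<close>.\<close>

lemma acl_Real:
  assumes "x \<in> carrier M ()"
  shows "Real x \<in> acl LN N (Real ` A) \<longleftrightarrow> x \<in> acl L M A"
proof
  assume "Real x \<in> acl LN N (Real ` A)"
  then obtain s R where s: "s \<in> eq_sorts L M" "Real x \<in> carrier N s" "N.dfn (Real ` A) [s] R" "R [Real x]"
    "finite {y \<in> carrier N s. R [y]}" unfolding N.acl_iff by auto
  have [simp]: "s = Home" using eq_sorts_disjoint[OF s(2), of Home] assms by simp
  have "covers A (Real ` A)"
    unfolding covers_def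
  proof (intro ballI allI impI)
    fix y t assume y: "y \<in> Real ` A" "y \<in> carrier N t"
    then obtain z where z: "z \<in> A" "y = Real z" by blast
    have "t = Home" using y(2) z by (cases t) (auto simp: carrier_pr)
    then show "\<exists>q\<in>cart_power M (ar t). pr t q = y \<and> set q \<subseteq> A"
      using y z by (intro bexI[of _ "[z]"]) auto
  qed
  from dfn_N_M[OF s(3) this] have "M.dfn A [()] (\<lambda>r. R (unflat [Home] r))" by simp
  then have D: "M.dfn A [()] (\<lambda>r. R [Real (hd r)])"
    by (rule M.dfn_cong) (auto simp: tuples_Cons)
  have e: "Real ` {y \<in> carrier M (). R [Real y]} = {y \<in> carrier N s. R [y]}" by auto
  from s(5) have "finite {y \<in> carrier M (). R [Real y]}"
    unfolding e[symmetric] by (rule finite_imageD) (simp add: inj_on_def)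
  then show "x \<in> acl L M A" using D s(4) assms unit_sort
    by (intro M.acl_dcl[of "()" x A "\<lambda>y. R [Real y]"]) auto
next
  assume "x \<in> acl L M A"
  then obtain s R where s: "M.dfn A [s] R" "R [x]" "finite {y \<in> carrier M s. R [y]}"
    unfolding M.acl_iff by auto
  have "N.dfn (Real ` A) [Home] (\<lambda>a. R (map the_real a))" using dfn_M_N[OF s(1)] by simp
  moreover have "{y \<in> carrier N Home. R (map the_real [y])} = Real ` {y \<in> carrier M s. R [y]}" by auto
  ultimately show "Real x \<in> acl LN N (Real ` A)" unfolding N.acl_iff using assms s(2,3)
    by (intro bexI[of _ Home] conjI exI[of _ "\<lambda>a. R (map the_real a)"]) auto
qed

text \<open>One finite representative per element suffices: the resulting set is finite if
  \<open>A\<close> is, and otherwise has at most the cardinality of \<open>A\<close>.\<close>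

lemma small_cover:
  assumes "A \<subseteq> elements LN N" "|A| <o \<kappa>" "Card_order \<kappa>" "infinite (Field \<kappa>)"
  obtains A' where "A' \<subseteq> elements L M" "|A'| <o \<kappa>" "covers A' A"
proof -
  have "\<forall>x\<in>A. \<exists>q. set q \<subseteq> elements L M \<and> (\<forall>s. x \<in> carrier N s \<longrightarrow> q \<in> cart_power M (ar s) \<and> pr s q = x)"
  proof
    fix x assume "x \<in> A"
    then obtain s where s: "x \<in> carrier N s" using assms(1) by (auto simp: elements_def)
    then obtain q where q: "q \<in> cart_power M (ar s)" "pr s q = x" by (auto simp: carrier_pr)
    then show "\<exists>q. set q \<subseteq> elements L M \<and> (\<forall>s. x \<in> carrier N s \<longrightarrow> q \<in> cart_power M (ar s) \<and> pr s q = x)"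
      using eq_sorts_disjoint[OF s] set_tuples[OF q(1) units_sorts] by (intro exI[of _ q] conjI allI impI) auto
  qed
  from bchoice[OF this] obtain f where f: "\<forall>x\<in>A. set (f x) \<subseteq> elements L M \<and>
      (\<forall>s. x \<in> carrier N s \<longrightarrow> f x \<in> cart_power M (ar s) \<and> pr s (f x) = x)" by (rule exE)
  let ?A = "\<Union>x\<in>A. set (f x)"
  have "|?A| <o \<kappa>"
  proof (cases "finite A")
    case True
    then have "finite ?A" by auto
    then show ?thesis using finite_ordLess_infinite[of "|?A|" \<kappa>] assms(3,4) card_of_Well_order[of ?A]
      by (auto simp: Field_card_of card_order_on_well_order_on)
  next
    case False
    have "\<forall>x\<in>A. |set (f x)| \<le>o |A|"
      using False by (auto intro!: ordLess_imp_ordLeq finite_ordLess_infinite card_of_Well_order simp: Field_card_of)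
    then have "|?A| \<le>o |A|" using card_of_UNION_ordLeq_infinite[OF False] card_of_refl
      by (metis card_of_mono1 subset_refl)
    then show ?thesis using assms(2) by (rule ordLeq_ordLess_trans)
  qed
  moreover have "covers ?A A" unfolding covers_def using f by blast
  ultimately show ?thesis using that[of ?A] f by blast
qed

text \<open>A set of formulas about imaginaries is rewritten as one about their representatives,
  over a small cover of the parameters, and realized in \<open>M\<close>.\<close>

lemma saturated_eq:
  assumes "saturated L \<kappa> M" "Card_order \<kappa>" "infinite (Field \<kappa>)"
  shows "saturated LN \<kappa> N"
  unfolding saturated_def
proof (intro allI impI)
  fix A \<Gamma> \<Sigma>
  assume A: "A \<subseteq> elements LN N" "|A| <o \<kappa>" and \<Gamma>: "set \<Gamma> \<subseteq> sorts LN"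
    and \<Sigma>: "\<Sigma> \<subseteq> param_formulas LN N \<Gamma> A"
    and fin: "\<forall>F\<subseteq>\<Sigma>. finite F \<longrightarrow> (\<exists>a\<in>tuples N \<Gamma>. \<forall>(\<phi>, c)\<in>F. sat N (a @ c) \<phi>)"
  interpret S: saturated_structure L M \<kappa> by unfold_locales (use assms in auto)
  obtain A' where A': "A' \<subseteq> elements L M" "|A'| <o \<kappa>" "covers A' A"
    by (rule small_cover[OF A assms(2,3)])
  let ?f = "\<lambda>p r. case p of (\<phi>, c) \<Rightarrow> sat N (unflat \<Gamma> r @ c) \<phi>"
  have "\<exists>r\<in>flats \<Gamma>. \<forall>R\<in>?f ` \<Sigma>. R r"
  proof (rule S.saturation)
    show "S.small A'" using A' by (simp add: S.small_def)
    fix R assume "R \<in> ?f ` \<Sigma>"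
    then obtain \<phi> c where R: "(\<phi>, c) \<in> \<Sigma>" "R = (\<lambda>r. sat N (unflat \<Gamma> r @ c) \<phi>)" by auto
    then obtain \<Theta> where \<Theta>: "set c \<subseteq> A" "set \<Theta> \<subseteq> sorts LN" "c \<in> tuples N \<Theta>" "wf_fm LN (\<Gamma> @ \<Theta>) \<phi>"
      using \<Sigma> by (auto simp: param_formulas_def)
    then have "N.dfn A \<Gamma> (\<lambda>a. sat N (a @ c) \<phi>)" by (intro N.dfnI[of \<Theta> c]) auto
    from dfn_N_M[OF this A'(3)] show "M.dfn A' (flat \<Gamma>) R" by (simp add: R(2))
  next
    fix F assume F: "F \<subseteq> ?f ` \<Sigma>" "finite F"
    obtain G where G: "G \<subseteq> \<Sigma>" "finite G" "F = ?f ` G" using finite_subset_image[OF F(2,1)] by blast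
    obtain a where a: "a \<in> tuples N \<Gamma>" "\<forall>(\<phi>, c)\<in>G. sat N (a @ c) \<phi>" using fin G by blast
    obtain r where "r \<in> flats \<Gamma>" "a = unflat \<Gamma> r" using a(1) tuples_unflat by auto
    then show "\<exists>r\<in>flats \<Gamma>. \<forall>R\<in>F. R r" using a(2) G(3) by (intro bexI[of _ r]) auto
  qed (rule units_sorts)
  then obtain r where r: "r \<in> flats \<Gamma>" "\<forall>R\<in>?f ` \<Sigma>. R r" by (rule bexE)
  then show "\<exists>a\<in>tuples N \<Gamma>. \<forall>(\<phi>, c)\<in>\<Sigma>. sat N (a @ c) \<phi>"
    using unflat_tuples[OF r(1)] by (intro bexI[of _ "unflat \<Gamma> r"]) auto
qed

lemma exchange_eq:
  assumes "acl_exchange L M" "A \<subseteq> carrier N Home" "a \<in> carrier N Home" "b \<in> carrier N Home"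
    "a \<in> acl LN N (insert b A)" "a \<notin> acl LN N A"
  shows "b \<in> acl LN N (insert a A)"
proof -
  obtain B where B: "A = Real ` B" "B \<subseteq> carrier M ()" using assms(2) by (auto simp: subset_image_iff)
  obtain x y where xy: "a = Real x" "x \<in> carrier M ()" "b = Real y" "y \<in> carrier M ()" using assms(3,4) by auto
  have el: "elements L M = carrier M ()" using unit_sort by (auto simp: elements_def)
  have "x \<in> acl L M (insert y B)" "x \<notin> acl L M B"
    using assms(5,6) acl_Real[OF xy(2), of "insert y B"] acl_Real[OF xy(2), of B] by (simp_all add: xy B)
  then have "y \<in> acl L M (insert x B)" using assms(1) B xy unfolding acl_exchange_def el by blast
  then show ?thesis using acl_Real[OF xy(4), of "insert x B"] by (simp add: xy B)
qed

lemma reps_eq: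
  assumes "s \<in> eq_sorts L M" "x \<in> carrier N s"
  shows "\<exists>n t r. has_sort LN (replicate n Home) t s \<and> r \<in> tuples N (replicate n Home) \<and> eval N r t = x"
proof (cases s)
  case Home
  then show ?thesis using assms(2) by (intro exI[of _ 1] exI[of _ "Var 0"] exI[of _ "[x]"]) auto
next
  case (Quot n E)
  then obtain q where q: "q \<in> cart_power M n" "x = Class n E (def_rel M n E `` {q})"
    using assms(2) by (auto simp: carrier_pr)
  have l: "length q = n" using q(1) by (simp add: tuples_replicate)
  let ?t = "Fn (Proj n E) (map Var [0..<n]) :: ('f, 'r) eq_fun tm"
  have "has_sort LN (replicate n Home) ?t s"
    using assms(1) Quot by (auto simp: eq_language_def list_all2_conv_all_nth)
  moreover have "map Real q \<in> tuples N (replicate n Home)" using q(1) tuples_Home_replicate by blast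
  moreover have "map (eval N (map Real q)) (map Var [0..<n]) = map Real q"
    using l by (auto intro: nth_equalityI)
  then have "eval N (map Real q) ?t = x" using q(2)
    by (simp only: eval.simps interp_Proj map_the_real)
  ultimately show ?thesis by blast
qed

end

subsection \<open>Infinite models and fields\<close>

fun distinct_fm :: "nat \<Rightarrow> (unit, 'f, 'r) fm" where
  "distinct_fm 0 = Equal (Var 0) (Var 0)"
| "distinct_fm (Suc k) = Conj (distinct_fm k) (Neg (Equal (Var 0) (Var (Suc k))))"

text \<open>Follows the recursion \<open>atl_Suc\<close>. Each quantifier pushes its witness onto
  the environment, and later witnesses must differ from the first \<open>k\<close> entries; hence
  \<open>k\<close> grows with the quantifiers.\<close>

fun atl_fm :: "nat \<Rightarrow> nat \<Rightarrow> (unit, 'f, 'r) fm" where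
  "atl_fm k 0 = Ex () (Equal (Var 0) (Var 0))"
| "atl_fm k (Suc n) = Ex () (Conj (distinct_fm k) (atl_fm (Suc k) n))"

lemma wf_atl_fm: "() \<in> sorts L \<Longrightarrow> wf_fm L (units k) (atl_fm k n)"
proof (induction n arbitrary: k)
  case (Suc n)
  have "wf_fm L (units (Suc k)) (distinct_fm j)" if "j \<le> k" for j
    using that Suc.prems by (induction j) (auto simp: nth_Cons')
  then show ?case using Suc.IH[of "Suc k"] Suc.prems by simp
qed (auto simp: has_sort.simps)

lemma sat_distinct_fm: "k \<le> length e \<Longrightarrow> sat M (x # e) (distinct_fm k) \<longleftrightarrow> x \<notin> set (take k e)"
  by (induction k) (auto simp: take_Suc_conv_app_nth)

lemma sat_atl_fm: "carrier M () \<noteq> {} \<Longrightarrow> sat M e (atl_fm (length e) n) \<longleftrightarrow> atl n (carrier M () - set e)"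
proof (induction n arbitrary: e)
  case (Suc n)
  have "carrier M () - set (x # e) = carrier M () - set e - {x}" for x by auto
  then have "sat M (x # e) (atl_fm (Suc (length e)) n) \<longleftrightarrow> atl n (carrier M () - set e - {x})" for x
    using Suc.IH[OF Suc.prems, of "x # e"] by (simp only: list.size add_Suc_right add_0_right)
  then show ?case by (auto simp: atl_Suc sat_distinct_fm)
qed (auto simp: atl_def)

text \<open>A finite model is separated from an infinite one by the sentence "there are more than
  \<open>card (carrier M ())\<close> elements", which a complete theory has to decide.\<close>

lemma complete_infinite:
  fixes M :: "(unit, 'f, 'r, 'a) struct"
  assumes "complete_theory TYPE('a) L T" "has_infinite_models TYPE('a) L T" "M \<in> Mod L T" "() \<in> sorts L"
  shows "infinite (carrier M ())"
proof
  assume fin: "finite (carrier M ())"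
  obtain M' :: "(unit, 'f, 'r, 'a) struct" where M': "M' \<in> Mod L T" "infinite (carrier M' ())"
    using assms(2) by (auto simp: has_infinite_models_def)
  have ne: "carrier M () \<noteq> {}" "carrier M' () \<noteq> {}"
    using assms(3,4) M' by (auto simp: Mod_def is_structure_def)
  let ?\<sigma> = "atl_fm 0 (Suc (card (carrier M ()))) :: (unit, 'f, 'r) fm"
  have "\<not> sat M [] ?\<sigma>" "sat M' [] ?\<sigma>"
    using sat_atl_fm[OF ne(1), of "[]"] sat_atl_fm[OF ne(2), of "[]"] fin M'(2)
    by (simp_all add: atl_def del: atl_fm.simps)
  moreover have "?\<sigma> \<in> sentences L" using wf_atl_fm[OF assms(4), of 0] by (simp add: sentences_def del: atl_fm.simps)
  then have "entails TYPE('a) L T ?\<sigma> \<or> entails TYPE('a) L T (Neg ?\<sigma>)"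
    using assms(1) by (auto simp: complete_theory_def)
  ultimately show False using assms(3) M'(1) by (auto simp: entails_def)
qed

text \<open>Equations between ever higher variables already are infinitely many. With
  \<open>|formulas L| <o \<kappa>\<close> this makes \<open>\<kappa>\<close> infinite, so that
  finite sets and unions of two small sets are small.\<close>

lemma infinite_formulas:
  assumes "() \<in> sorts L"
  shows "infinite (formulas L :: (unit, 'f, 'r) fm set)"
proof
  assume fin: "finite (formulas L :: (unit, 'f, 'r) fm set)"
  let ?f = "\<lambda>i. Equal (Var i) (Var i) :: (unit, 'f, 'r) fm"
  have "?f i \<in> formulas L" for i
    using assms by (auto simp: formulas_def intro!: exI[of _ "units (Suc i)"])
  then have "range ?f \<subseteq> formulas L" by blast
  then have "finite (range ?f)" using fin finite_subset by blast
  moreover have "inj ?f" by (simp add: inj_def)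
  ultimately show False using finite_imageD infinite_UNIV_nat by blast
qed

section \<open>Affine maps over a field given on a carrier set\<close>

locale field_carrier =
  fixes K :: "'a set" and pl tm :: "'a \<Rightarrow> 'a \<Rightarrow> 'a" and ng :: "'a \<Rightarrow> 'a" and ze on :: 'a
  assumes cl: "ze \<in> K" "on \<in> K" "\<And>x y. x \<in> K \<Longrightarrow> y \<in> K \<Longrightarrow> pl x y \<in> K"
      "\<And>x y. x \<in> K \<Longrightarrow> y \<in> K \<Longrightarrow> tm x y \<in> K" "\<And>x. x \<in> K \<Longrightarrow> ng x \<in> K"
    and pl_assoc: "\<And>x y z. x \<in> K \<Longrightarrow> y \<in> K \<Longrightarrow> z \<in> K \<Longrightarrow> pl x (pl y z) = pl (pl x y) z"
    and pl_comm: "\<And>x y. x \<in> K \<Longrightarrow> y \<in> K \<Longrightarrow> pl x y = pl y x"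
    and pl_ze: "\<And>x. x \<in> K \<Longrightarrow> pl x ze = x"
    and pl_ng: "\<And>x. x \<in> K \<Longrightarrow> pl x (ng x) = ze"
    and tm_assoc: "\<And>x y z. x \<in> K \<Longrightarrow> y \<in> K \<Longrightarrow> z \<in> K \<Longrightarrow> tm x (tm y z) = tm (tm x y) z"
    and tm_comm: "\<And>x y. x \<in> K \<Longrightarrow> y \<in> K \<Longrightarrow> tm x y = tm y x"
    and tm_on: "\<And>x. x \<in> K \<Longrightarrow> tm x on = x"
    and distrib: "\<And>x y z. x \<in> K \<Longrightarrow> y \<in> K \<Longrightarrow> z \<in> K \<Longrightarrow> tm x (pl y z) = pl (tm x y) (tm x z)"
    and inverse: "\<And>x. x \<in> K \<Longrightarrow> x \<noteq> ze \<Longrightarrow> \<exists>y\<in>K. tm x y = on"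
begin

lemma pl_cancel: "x \<in> K \<Longrightarrow> y \<in> K \<Longrightarrow> z \<in> K \<Longrightarrow> pl x z = pl y z \<Longrightarrow> x = y"
  by (metis cl(5) pl_assoc pl_ng pl_ze)

lemma pl_cancel_left: "x \<in> K \<Longrightarrow> y \<in> K \<Longrightarrow> z \<in> K \<Longrightarrow> pl z x = pl z y \<Longrightarrow> x = y"
  by (metis pl_cancel pl_comm)

lemma tm_cancel: "x \<in> K \<Longrightarrow> y \<in> K \<Longrightarrow> z \<in> K \<Longrightarrow> z \<noteq> ze \<Longrightarrow> tm x z = tm y z \<Longrightarrow> x = y"
  by (metis inverse tm_assoc tm_on)

lemma tm_ze: "x \<in> K \<Longrightarrow> tm x ze = ze"
  by (metis cl(1) cl(4) distrib pl_cancel_left pl_ze)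

text \<open>With \<open>d = w - z\<close>, which is not zero, the two equations say that
  \<open>x + c d\<close> and \<open>x + c' d\<close> both equal \<open>y\<close>.\<close>

lemma affine_slope:
  assumes K: "x \<in> K" "y \<in> K" "z \<in> K" "w \<in> K" "c \<in> K" "c' \<in> K" and zw: "z \<noteq> w"
    and eqs: "pl x (tm c w) = pl y (tm c z)" "pl x (tm c' w) = pl y (tm c' z)"
  shows "c = c'"
proof -
  define d where "d = pl w (ng z)"
  have d: "d \<in> K" using K by (simp add: d_def cl)
  have "d \<noteq> ze"
  proof
    assume "d = ze"
    then have "pl w (ng z) = pl z (ng z)" using pl_ng K by (simp add: d_def)
    then show False using pl_cancel[of w z "ng z"] K zw by (simp add: cl)
  qed
  have *: "pl x (tm k d) = y" if k: "k \<in> K" "pl x (tm k w) = pl y (tm k z)" for k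
  proof -
    have "pl x (tm k d) = pl (pl x (tm k w)) (tm k (ng z))"
      using K k(1) by (simp add: d_def distrib pl_assoc cl)
    also have "\<dots> = pl y (pl (tm k z) (tm k (ng z)))" using K k by (simp add: pl_assoc cl)
    also have "pl (tm k z) (tm k (ng z)) = ze" using K k(1) by (simp add: distrib[symmetric] pl_ng tm_ze cl)
    finally show ?thesis using K by (simp add: pl_ze)
  qed
  have "pl x (tm c d) = pl x (tm c' d)" using * K eqs by simp
  then have "tm c d = tm c' d" by (rule pl_cancel_left[of _ _ x, rotated 3]) (use K d in \<open>simp_all add: cl\<close>)
  then show ?thesis using K d \<open>d \<noteq> ze\<close> by (intro tm_cancel[of c c' d])
qed

lemma affine_inj:
  assumes "x \<in> K" "c \<in> K" "w \<in> K" "z \<in> K" "c \<noteq> ze" "pl x (tm c w) = pl x (tm c z)"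
  shows "w = z"
proof -
  have "tm c w = tm c z" by (rule pl_cancel_left[of _ _ x, rotated 3]) (use assms in \<open>simp_all add: cl\<close>)
  then have "tm w c = tm z c" using assms(2-4) tm_comm[of c] by simp
  then show ?thesis using assms by (intro tm_cancel[of w z c])
qed

end

lemma field_model:
  fixes L :: "(unit, ring_sym + 'f, 'r) language" and M :: "(unit, ring_sym + 'f, 'r, 'a) struct"
  assumes "sublanguage ring_language L" "is_structure L M" "\<forall>\<sigma>\<in>field_axioms. sat M [] \<sigma>"
  shows "field_carrier (carrier M ()) (\<lambda>x y. fun_interp M (Inl Plus) [x, y])
    (\<lambda>x y. fun_interp M (Inl Times) [x, y]) (\<lambda>x. fun_interp M (Inl Minus) [x])
    (fun_interp M (Inl Zero) []) (fun_interp M (Inl One) [])"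
proof -
  have dom: "Inl f \<in> funs L" "fun_dom L (Inl f) = fun_dom ring_language (Inl f)" for f
    using assms(1) by (auto simp: sublanguage_def ring_language_def)
  have cl: "a \<in> tuples M (fun_dom ring_language (Inl f)) \<Longrightarrow> fun_interp M (Inl f) a \<in> carrier M ()" for f a
    using assms(2) dom[of f] unfolding is_structure_def by (metis (full_types) old.unit.exhaust)
  show ?thesis
  proof
    show "fun_interp M (Inl Zero) [] \<in> carrier M ()" by (rule cl) (simp add: ring_language_def)
    show "fun_interp M (Inl One) [] \<in> carrier M ()" by (rule cl) (simp add: ring_language_def)
    show "fun_interp M (Inl Plus) [x, y] \<in> carrier M ()" if "x \<in> carrier M ()" "y \<in> carrier M ()" for x y
      by (rule cl) (use that in \<open>simp add: ring_language_def\<close>)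
    show "fun_interp M (Inl Times) [x, y] \<in> carrier M ()" if "x \<in> carrier M ()" "y \<in> carrier M ()" for x y
      by (rule cl) (use that in \<open>simp add: ring_language_def\<close>)
    show "fun_interp M (Inl Minus) [x] \<in> carrier M ()" if "x \<in> carrier M ()" for x
      by (rule cl) (use that in \<open>simp add: ring_language_def\<close>)
    show "\<exists>y\<in>carrier M (). fun_interp M (Inl Times) [x, y] = fun_interp M (Inl One) []"
      if "x \<in> carrier M ()" "x \<noteq> fun_interp M (Inl Zero) []" for x
    proof -
      have "\<forall>x\<in>carrier M (). x = fun_interp M (Inl Zero) [] \<or>
          (\<exists>y\<in>carrier M (). fun_interp M (Inl Times) [x, y] = fun_interp M (Inl One) [])"
        using assms(3) by (simp add: field_axioms_def Let_def)
      then show ?thesis using that by blast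
    qed
  qed (use assms(3) in \<open>simp_all add: field_axioms_def Let_def\<close>)
qed

theorem theorem2p10:
  fixes L :: "(unit, ring_sym + 'f, 'r) language"
    and T :: "(unit, ring_sym + 'f, 'r) fm set"
    and \<kappa> :: "'k rel"
    and M :: "(unit, ring_sym + 'f, 'r, 'a) struct"
  assumes "sublanguage ring_language L"
    and "complete_theory TYPE('a) L T"
    and "has_infinite_models TYPE('a) L T"
    and "\<forall>\<sigma>\<in>field_axioms. entails TYPE('a) L T \<sigma>"
    and "monster_model L T \<kappa> M"
    and "pregeometric TYPE('a) L T"
    and "rosy L M"
  shows "surgical L \<kappa> M"
proof -
  have unit: "() \<in> sorts L" using assms(1) by (auto simp: sublanguage_def ring_language_def)
  have \<kappa>: "Card_order \<kappa>" "|formulas L| <o \<kappa>" "M \<in> Mod L T" "saturated L \<kappa> M"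
    using assms(5) by (auto simp: monster_model_def)
  have str: "is_structure L M" using \<kappa>(3) by (simp add: Mod_def)
  have "|formulas L| \<le>o |Field \<kappa>|"
    using \<kappa>(2) card_of_Field_ordIso[OF \<kappa>(1)] ordIso_symmetric ordLeq_ordIso_trans ordLess_imp_ordLeq by blast
  then have infk: "infinite (Field \<kappa>)" using infinite_formulas[OF unit] card_of_ordLeq_infinite by blast
  have exch: "acl_exchange L M" using assms(6) \<kappa>(3) by (simp add: pregeometric_def)
  have infM: "infinite (carrier M ())" by (rule complete_infinite[OF assms(2,3) \<kappa>(3) unit])
  interpret one_sorted L M by unfold_locales (use str unit in auto)
  interpret K: field_carrier "carrier M ()" "\<lambda>x y. fun_interp M (Inl Plus) [x, y]"
    "\<lambda>x y. fun_interp M (Inl Times) [x, y]" "\<lambda>x. fun_interp M (Inl Minus) [x]"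
    "fun_interp M (Inl Zero) []" "fun_interp M (Inl One) []"
    by (rule field_model[OF assms(1) str]) (use assms(4) \<kappa>(3) in \<open>auto simp: entails_def\<close>)
  define g :: "(ring_sym + 'f, 'r, 'a) eq_elem \<Rightarrow> (ring_sym + 'f, 'r, 'a) eq_elem \<Rightarrow>
    (ring_sym + 'f, 'r, 'a) eq_elem \<Rightarrow> (ring_sym + 'f, 'r, 'a) eq_elem" where "g x c w = Real (fun_interp M (Inl Plus)
    [the_real x, fun_interp M (Inl Times) [the_real c, the_real w]])" for x c w
  let ?t = "tplus (Var 0) (ttimes (Var 1) (Var 2)) :: (ring_sym + 'f) tm"
  have dom: "Inl f \<in> funs L" "fun_dom L (Inl f) = fun_dom ring_language (Inl f)" for f
    using assms(1) by (auto simp: sublanguage_def ring_language_def)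
  have t: "has_sort L [(), (), ()] ?t ()" "has_sort L [] tzero ()"
    using dom by (auto simp: ring_language_def nth_Cons')
  \<comment> \<open>The abstract argument is run in \<open>M\<^sup>e\<^sup>q\<close> with the reals
    as home sort. The properties of \<open>g\<close> are those of \<open>x + cw\<close> in the
    field, and every imaginary is represented because the projections are function symbols.\<close>
  interpret R: rosy_pregeometric_field LN N \<kappa> Home g "Real (fun_interp M (Inl Zero) [])"
  proof unfold_locales
    show "saturated LN \<kappa> N" by (rule saturated_eq[OF \<kappa>(4,1) infk])
    show "Home \<in> sorts LN" by simp
    show "infinite (carrier N Home)" using infM finite_imageD[of Real "carrier M ()"] by (auto simp: inj_on_def)
    show "finite_local_ranks LN N" using assms(7) by (simp add: rosy_def)
    show "\<exists>t. has_sort LN [Home, Home, Home] t Home \<and> (\<forall>x\<in>carrier N Home. \<forall>c\<in>carrier N Home.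
        \<forall>w\<in>carrier N Home. eval N [x, c, w] t = g x c w)"
    proof (intro exI[of _ "temb ?t"] conjI ballI)
      show "has_sort LN [Home, Home, Home] (temb ?t) Home" using has_sort_temb[OF t(1)] by simp
      fix x c w assume "x \<in> carrier N Home" "c \<in> carrier N Home" "w \<in> carrier N Home"
      then obtain x' c' w' where "x = Real x'" "c = Real c'" "w = Real w'" by auto
      then show "eval N [x, c, w] (temb ?t) = g x c w"
        using eval_temb[OF t(1), of "[x', c', w']"] by (simp add: g_def interp_Base)
    qed
    show "\<exists>t. has_sort LN [] t Home \<and> eval N [] t = Real (fun_interp M (Inl Zero) [])"
      using has_sort_temb[OF t(2)] eval_temb[OF t(2), of "[]"] by (intro exI[of _ "temb tzero"]) simp
    show "c = c'" if "{x, y, z, w, c, c'} \<subseteq> carrier N Home" "z \<noteq> w" "g x c w = g y c z" "g x c' w = g y c' z"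
      for x y z w c c'
    proof -
      have e: "z = Real (the_real z)" "w = Real (the_real w)" "c = Real (the_real c)" "c' = Real (the_real c')"
        and m: "the_real ` {x, y, z, w, c, c'} \<subseteq> carrier M ()" using that(1) by auto
      have n: "the_real z \<noteq> the_real w" using that(2) e by metis
      have "the_real c = the_real c'"
        by (rule K.affine_slope[of "the_real x" "the_real y" "the_real z" "the_real w"])
          (use m n that(3,4) in \<open>simp_all add: g_def\<close>)
      then show ?thesis using e by metis
    qed
    show "w = z" if "{x, c, w, z} \<subseteq> carrier N Home" "c \<noteq> Real (fun_interp M (Inl Zero) [])" "g x c w = g x c z"
      for x c w z
    proof -
      have e: "z = Real (the_real z)" "w = Real (the_real w)" "c = Real (the_real c)"
        and m: "the_real ` {x, c, w, z} \<subseteq> carrier M ()" using that(1) by auto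
      have n: "the_real c \<noteq> fun_interp M (Inl Zero) []" using that(2) e by metis
      have "the_real w = the_real z"
        by (rule K.affine_inj[of "the_real x" "the_real c"]) (use m n that(3) in \<open>simp_all add: g_def\<close>)
      then show ?thesis using e by metis
    qed
    show "x = y" if "{x, y, c, w} \<subseteq> carrier N Home" "g x c w = g y c w" for x y c w
    proof -
      have e: "x = Real (the_real x)" "y = Real (the_real y)"
        and m: "the_real ` {x, y, c, w} \<subseteq> carrier M ()" using that(1) by auto
      have "the_real x = the_real y"
        by (rule K.pl_cancel[of _ _ "fun_interp M (Inl Times) [the_real c, the_real w]"])
          (use m that(2) in \<open>simp_all add: g_def K.cl\<close>)
      then show ?thesis using e by metis
    qed
  qed (use \<kappa>(1) infk reps_eq exchange_eq[OF exch] in auto)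
  have "superrosy L \<kappa> M" unfolding superrosy_def using assms(7) R.has_ordinal_rank_all by auto
  moreover have "theory_thorn_rank L \<kappa> M 1" unfolding theory_thorn_rank_def
  proof (intro conjI ballI)
    show "\<exists>a\<in>carrier M (). rank_ge LN \<kappa> N 1 [Home] {} [Real a]"
      using R.rank_ge_1 by (simp del: rank_ge.simps One_nat_def)
    show "\<not> rank_ge LN \<kappa> N (Suc 1) [Home] {} [Real a]" if "a \<in> carrier M ()" for a
      using R.not_rank_ge_2[of "Real a" "{}"] that by (simp del: rank_ge.simps add: numeral_2_eq_2)
  qed
  ultimately show ?thesis by (simp add: surgical_def)
qed

end
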